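(* Let $\Omega\subset\mathbb{R}^3$ and consider the FETI-DP algorithm with the projector preconditioner $M_{PP}^{-1}$ enforcing the primal constraints chosen adaptively on all faces and edges with a given tolerance $\lambda_{TOL}$, as described in the context. Then $$\kappa\big(M_{PP}^{-1}F_{DP}\big)\le C\,\lambda_{TOL},$$ where $C$ is a constant depending only on the numbers $N_{F(i)}$ of faces per subdomain, $N_{E(i)}$ of edges per subdomain, and $N_{I(E)}$ of subdomains sharing an edge $E$; explicitly $$C=8\max\Big\{\max_i N_{F(i)}^2,\ \max_i\Big(N_{E(i)}^2\max_{E\in E(i)}N_{I(E)}\Big)\Big\}.$$
   Context: **Discretization.** $\Omega\subset\mathbb{R}^3$ is a bounded domain, $\rho$ is a uniformly positive coefficient (otherwise arbitrary), and $V_h$ is the space of conforming piecewise linear finite element functions on a given mesh of $\Omega$ vanishing on $\partial\Omega$. $\Omega$ is partitioned into non-overlapping subdomains $\Omega_1,\dots,\Omega_N$ that are unions of mesh elements. $X_i$ is the restriction of $V_h$ to $\Omega_i$ and $A^{(i)}$ is the matrix of $a_i(u,v)=\int_{\Omega_i}\rho\nabla u\cdot\nabla v\,dx$ on $X_i$. $W_i$ is the restriction of $X_i$ to $\partial\Omega_i$ (functions are identified with coefficient vectors), and $S^{(i)}$ is the Schur complement of $A^{(i)}$ obtained by eliminating the unknowns interior to $\Omega_i$. **Interface classes.** Interface nodes (not on $\partial\Omega$) are grouped into faces $F$ (equivalence classes shared by exactly two subdomains), edges $E$ (shared by more than two subdomains) and vertices (end points of edges). $F(i)$, $E(i)$ are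 the sets of faces and edges of $\partial\Omega_i$, with $N_{F(i)}=|F(i)|$, $N_{E(i)}=|E(i)|$. $I(E)$ is the set of indices of the subdomains sharing $E$, and $N_{I(E)}=|I(E)|$. For $w^{(i)}\in W_i$, $w_F^{(i)}$ and $w_E^{(i)}$ are its unknowns interior to $F$ and $E$. **Local matrices and scalings.** $S_F^{(i)}$, $S_E^{(i)}$ are the diagonal blocks of $S^{(i)}$ for the unknowns interior to $F$, $E$; $\widetilde S_F^{(i)}$, $\widetilde S_E^{(i)}$ are the Schur complements of $S^{(i)}$ after eliminating all unknowns except those interior to $F$, $E$. Scaling matrices $D_F^{(l)}$, $D_E^{(l)}$ satisfy $D_F^{(i)}+D_F^{(j)}=I$ for $F$ shared by $\Omega_i,\Omega_j$ and $\sum_{l\in I(E)}D_E^{(l)}=I$. For symmetric positive semidefinite $A,B$, the parallel sum is $A:B=B(A+B)^+A$, with $^+$ a pseudo-inverse. **Generalized eigenvalue problems.** For a face $F$ shared by $\Omega_i,\Omega_j$: $A_Fv=\lambda(\widetilde S_F^{(i)}:\widetilde S_F^{(j)})v$ with $A_F=(D_F^{(j)})^TS_F^{(i)}D_F^{(j)}+(D_F^{(i)})^TS_F^{(j)}D_F^{(i)}$. For an edge $E$: $A_Ev=\lambda\widetilde S_Ev$ with $A_E=\sum_{m\in I(E)}\sum_{l\in I(E)\setminus\{m\}}(D_E^{(l)})^TS_E^{(m)}D_E^{(l)}$ and $\widetilde S_E$ the parallel sum of all $\widetilde S_E^{(m)}$, $m\in I(E)$. $A_F$, $A_E$ are symmetric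 positive definite; eigenvalues lie in $(0,\infty]$, with $\lambda=\infty$ for vectors in the kernel of the right-hand matrix. On each $F$ (resp. $E$) a full basis of eigenvectors, orthonormal for $\langle A_F\cdot,\cdot\rangle$ (resp. $\langle A_E\cdot,\cdot\rangle$), is fixed. Selected eigenvectors: those with eigenvalue $\ge\lambda_{TOL}$ on faces and $>\lambda_{TOL}$ on edges. **FETI-DP.** $\widetilde W$ is the space of tuples $(w^{(1)},\dots,w^{(N)})\in\prod_iW_i$ continuous at the subdomain vertices (one common value at each vertex; these are the primal unknowns; all other unknowns are dual). $\widetilde S$ is defined on $\widetilde W$ by $\langle\widetilde Sw,z\rangle=\sum_i\langle S^{(i)}w^{(i)},z^{(i)}\rangle$ and is positive definite. $B$ is the matrix with entries $0,\pm1$, zero on primal unknowns, such that $Bw$ collects $w_F^{(i)}-w_F^{(j)}$ for every face $F$ shared by $\Omega_i,\Omega_j$ and $w_E^{(l)}-w_E^{(k)}$ for every edge $E$ and every pair $\{l,k\}\subset I(E)$ (fully redundant constraints). $B_D$ is obtained from $B$ by multiplying, in the columns of the dual unknowns of $\Omega_i$, the rows of the multipliers connecting $\Omega_i$ and $\Omega_l$ on $F$ (resp. $E$) by $(D_F^{(l)})^T$ (resp. $(D_E^{(l)})^T$). Set $F_{DP}=B\widetilde S^{-1}B^T$ and $M_{FETI}^{-1}=B_D\widetilde SB_D^T$. **Projector.** $U$ is the matrix with one column for each selected eigenvector $v$ on a face $F$ (resp. an edge $E$) and each pair of subdomains sharing it; this column has $A_Fv$ (resp. $A_Ev$) in the rows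 of the multipliers of that face (resp. edge) and pair, and zeros elsewhere. Thus $U^TBw=0$ means $\langle A_Fv,w_F^{(i)}-w_F^{(j)}\rangle=0$ and $\langle A_Ev,w_E^{(l)}-w_E^{(k)}\rangle=0$ for all selected $v$ and all pairs. The projection $P$ is $P=U(U^TF_{DP}U)^{-1}U^TF_{DP}$. $P_B$ is the orthogonal projection onto $\mathrm{Range}(B)$, and $M_{PP}^{-1}=P_B^T(I-P)M_{FETI}^{-1}(I-P)^TP_B$. $\kappa(M_{PP}^{-1}F_{DP})$ is the ratio of the largest to the smallest nonzero eigenvalue of $M_{PP}^{-1}F_{DP}$.
   Formalization: In the projection P the inverse of U^T F_DP U is read as the Moore-Penrose pseudo-inverse, since with fully redundant edge constraints that matrix is singular once an edge eigenvector is selected; kappa is considered only if a nonzero eigenvalue exists. *)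

theory Defs
  imports "HOL-Analysis.Analysis"
begin

section \<open>Matrices over finite index sets\<close>

text \<open>
  The rows and columns of the matrices below are labelled by mesh nodes, by pairs (subdomain, node),
  by Lagrange multipliers etc.  A matrix is therefore a function of two labels, read on explicitly
  given finite index sets; a vector is a function of one label.
\<close>

type_synonym ('a, 'b) fmat = "'a \<Rightarrow> 'b \<Rightarrow> real"

definition mtr :: "('a, 'b) fmat \<Rightarrow> ('b, 'a) fmat" where
  "mtr A = (\<lambda>i j. A j i)"

text \<open>In \<open>mm K A B\<close> and \<open>mv K A x\<close> the set \<open>K\<close> is the index set summed over.\<close>

definition mm :: "'b set \<Rightarrow> ('a, 'b) fmat \<Rightarrow> ('b, 'c) fmat \<Rightarrow> ('a, 'c) fmat" where
  "mm K A B = (\<lambda>i j. \<Sum>k\<in>K. A i k * B k j)"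

definition mv :: "'b set \<Rightarrow> ('a, 'b) fmat \<Rightarrow> ('b \<Rightarrow> real) \<Rightarrow> 'a \<Rightarrow> real" where
  "mv K A x = (\<lambda>i. \<Sum>k\<in>K. A i k * x k)"

definition dotp :: "'a set \<Rightarrow> ('a \<Rightarrow> real) \<Rightarrow> ('a \<Rightarrow> real) \<Rightarrow> real" where
  "dotp K x y = (\<Sum>k\<in>K. x k * y k)"

definition unit_mat :: "('a, 'a) fmat" where
  "unit_mat = (\<lambda>i j. if i = j then 1 else 0)"

definition pos_def :: "'a set \<Rightarrow> ('a, 'a) fmat \<Rightarrow> bool" where
  "pos_def K A \<longleftrightarrow> (\<forall>x. (\<exists>k\<in>K. x k \<noteq> 0) \<longrightarrow> dotp K (mv K A x) x > 0)"

text \<open>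
  The Moore--Penrose pseudo-inverse of the matrix \<open>A\<close> on \<open>K \<times> K\<close>, set to zero outside of
  \<open>K \<times> K\<close>.  It is also written for inverses (cf. \<open>pinv_eq_inverse\<close>).
\<close>

definition is_pinv :: "'a set \<Rightarrow> ('a, 'a) fmat \<Rightarrow> ('a, 'a) fmat \<Rightarrow> bool" where
  "is_pinv K A G \<longleftrightarrow>
     (\<forall>i j. i \<notin> K \<or> j \<notin> K \<longrightarrow> G i j = 0) \<and>
     (\<forall>i\<in>K. \<forall>j\<in>K.
        mm K A (mm K G A) i j = A i j \<and>
        mm K G (mm K A G) i j = G i j \<and>
        mm K A G i j = mm K A G j i \<and>
        mm K G A i j = mm K G A j i)"

definition pinv :: "'a set \<Rightarrow> ('a, 'a) fmat \<Rightarrow> ('a, 'a) fmat" where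
  "pinv K A = (THE G. is_pinv K A G)"

lemma mm_assoc:
  assumes "finite K" "finite L"
  shows "mm K A (mm L B C) = mm L (mm K A B) C"
  unfolding mm_def
  by (auto simp: fun_eq_iff sum_distrib_left sum_distrib_right mult.assoc
      intro: sum.swap)

lemma mm_cong:
  assumes "\<And>k. k \<in> K \<Longrightarrow> A i k = A' i k" "\<And>k. k \<in> K \<Longrightarrow> B k j = B' k j"
  shows "mm K A B i j = mm K A' B' i j"
  unfolding mm_def using assms by (intro sum.cong) auto

lemma mm_unit:
  assumes "finite K"
  shows "i \<in> K \<Longrightarrow> mm K unit_mat A i j = A i j" "j \<in> K \<Longrightarrow> mm K A unit_mat i j = A i j"
proof -
  have "(\<Sum>k\<in>K. (if i = k then 1 else 0) * A k j) = (\<Sum>k\<in>K. if i = k then A k j else 0)"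
    by (intro sum.cong) auto
  then show "i \<in> K \<Longrightarrow> mm K unit_mat A i j = A i j"
    using assms by (simp add: mm_def unit_mat_def)
  have "(\<Sum>k\<in>K. A i k * (if k = j then 1 else 0)) = (\<Sum>k\<in>K. if k = j then A i k else 0)"
    by (intro sum.cong) auto
  then show "j \<in> K \<Longrightarrow> mm K A unit_mat i j = A i j"
    using assms by (simp add: mm_def unit_mat_def)
qed

lemma pinv_eq_inverse:
  assumes K: "finite K"
    and supp: "\<And>i j. i \<notin> K \<or> j \<notin> K \<Longrightarrow> G i j = 0"
    and AG: "\<And>i j. i \<in> K \<Longrightarrow> j \<in> K \<Longrightarrow> mm K A G i j = unit_mat i j"
    and GA: "\<And>i j. i \<in> K \<Longrightarrow> j \<in> K \<Longrightarrow> mm K G A i j = unit_mat i j"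
  shows "pinv K A = G"
  unfolding pinv_def
proof (rule the_equality)
  have 1: "mm K A (mm K G A) i j = A i j" "mm K G (mm K A G) i j = G i j"
    if "i \<in> K" "j \<in> K" for i j
  proof -
    have "mm K A (mm K G A) i j = mm K A unit_mat i j"
      using GA that by (intro mm_cong) auto
    then show "mm K A (mm K G A) i j = A i j"
      using mm_unit(2)[OF K, of j A i] that by simp
    have "mm K G (mm K A G) i j = mm K G unit_mat i j"
      using AG that by (intro mm_cong) auto
    then show "mm K G (mm K A G) i j = G i j"
      using mm_unit(2)[OF K, of j G i] that by simp
  qed
  then show "is_pinv K A G"
    using supp AG GA by (auto simp: is_pinv_def unit_mat_def)
next
  fix H assume H: "is_pinv K A H"
  show "H = G"
  proof (intro ext)
    fix i j
    show "H i j = G i j"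
    proof (cases "i \<in> K \<and> j \<in> K")
      case False
      then show ?thesis using H supp by (auto simp: is_pinv_def)
    next
      case True
      then have i: "i \<in> K" and j: "j \<in> K" by auto
      have "mm K G (mm K (mm K A (mm K H A)) G) i j = mm K G (mm K A G) i j"
      proof (rule mm_cong)
        fix k assume k: "k \<in> K"
        show "mm K (mm K A (mm K H A)) G k j = mm K A G k j"
          using H k by (intro mm_cong) (auto simp: is_pinv_def)
      qed simp
      moreover have "mm K G (mm K (mm K A (mm K H A)) G) = mm K (mm K G A) (mm K H (mm K A G))"
        using K by (simp add: mm_assoc)
      moreover have "mm K (mm K G A) (mm K H (mm K A G)) i j = mm K unit_mat (mm K H unit_mat) i j"
        using AG GA i j by (intro mm_cong) auto
      moreover have "mm K unit_mat (mm K H unit_mat) i j = H i j"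
        using mm_unit(1)[OF K i, of "mm K H unit_mat" j] mm_unit(2)[OF K j, of H i] by simp
      moreover have "mm K G (mm K A G) i j = mm K G unit_mat i j"
        using AG j by (intro mm_cong) auto
      moreover have "mm K G unit_mat i j = G i j"
        using mm_unit(2)[OF K j, of G i] .
      ultimately show ?thesis by simp
    qed
  qed
qed

text \<open>
  Schur complement on the unknowns \<open>K\<close> after elimination of the unknowns \<open>L\<close>.  For a positive
  semidefinite matrix whose block on \<open>L\<close> is singular, the pseudo-inverse still gives the
  energy-minimal extension.
\<close>

definition schur :: "'a set \<Rightarrow> ('a, 'a) fmat \<Rightarrow> ('a, 'a) fmat" where
  "schur L A = (\<lambda>i j. A i j - mm L A (mm L (pinv L A) A) i j)"

definition par_sum :: "'a set \<Rightarrow> ('a, 'a) fmat \<Rightarrow> ('a, 'a) fmat \<Rightarrow> ('a, 'a) fmat" where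
  "par_sum K A B = mm K B (mm K (pinv K (\<lambda>i j. A i j + B i j)) A)"

text \<open>
  The parallel sum is associative and commutative on symmetric positive semidefinite matrices, so
  the order of the list does not matter there.
\<close>

fun par_sum_list :: "'a set \<Rightarrow> ('a, 'a) fmat list \<Rightarrow> ('a, 'a) fmat" where
  "par_sum_list K [] = (\<lambda>i j. 0)"
| "par_sum_list K [A] = A"
| "par_sum_list K (A # B # As) = par_sum K A (par_sum_list K (B # As))"

definition mat_range :: "'a set \<Rightarrow> 'b set \<Rightarrow> ('a, 'b) fmat \<Rightarrow> ('a \<Rightarrow> real) set" where
  "mat_range K L A = {\<lambda>i. if i \<in> K then mv L A x i else 0 | x. True}"

definition is_orth_proj :: "'a set \<Rightarrow> ('a \<Rightarrow> real) set \<Rightarrow> ('a, 'a) fmat \<Rightarrow> bool" where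
  "is_orth_proj K R Q \<longleftrightarrow>
     (\<forall>i j. i \<notin> K \<or> j \<notin> K \<longrightarrow> Q i j = 0) \<and>
     (\<forall>x. mv K Q x \<in> R \<and> (\<forall>y\<in>R. dotp K (\<lambda>i. x i - mv K Q x i) y = 0))"

definition orth_proj :: "'a set \<Rightarrow> ('a \<Rightarrow> real) set \<Rightarrow> ('a, 'a) fmat" where
  "orth_proj K R = (THE Q. is_orth_proj K R Q)"

text \<open>
  Real eigenvalues; the matrix of interest is a product of two symmetric positive semidefinite
  matrices and has no others.
\<close>

definition eigenvalues :: "'a set \<Rightarrow> ('a, 'a) fmat \<Rightarrow> real set" where
  "eigenvalues K A = {\<mu>. \<exists>x. (\<exists>i\<in>K. x i \<noteq> 0) \<and> (\<forall>i\<in>K. mv K A x i = \<mu> * x i)}"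

definition nonzero_eigenvalues :: "'a set \<Rightarrow> ('a, 'a) fmat \<Rightarrow> real set" where
  "nonzero_eigenvalues K A = eigenvalues K A - {0}"

definition cond_number :: "'a set \<Rightarrow> ('a, 'a) fmat \<Rightarrow> real" where
  "cond_number K A = Max (nonzero_eigenvalues K A) / Min (nonzero_eigenvalues K A)"

text \<open>Eigenpairs of \<open>A v = \<mu> S v\<close> with \<open>\<mu> \<in> (0,\<infinity>]\<close>.\<close>

definition gen_eigenpair ::
    "'a set \<Rightarrow> ('a, 'a) fmat \<Rightarrow> ('a, 'a) fmat \<Rightarrow> ereal \<Rightarrow> ('a \<Rightarrow> real) \<Rightarrow> bool" where
  "gen_eigenpair K A S \<mu> v \<longleftrightarrow>
     (\<exists>k\<in>K. v k \<noteq> 0) \<and>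
     ((\<mu> = \<infinity> \<and> (\<forall>k\<in>K. mv K S v k = 0)) \<or>
      (\<exists>r>0. \<mu> = ereal r \<and> (\<forall>k\<in>K. mv K A v k = r * mv K S v k)))"


section \<open>Mesh, subdomains and interface\<close>

type_synonym pt = "real ^ 3"

definition grad :: "(pt \<Rightarrow> real) \<Rightarrow> pt \<Rightarrow> pt" where
  "grad u x = (THE g. GDERIV u x :> g)"

text \<open>
  A tetrahedron is represented by the set of its four vertices.  \<open>sub i\<close> is the set of mesh
  elements making up the \<open>i\<close>-th subdomain.
\<close>

locale decomposed_mesh =
  fixes \<Omega> :: "pt set"
    and T :: "pt set set"
    and N :: nat
    and sub :: "nat \<Rightarrow> pt set set"
  assumes dom: "open \<Omega>" "connected \<Omega>" "bounded \<Omega>" "\<Omega> \<noteq> {}"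
    and finite_mesh: "finite T"
    and tetrahedra: "\<And>K. K \<in> T \<Longrightarrow> card K = 4 \<and> \<not> affine_dependent K"
    and conforming: "\<And>K L. K \<in> T \<Longrightarrow> L \<in> T \<Longrightarrow>
          convex hull K \<inter> convex hull L = convex hull (K \<inter> L)"
    and covers: "closure \<Omega> = (\<Union>K\<in>T. convex hull K)"
    and boundary_resolved: "\<exists>\<B> \<subseteq> {f. card f = 3 \<and> (\<exists>K\<in>T. f \<subseteq> K)}.
          frontier \<Omega> = (\<Union>f\<in>\<B>. convex hull f)"
    and sub_cover: "(\<Union>i\<in>{1..N}. sub i) = T"
    and sub_disjoint: "disjoint_family_on sub {1..N}"
    and sub_nonempty: "\<And>i. i \<in> {1..N} \<Longrightarrow> sub i \<noteq> {}"
begin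

definition nodes :: "pt set" where
  "nodes = \<Union>T"

definition subdom :: "nat \<Rightarrow> pt set" where
  "subdom i = \<Omega> \<inter> interior (\<Union>K\<in>sub i. convex hull K)"

text \<open>Functions in \<open>V\<^sub>h\<close> are extended by zero to the whole space.\<close>

definition V\<^sub>h :: "(pt \<Rightarrow> real) set" where
  "V\<^sub>h = {u. continuous_on UNIV u \<and> (\<forall>x. x \<notin> \<Omega> \<longrightarrow> u x = 0) \<and>
          (\<forall>K\<in>T. \<exists>g c. \<forall>x\<in>convex hull K. u x = g \<bullet> x + c)}"

text \<open>The nodal basis function of a node \<open>p \<in> \<Omega>\<close>.\<close>

definition hat :: "pt \<Rightarrow> pt \<Rightarrow> real" where
  "hat p = (THE u. u \<in> V\<^sub>h \<and> (\<forall>q\<in>nodes. u q = (if q = p then 1 else 0)))"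

text \<open>
  Index sets of the coefficient vectors of \<open>X\<^sub>i\<close> and of \<open>W\<^sub>i\<close>.  A node does not lie on the
  boundary of \<open>\<Omega>\<close> iff it lies in \<open>\<Omega>\<close>.
\<close>

definition X_nodes :: "nat \<Rightarrow> pt set" where
  "X_nodes i = nodes \<inter> \<Omega> \<inter> closure (subdom i)"

definition W_nodes :: "nat \<Rightarrow> pt set" where
  "W_nodes i = nodes \<inter> \<Omega> \<inter> frontier (subdom i)"

definition interface :: "pt set" where
  "interface = \<Omega> \<inter> (\<Union>i\<in>{1..N}. frontier (subdom i))"

definition sharing_pt :: "pt \<Rightarrow> nat set" where
  "sharing_pt x = {i\<in>{1..N}. x \<in> closure (subdom i)}"

text \<open>
  The equivalence class of an interface point: two points are equivalent if they are shared by the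
  same subdomains and can be connected within the set of interface points shared by exactly these.
\<close>

definition stratum :: "pt \<Rightarrow> pt set" where
  "stratum x = connected_component_set {y\<in>interface. sharing_pt y = sharing_pt x} x"

text \<open>
  Classes shared by more than two subdomains are unions of relatively open mesh edges and of nodes;
  the points which such a class accumulates at but does not contain are its end points.
\<close>

definition vertices :: "pt set" where
  "vertices = {p\<in>nodes \<inter> interface. \<exists>x\<in>interface.
      card (sharing_pt x) > 2 \<and> p \<in> closure (stratum x) - stratum x}"

text \<open>Faces and edges as sets of (interior) nodes.\<close>

definition faces :: "pt set set" where
  "faces = {nodes \<inter> stratum x | x. x \<in> nodes \<inter> interface \<and> card (sharing_pt x) = 2}"

definition edges :: "pt set set" where
  "edges = {nodes \<inter> stratum x - vertices | x.
      x \<in> nodes \<inter> interface - vertices \<and> card (sharing_pt x) > 2}"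

text \<open>The index set \<open>I(Z)\<close> of the subdomains sharing a face or edge \<open>Z\<close>.\<close>

definition sharing :: "pt set \<Rightarrow> nat set" where
  "sharing Z = {i\<in>{1..N}. Z \<subseteq> closure (subdom i)}"

definition faces_of :: "nat \<Rightarrow> pt set set" where
  "faces_of i = {F\<in>faces. i \<in> sharing F}"

definition edges_of :: "nat \<Rightarrow> pt set set" where
  "edges_of i = {E\<in>edges. i \<in> sharing E}"

text \<open>
  If \<open>edges_of i\<close> is empty, the (then meaningless) inner maximum is multiplied by zero.
\<close>

definition C_const :: real where
  "C_const = 8 * real (max
     (MAX i\<in>{1..N}. card (faces_of i) ^ 2)
     (MAX i\<in>{1..N}. card (edges_of i) ^ 2 * (MAX E\<in>edges_of i. card (sharing E))))"

end


section \<open>The FETI-DP system\<close>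

text \<open>
  Indices of the unknowns of the partially assembled space: \<open>Dual i p\<close> is the unknown of
  subdomain \<open>i\<close> at the node \<open>p\<close>, \<open>Primal p\<close> the common value at the vertex \<open>p\<close>.
\<close>

datatype dof = Dual nat pt | Primal pt

text \<open>
  \<open>(Z, (l, k), p)\<close>, with \<open>l < k\<close>, is the multiplier for the jump between the subdomains \<open>l\<close> and
  \<open>k\<close> at the node \<open>p\<close> of the face or edge \<open>Z\<close>.
\<close>

type_synonym multiplier = "pt set \<times> (nat \<times> nat) \<times> pt"

locale feti_dp = decomposed_mesh \<Omega> T N sub
  for \<Omega> :: "pt set" and T :: "pt set set" and N :: nat and sub :: "nat \<Rightarrow> pt set set" +
  fixes \<rho> :: "pt \<Rightarrow> real"
    and D :: "pt set \<Rightarrow> nat \<Rightarrow> (pt, pt) fmat"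
  assumes rho_integrable: "set_integrable lebesgue \<Omega> \<rho>"
    and rho_uniformly_positive: "\<exists>\<rho>\<^sub>0>0. AE x in lebesgue. x \<in> \<Omega> \<longrightarrow> \<rho>\<^sub>0 \<le> \<rho> x"
    and scaling: "\<And>Z p q. Z \<in> faces \<union> edges \<Longrightarrow> p \<in> Z \<Longrightarrow> q \<in> Z \<Longrightarrow>
          (\<Sum>l\<in>sharing Z. D Z l p q) = unit_mat p q"
begin

definition energy :: "nat \<Rightarrow> (pt \<Rightarrow> real) \<Rightarrow> (pt \<Rightarrow> real) \<Rightarrow> real" where
  "energy i u v = (LINT x:subdom i|lebesgue. \<rho> x * (grad u x \<bullet> grad v x))"

definition A_loc :: "nat \<Rightarrow> (pt, pt) fmat" where
  "A_loc i = (\<lambda>p q. energy i (hat p) (hat q))"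

definition S_loc :: "nat \<Rightarrow> (pt, pt) fmat" where
  "S_loc i = schur (X_nodes i - W_nodes i) (A_loc i)"

definition S_tilde_loc :: "nat \<Rightarrow> pt set \<Rightarrow> (pt, pt) fmat" where
  "S_tilde_loc i Z = schur (W_nodes i - Z) (S_loc i)"

text \<open>
  The two sides of the generalized eigenvalue problem on a face or edge \<open>Z\<close>.  For a face shared by
  the subdomains \<open>i\<close> and \<open>j\<close> the double sum has the two terms \<open>(m, l) = (i, j)\<close> and
  \<open>(m, l) = (j, i)\<close>.  The block of \<open>S_loc m\<close> on \<open>Z\<close> is selected by the index set of the products.
\<close>

definition A_Z :: "pt set \<Rightarrow> (pt, pt) fmat" where
  "A_Z Z = (\<lambda>p q. \<Sum>m\<in>sharing Z. \<Sum>l\<in>sharing Z - {m}.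
              mm Z (mtr (D Z l)) (mm Z (S_loc m) (D Z l)) p q)"

definition S_Z :: "pt set \<Rightarrow> (pt, pt) fmat" where
  "S_Z Z = par_sum_list Z (map (\<lambda>m. S_tilde_loc m Z) (sorted_list_of_set (sharing Z)))"

definition dofs :: "dof set" where
  "dofs = {Dual i p | i p. i \<in> {1..N} \<and> p \<in> W_nodes i - vertices} \<union> Primal ` vertices"

definition restr :: "nat \<Rightarrow> (dof \<Rightarrow> real) \<Rightarrow> pt \<Rightarrow> real" where
  "restr i w = (\<lambda>p. if p \<in> vertices then w (Primal p) else w (Dual i p))"

definition S_tilde :: "(dof, dof) fmat" where
  "S_tilde = (\<lambda>\<alpha> \<beta>. \<Sum>i\<in>{1..N}.
      dotp (W_nodes i) (mv (W_nodes i) (S_loc i) (restr i (unit_mat \<beta>))) (restr i (unit_mat \<alpha>)))"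

definition mults :: "multiplier set" where
  "mults = {(Z, (l, k), p) | Z l k p.
      Z \<in> faces \<union> edges \<and> l \<in> sharing Z \<and> k \<in> sharing Z \<and> l < k \<and> p \<in> Z}"

text \<open>In the row \<open>(Z, (l, k), p)\<close> the jump is the value on \<open>l\<close> minus the value on \<open>k\<close>.\<close>

definition B :: "(multiplier, dof) fmat" where
  "B = (\<lambda>(Z, (l, k), p) \<beta>. case \<beta> of
          Dual i q \<Rightarrow> if q = p then (if i = l then 1 else if i = k then - 1 else 0) else 0
        | Primal q \<Rightarrow> 0)"

text \<open>
  In the columns of subdomain \<open>l\<close> the block of rows belonging to \<open>Z\<close> and \<open>{l, k}\<close> is multiplied by
  the transposed scaling matrix of the other subdomain \<open>k\<close>, and vice versa.
\<close>

definition B_D :: "(multiplier, dof) fmat" where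
  "B_D = (\<lambda>(Z, (l, k), p) \<beta>. case \<beta> of
          Dual i q \<Rightarrow>
            \<Sum>r\<in>Z. mtr (D Z (if i = l then k else l)) p r * B (Z, (l, k), r) (Dual i q)
        | Primal q \<Rightarrow> 0)"

definition F_DP :: "(multiplier, multiplier) fmat" where
  "F_DP = mm dofs B (mm dofs (pinv dofs S_tilde) (mtr B))"

definition M_FETI :: "(multiplier, multiplier) fmat" where
  "M_FETI = mm dofs B_D (mm dofs S_tilde (mtr B_D))"

definition P_B :: "(multiplier, multiplier) fmat" where
  "P_B = orth_proj mults (mat_range mults dofs B)"

end


section \<open>The adaptive coarse space and the projector preconditioner\<close>

text \<open>
  \<open>ev Z k\<close> and \<open>lam Z k\<close>, for \<open>k < card Z\<close>, are the fixed eigenvectors and eigenvalues on the face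
  or edge \<open>Z\<close>; \<open>card Z\<close> orthonormal vectors form a full basis.
\<close>

locale adaptive_feti_dp = feti_dp \<Omega> T N sub \<rho> D
  for \<Omega> :: "pt set" and T :: "pt set set" and N :: nat and sub :: "nat \<Rightarrow> pt set set"
    and \<rho> :: "pt \<Rightarrow> real" and D :: "pt set \<Rightarrow> nat \<Rightarrow> (pt, pt) fmat" +
  fixes ev :: "pt set \<Rightarrow> nat \<Rightarrow> pt \<Rightarrow> real"
    and lam :: "pt set \<Rightarrow> nat \<Rightarrow> ereal"
    and tol :: real
  assumes S_tilde_pos_def: "pos_def dofs S_tilde"
    and eigenpairs: "\<And>Z k. Z \<in> faces \<union> edges \<Longrightarrow> k < card Z \<Longrightarrow>
          gen_eigenpair Z (A_Z Z) (S_Z Z) (lam Z k) (ev Z k)"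
    and orthonormal: "\<And>Z k l. Z \<in> faces \<union> edges \<Longrightarrow> k < card Z \<Longrightarrow> l < card Z \<Longrightarrow>
          dotp Z (mv Z (A_Z Z) (ev Z k)) (ev Z l) = unit_mat k l"
begin

definition selected :: "pt set \<Rightarrow> nat set" where
  "selected Z = {k. k < card Z \<and>
      (Z \<in> faces \<and> lam Z k \<ge> ereal tol \<or> Z \<in> edges \<and> lam Z k > ereal tol)}"

definition cols :: "(pt set \<times> (nat \<times> nat) \<times> nat) set" where
  "cols = {(Z, (l, k), s) | Z l k s.
      Z \<in> faces \<union> edges \<and> l \<in> sharing Z \<and> k \<in> sharing Z \<and> l < k \<and> s \<in> selected Z}"

definition U :: "(multiplier, pt set \<times> (nat \<times> nat) \<times> nat) fmat" where
  "U = (\<lambda>(Z, lk, p) (Z', lk', s).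
          if Z = Z' \<and> lk = lk' then mv Z (A_Z Z) (ev Z s) p else 0)"

text \<open>
  With fully redundant constraints on an edge the columns of \<open>U\<close> for the different pairs of
  subdomains are dependent modulo the kernel of the transpose of \<open>B\<close>, so that the matrix inverted
  here is singular as soon as an edge eigenvector is selected; hence the pseudo-inverse.
  The preconditioner \<open>M_PP\<close> does not depend on the choice of the pseudo-inverse.
\<close>

definition P :: "(multiplier, multiplier) fmat" where
  "P = mm cols U (mm cols
         (pinv cols (mm mults (mtr U) (mm mults F_DP U)))
         (mm mults (mtr U) F_DP))"

definition M_PP :: "(multiplier, multiplier) fmat" where
  "M_PP = (let IP = (\<lambda>m n. unit_mat m n - P m n) in
     mm mults (mtr P_B) (mm mults IP (mm mults M_FETI (mm mults (mtr IP) P_B))))"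

definition preconditioned_system :: "(multiplier, multiplier) fmat" where
  "preconditioned_system = mm mults M_PP F_DP"

end

end

theory Submission
  imports Defs
begin

text \<open>
  The nonzero eigenvalues of the preconditioned system are Rayleigh quotients
  \<open>|P_D w|\<^sup>2 / |w|\<^sup>2\<close> of the jump operator \<open>P_D = B_D\<^sup>T B\<close> in the norm of \<open>S_tilde\<close>, taken at
  functions \<open>w\<close> whose jumps are orthogonal to all selected eigenvectors
  (\<open>nonzero_eigenvalue_bounds\<close>).  Since the scaling matrices form a partition of unity, \<open>P_D w\<close> has
  the same jumps as \<open>w\<close> (\<open>jump_P_D\<close>), and a comparison of \<open>|w|\<^sup>2\<close> with the inner product of \<open>w\<close> and
  \<open>P_D w\<close> shows that these quotients are at least 1.  It remains to bound them from above
  by \<open>C_const * tol\<close> (\<open>P_D_energy_bound\<close>).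

  On a single face or edge \<open>Z\<close> the values of \<open>P_D w\<close> are weighted jumps of traces.  A jump that is
  orthogonal to the selected eigenvectors is the difference of the projections of the two traces
  onto the remaining eigenvectors.  On these the energy for \<open>A_Z\<close> is at most \<open>tol\<close> times the energy
  for the parallel sum \<open>S_Z\<close> (\<open>unselected_part_energy\<close>), the parallel sum is bounded by each of its
  summands (\<open>par_sum_list_psd_le\<close>), and the summand of a subdomain, being a Schur complement, is
  bounded by the energy of the subdomain (\<open>schur_le\<close>).  This gives the factor \<open>2 (n - 1) tol\<close> for
  \<open>n\<close> subdomains sharing \<open>Z\<close> (\<open>weighted_jump_energy\<close>); a face is the case \<open>n = 2\<close>.  Summation over
  the faces and edges of all subdomains (\<open>overlap_sum_bound\<close>) leads to the constant.

  Two kinds of groundwork are needed.  The linear algebra (pseudo-inverses of symmetric matrices,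
  Schur complements, parallel sums, finiteness of the spectrum) is done with bilinear forms
  \<open>bil K A x y\<close> on an explicit finite index set \<open>K\<close>.  The geometry of the mesh enters through the
  existence of the nodal basis functions, which makes the local stiffness matrices positive
  semidefinite (\<open>A_loc_psd\<close>), and through the disjointness of the subdomains, which makes every node
  of a face or edge an interface unknown of each subdomain sharing it
  (\<open>face_or_edge_subset_W_nodes\<close>).
\<close>

section \<open>Matrices and bilinear forms on finite index sets\<close>

definition bil :: "'a set \<Rightarrow> ('a, 'a) fmat \<Rightarrow> ('a \<Rightarrow> real) \<Rightarrow> ('a \<Rightarrow> real) \<Rightarrow> real" where
  "bil K A x y = dotp K (mv K A x) y"

definition symmetric_on :: "'a set \<Rightarrow> ('a, 'a) fmat \<Rightarrow> bool" where
  "symmetric_on K A \<longleftrightarrow> (\<forall>i\<in>K. \<forall>j\<in>K. A i j = A j i)"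

definition psd_on :: "'a set \<Rightarrow> ('a, 'a) fmat \<Rightarrow> bool" where
  "psd_on K A \<longleftrightarrow> symmetric_on K A \<and> (\<forall>x. 0 \<le> bil K A x x)"

lemma psd_onD: "psd_on K A \<Longrightarrow> symmetric_on K A" "psd_on K A \<Longrightarrow> 0 \<le> bil K A x x"
  by (auto simp: psd_on_def)

lemma dotp_cong: "(\<And>i. i \<in> K \<Longrightarrow> x i = x' i) \<Longrightarrow> (\<And>i. i \<in> K \<Longrightarrow> y i = y' i) \<Longrightarrow> dotp K x y = dotp K x' y'"
  unfolding dotp_def by (rule sum.cong) auto

lemma mv_cong: "(\<And>k. k \<in> K \<Longrightarrow> A i k = A' i k) \<Longrightarrow> (\<And>k. k \<in> K \<Longrightarrow> x k = x' k) \<Longrightarrow> mv K A x i = mv K A' x' i"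
  unfolding mv_def by (rule sum.cong) auto

lemma bil_cong:
  "(\<And>i. i \<in> K \<Longrightarrow> x i = x' i) \<Longrightarrow> (\<And>i. i \<in> K \<Longrightarrow> y i = y' i) \<Longrightarrow> bil K A x y = bil K A x' y'"
  unfolding bil_def by (intro dotp_cong mv_cong) auto

lemma dotp_commute: "dotp K x y = dotp K y x"
  by (simp add: dotp_def mult.commute)

lemma dotp_add: "dotp K (\<lambda>i. x i + y i) z = dotp K x z + dotp K y z"
    "dotp K z (\<lambda>i. x i + y i) = dotp K z x + dotp K z y"
  and dotp_diff: "dotp K (\<lambda>i. x i - y i) z = dotp K x z - dotp K y z"
    "dotp K z (\<lambda>i. x i - y i) = dotp K z x - dotp K z y"
  and dotp_scale: "dotp K (\<lambda>i. c * x i) z = c * dotp K x z"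
    "dotp K z (\<lambda>i. c * x i) = c * dotp K z x"
  and dotp_sum: "dotp K (\<lambda>i. \<Sum>j\<in>J. f j i) z = (\<Sum>j\<in>J. dotp K (f j) z)"
    "dotp K z (\<lambda>i. \<Sum>j\<in>J. f j i) = (\<Sum>j\<in>J. dotp K z (f j))"
  by (auto simp: dotp_def algebra_simps sum.distrib sum_subtractf sum_distrib_left sum_distrib_right
      intro: sum.swap)

lemma mv_add: "mv K A (\<lambda>i. x i + y i) = (\<lambda>i. mv K A x i + mv K A y i)"
  and mv_diff: "mv K A (\<lambda>i. x i - y i) = (\<lambda>i. mv K A x i - mv K A y i)"
  and mv_scale: "mv K A (\<lambda>i. c * x i) = (\<lambda>i. c * mv K A x i)"
  and mv_sum: "mv K A (\<lambda>i. \<Sum>j\<in>J. f j i) = (\<lambda>i. \<Sum>j\<in>J. mv K A (f j) i)"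
  by (auto simp: mv_def fun_eq_iff algebra_simps sum.distrib sum_subtractf sum_distrib_left
      intro: sum.swap)

lemma mv_zero: "mv K A (\<lambda>i. 0) = (\<lambda>i. 0)"
  by (auto simp: mv_def)

lemma mv_mm: "mv L (mm K A B) x = mv K A (mv L B x)"
  by (auto simp: mv_def mm_def fun_eq_iff sum_distrib_left sum_distrib_right mult.assoc intro: sum.swap)

lemma mv_diff_mat: "mv K (\<lambda>i j. A i j - B i j) x = (\<lambda>i. mv K A x i - mv K B x i)"
  and mv_add_mat: "mv K (\<lambda>i j. A i j + B i j) x = (\<lambda>i. mv K A x i + mv K B x i)"
  by (simp_all add: fun_eq_iff mv_def algebra_simps sum.distrib sum_subtractf)

lemma mv_unit_mat: "finite K \<Longrightarrow> i \<in> K \<Longrightarrow> mv K unit_mat x i = x i"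
  by (simp add: mv_def unit_mat_def if_distrib[of "\<lambda>a. a * _"] cong: if_cong)

lemma dotp_mv_mtr: "dotp K (mv L A x) y = dotp L x (mv K (mtr A) y)"
  unfolding dotp_def mv_def mtr_def
  by (simp add: sum_distrib_left sum_distrib_right mult_ac) (rule sum.swap)

lemma mtr_mtr [simp]: "mtr (mtr A) = A"
  by (simp add: mtr_def)

lemma mtr_mm: "mtr (mm K A B) = mm K (mtr B) (mtr A)"
  by (simp add: mtr_def mm_def mult.commute)

lemma bil_add: "bil K A (\<lambda>i. x i + y i) z = bil K A x z + bil K A y z"
    "bil K A z (\<lambda>i. x i + y i) = bil K A z x + bil K A z y"
  and bil_diff: "bil K A (\<lambda>i. x i - y i) z = bil K A x z - bil K A y z"
    "bil K A z (\<lambda>i. x i - y i) = bil K A z x - bil K A z y"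
  and bil_scale: "bil K A (\<lambda>i. c * x i) z = c * bil K A x z"
    "bil K A z (\<lambda>i. c * x i) = c * bil K A z x"
  and bil_sum: "bil K A (\<lambda>i. \<Sum>j\<in>J. f j i) z = (\<Sum>j\<in>J. bil K A (f j) z)"
    "bil K A z (\<lambda>i. \<Sum>j\<in>J. f j i) = (\<Sum>j\<in>J. bil K A z (f j))"
  by (simp_all add: bil_def mv_add mv_diff mv_scale mv_sum dotp_add dotp_diff dotp_scale dotp_sum)

lemma bil_add_mat: "bil K (\<lambda>i j. A i j + B i j) x y = bil K A x y + bil K B x y"
  and bil_diff_mat: "bil K (\<lambda>i j. A i j - B i j) x y = bil K A x y - bil K B x y"
  by (simp_all add: bil_def mv_add_mat mv_diff_mat dotp_add dotp_diff)

lemma bil_commute: "symmetric_on K A \<Longrightarrow> bil K A x y = bil K A y x"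
  unfolding bil_def by (subst dotp_mv_mtr, subst dotp_commute)
    (auto simp: symmetric_on_def mtr_def intro!: dotp_cong mv_cong)

lemma bil_unit: "finite K \<Longrightarrow> i \<in> K \<Longrightarrow> j \<in> K \<Longrightarrow> bil K A (unit_mat i) (unit_mat j) = A j i"
  by (simp add: bil_def dotp_def mv_def unit_mat_def if_distrib cong: if_cong)

lemma symmetric_onI_bil:
  "finite K \<Longrightarrow> (\<And>x y. bil K A x y = bil K A y x) \<Longrightarrow> symmetric_on K A"
  unfolding symmetric_on_def by (metis bil_unit)

lemma dotp_self_eq_0: "finite K \<Longrightarrow> dotp K x x = 0 \<Longrightarrow> i \<in> K \<Longrightarrow> x i = 0"
  by (auto simp: dotp_def sum_nonneg_eq_0_iff)

text \<open>
  Moving from \<open>y\<close> along an isotropic vector \<open>x\<close> changes the energy linearly, so a nonzero slope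
  would make it negative.
\<close>

lemma psd_bil_zero:
  assumes "psd_on K A" "bil K A x x = 0"
  shows "bil K A x y = 0"
proof (rule ccontr)
  assume n: "bil K A x y \<noteq> 0"
  define b c where "b = bil K A x y" and "c = bil K A y y"
  \<comment> \<open>the step that brings the energy \<open>c + 2 t b\<close> down to \<open>- 1\<close>\<close>
  define t where "t = - (c + 1) / (2 * b)"
  have "0 \<le> bil K A (\<lambda>i. y i + t * x i) (\<lambda>i. y i + t * x i)"
    using assms(1) by (simp add: psd_on_def)
  also have "\<dots> = c + 2 * t * b"
    using assms(2) bil_commute[OF psd_onD(1)[OF assms(1)], of y x]
    by (simp add: bil_add bil_scale b_def c_def)
  also have "\<dots> = - 1" using n by (simp add: t_def b_def field_simps)
  finally show False by simp
qed

lemma psd_sum_bound: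
  assumes "psd_on K A" "finite J"
  shows "bil K A (\<lambda>i. \<Sum>j\<in>J. f j i) (\<lambda>i. \<Sum>j\<in>J. f j i) \<le> card J * (\<Sum>j\<in>J. bil K A (f j) (f j))"
proof -
  have *: "2 * bil K A x y \<le> bil K A x x + bil K A y y" for x y
    using psd_onD(2)[OF assms(1), of "\<lambda>i. x i - y i"] bil_commute[OF psd_onD(1)[OF assms(1)], of y x]
    by (simp add: bil_diff)
  have "2 * bil K A (\<lambda>i. \<Sum>j\<in>J. f j i) (\<lambda>i. \<Sum>j\<in>J. f j i) = (\<Sum>j\<in>J. \<Sum>k\<in>J. 2 * bil K A (f j) (f k))"
    unfolding bil_sum by (simp add: sum_distrib_left)
  also have "\<dots> \<le> (\<Sum>j\<in>J. \<Sum>k\<in>J. bil K A (f j) (f j) + bil K A (f k) (f k))"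
    by (intro sum_mono *)
  also have "\<dots> = 2 * (card J * (\<Sum>j\<in>J. bil K A (f j) (f j)))"
    by (simp add: sum.distrib flip: sum_distrib_left)
  finally show ?thesis by simp
qed

lemma psd_add_bound:
  assumes "psd_on K A"
  shows "bil K A (\<lambda>i. x i + y i) (\<lambda>i. x i + y i) \<le> 2 * bil K A x x + 2 * bil K A y y"
  using psd_onD(2)[OF assms, of "\<lambda>i. x i - y i"] bil_commute[OF psd_onD(1)[OF assms], of y x]
  by (simp add: bil_diff bil_add)

lemma psd_diff_bound:
  assumes "psd_on K A"
  shows "bil K A (\<lambda>i. x i - y i) (\<lambda>i. x i - y i) \<le> 2 * bil K A x x + 2 * bil K A y y"
  using psd_onD(2)[OF assms, of "\<lambda>i. x i + y i"] bil_commute[OF psd_onD(1)[OF assms], of y x]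
  by (simp add: bil_diff bil_add)


section \<open>Least squares, dependence, eigenvalues\<close>

text \<open>
  Gram--Schmidt, one column at a time: the part \<open>r\<close> of the new column orthogonal to the old ones is
  used to correct the residual.  This is the existence statement behind orthogonal projections and
  pseudo-inverses.
\<close>

lemma least_squares:
  fixes A :: "('a, 'b) fmat"
  assumes "finite L"
  shows "\<exists>x. \<forall>l\<in>L. dotp K (\<lambda>k. b k - mv L A x k) (\<lambda>k. A k l) = 0"
  using assms
proof (induction L arbitrary: b rule: finite_induct)
  case (insert l L)
  let ?a = "\<lambda>k. A k l"
  obtain x' where x': "\<forall>m\<in>L. dotp K (\<lambda>k. ?a k - mv L A x' k) (\<lambda>k. A k m) = 0"
    using insert.IH[of ?a] by auto
  obtain x where x: "\<forall>m\<in>L. dotp K (\<lambda>k. b k - mv L A x k) (\<lambda>k. A k m) = 0"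
    using insert.IH[of b] by auto
  define r where "r = (\<lambda>k. ?a k - mv L A x' k)"
  define s where "s = (\<lambda>k. b k - mv L A x k)"
  \<comment> \<open>if \<open>r\<close> vanishes, division by zero yields the correct coefficient 0\<close>
  define t where "t = dotp K s r / dotp K r r"
  have t: "dotp K s r = t * dotp K r r" if "dotp K r r \<noteq> 0"
    using that by (simp add: t_def)
  define y where "y = (\<lambda>m. if m = l then t else x m - t * x' m)"
  have res: "b k - mv (insert l L) A y k = s k - t * r k" for k
  proof -
    have "mv L A y k = mv L A (\<lambda>m. x m - t * x' m) k"
      using insert.hyps by (intro mv_cong) (auto simp: y_def)
    then have "mv (insert l L) A y k = t * A k l + mv L A x k - t * mv L A x' k"
      using insert.hyps by (simp add: mv_def[of "insert l L"] y_def mv_diff mv_scale)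
        (simp add: mv_def mult.commute)
    then show ?thesis by (simp add: s_def r_def algebra_simps)
  qed
  have L: "dotp K (\<lambda>k. s k - t * r k) (\<lambda>k. A k m) = 0" if "m \<in> L" for m
    using x x' that by (simp add: dotp_diff(1)[of K s] dotp_scale) (simp add: s_def r_def)
  have "dotp K (\<lambda>k. s k - t * r k) r = 0"
  proof (cases "dotp K r r = 0")
    case True
    then have "r k = 0 \<or> infinite K" if "k \<in> K" for k
      using dotp_self_eq_0[of K r k] that by auto
    then have "dotp K z r = 0" for z
      by (cases "finite K") (auto simp: dotp_def)
    then show ?thesis .
  qed (simp add: dotp_diff dotp_scale t)
  moreover have "dotp K (\<lambda>k. s k - t * r k) (mv L A x') = 0"
  proof -
    have "mv L A x' = (\<lambda>k. \<Sum>m\<in>L. x' m * A k m)" by (simp add: mv_def mult.commute)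
    then show ?thesis using L by (simp add: dotp_sum dotp_scale)
  qed
  moreover have "?a = (\<lambda>k. r k + mv L A x' k)" by (simp add: r_def)
  ultimately have "dotp K (\<lambda>k. s k - t * r k) ?a = 0" by (simp only: dotp_add add_0_left)
  then show ?case using L by (intro exI[of _ y]) (auto simp: res)
qed auto

text \<open>
  Gaussian elimination: one vector with a nonzero coordinate \<open>k\<close> is used to clear this coordinate in
  all the others, and the dimension drops by one.
\<close>

lemma more_vectors_than_dimension_dependent:
  fixes v :: "'j \<Rightarrow> 'a \<Rightarrow> real"
  assumes "finite K" "finite J" "card K < card J"
  shows "\<exists>c. (\<exists>j\<in>J. c j \<noteq> 0) \<and> (\<forall>i\<in>K. (\<Sum>j\<in>J. c j * v j i) = 0)"
  using assms
proof (induction K arbitrary: J v rule: finite_induct)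
  case empty
  then show ?case by (intro exI[of _ "\<lambda>_. 1"]) (auto simp: card_gt_0_iff)
next
  case (insert k K)
  show ?case
  proof (cases "\<forall>j\<in>J. v j k = 0")
    case True
    obtain c where "\<exists>j\<in>J. c j \<noteq> 0" "\<forall>i\<in>K. (\<Sum>j\<in>J. c j * v j i) = 0"
      using insert.IH[of J v] insert.prems insert.hyps by auto
    then show ?thesis using True by (intro exI[of _ c]) auto
  next
    case False
    then obtain j0 where j0: "j0 \<in> J" "v j0 k \<noteq> 0" by auto
    let ?v = "\<lambda>j i. v j i - v j k / v j0 k * v j0 i"
    obtain c where c: "\<exists>j\<in>J - {j0}. c j \<noteq> 0" "\<forall>i\<in>K. (\<Sum>j\<in>J - {j0}. c j * ?v j i) = 0"
    proof -
      have "card K < card (J - {j0})" "finite (J - {j0})"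
        using insert.prems insert.hyps j0 by (auto simp: card_Diff_singleton)
      then show ?thesis using insert.IH[of "J - {j0}" ?v] that by blast
    qed
    define c0 where "c0 = - (\<Sum>j\<in>J - {j0}. c j * v j k) / v j0 k"
    define d where "d = (\<lambda>j. if j = j0 then c0 else c j)"
    have d: "(\<Sum>j\<in>J. d j * v j i) = c0 * v j0 i + (\<Sum>j\<in>J - {j0}. c j * v j i)" for i
      using sum.remove[OF insert.prems(1) j0(1), of "\<lambda>j. d j * v j i"] by (simp add: d_def)
    have "(\<Sum>j\<in>J. d j * v j i) = 0" if "i \<in> K" for i
    proof -
      have "0 = (\<Sum>j\<in>J - {j0}. c j * v j i) - (\<Sum>j\<in>J - {j0}. c j * v j k) / v j0 k * v j0 i"
        using c(2) that by (simp add: algebra_simps sum_subtractf sum_divide_distrib sum_distrib_left)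
      then show ?thesis by (simp add: d c0_def)
    qed
    moreover have "(\<Sum>j\<in>J. d j * v j k) = 0" using j0 by (simp add: d c0_def)
    ultimately show ?thesis using c(1) by (intro exI[of _ d]) (auto simp: d_def)
  qed
qed

text \<open>
  Applying \<open>A - \<nu>\<close> to a linear relation removes the eigenvector of \<open>\<nu>\<close> and multiplies the
  other coefficients by nonzero numbers.
\<close>

lemma eigenvectors_independent:
  assumes "finite J"
    and "\<And>\<mu>. \<mu> \<in> J \<Longrightarrow> \<exists>i\<in>K. v \<mu> i \<noteq> 0"
    and "\<And>\<mu> i. \<mu> \<in> J \<Longrightarrow> i \<in> K \<Longrightarrow> mv K A (v \<mu>) i = \<mu> * v \<mu> i"
    and "\<forall>i\<in>K. (\<Sum>\<mu>\<in>J. c \<mu> * v \<mu> i) = 0"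
  shows "\<forall>\<mu>\<in>J. c \<mu> = 0"
  using assms
proof (induction J arbitrary: c rule: finite_induct)
  case (insert \<nu> J)
  have "(\<Sum>\<mu>\<in>J. (c \<mu> * (\<mu> - \<nu>)) * v \<mu> i) = 0" if i: "i \<in> K" for i
  proof -
    have "0 = mv K A (\<lambda>i. \<Sum>\<mu>\<in>insert \<nu> J. c \<mu> * v \<mu> i) i - \<nu> * (\<Sum>\<mu>\<in>insert \<nu> J. c \<mu> * v \<mu> i)"
      using insert.prems(3) i mv_cong[of K A i A "\<lambda>i. \<Sum>\<mu>\<in>insert \<nu> J. c \<mu> * v \<mu> i" "\<lambda>_. 0"]
      by (simp add: mv_zero)
    also have "\<dots> = (\<Sum>\<mu>\<in>insert \<nu> J. c \<mu> * (\<mu> * v \<mu> i)) - \<nu> * (\<Sum>\<mu>\<in>insert \<nu> J. c \<mu> * v \<mu> i)"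
      using insert.prems(2) i by (simp add: mv_sum mv_scale)
    also have "\<dots> = (\<Sum>\<mu>\<in>J. (c \<mu> * (\<mu> - \<nu>)) * v \<mu> i)"
      using insert.hyps by (simp add: algebra_simps sum_subtractf sum_distrib_left)
    finally show ?thesis by simp
  qed
  then have "\<forall>\<mu>\<in>J. c \<mu> * (\<mu> - \<nu>) = 0"
    using insert.prems(1,2) by (intro insert.IH) blast+
  then have J: "\<forall>\<mu>\<in>J. c \<mu> = 0" using insert.hyps by auto
  obtain i where "i \<in> K" "v \<nu> i \<noteq> 0" using insert.prems(1)[of \<nu>] by auto
  moreover have "c \<nu> * v \<nu> i = 0"
    using J insert.hyps bspec[OF insert.prems(3) \<open>i \<in> K\<close>] by simp
  ultimately show ?case using J by auto
qed auto

text \<open>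
  Finiteness is what makes the maximum and the minimum in the condition number attained.
\<close>

lemma finite_eigenvalues:
  assumes "finite K"
  shows "finite (eigenvalues K A)"
proof (rule ccontr)
  assume "infinite (eigenvalues K A)"
  then obtain J where J: "J \<subseteq> eigenvalues K A" "finite J" "card J = Suc (card K)"
    using infinite_arbitrarily_large by metis
  define v where "v = (\<lambda>\<mu>. SOME x. (\<exists>i\<in>K. x i \<noteq> 0) \<and> (\<forall>i\<in>K. mv K A x i = \<mu> * x i))"
  have v: "(\<exists>i\<in>K. v \<mu> i \<noteq> 0) \<and> (\<forall>i\<in>K. mv K A (v \<mu>) i = \<mu> * v \<mu> i)" if "\<mu> \<in> J" for \<mu>
  proof -
    have "\<exists>x. (\<exists>i\<in>K. x i \<noteq> 0) \<and> (\<forall>i\<in>K. mv K A x i = \<mu> * x i)"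
      using J(1) that unfolding eigenvalues_def by blast
    from someI_ex[OF this] show ?thesis unfolding v_def .
  qed
  obtain c where c: "\<exists>j\<in>J. c j \<noteq> 0" "\<forall>i\<in>K. (\<Sum>j\<in>J. c j * v j i) = 0"
    using more_vectors_than_dimension_dependent[OF assms J(2), of v] J by auto
  then show False using eigenvectors_independent[OF J(2) _ _ c(2)] v by blast
qed


section \<open>Orthogonal projections and pseudo-inverses\<close>

lemma is_orth_projD:
  assumes "is_orth_proj K R Q"
  shows "mv K Q x \<in> R" "y \<in> R \<Longrightarrow> dotp K (\<lambda>i. x i - mv K Q x i) y = 0"
    "i \<notin> K \<or> j \<notin> K \<Longrightarrow> Q i j = 0"
  using assms unfolding is_orth_proj_def by blast+

lemma is_orth_proj_exists:
  assumes K: "finite K" and L: "finite L"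
  shows "\<exists>Q. is_orth_proj K (mat_range K L A) Q"
proof -
  define X where "X = (\<lambda>j. SOME x. \<forall>l\<in>L. dotp K (\<lambda>k. unit_mat j k - mv L A x k) (\<lambda>k. A k l) = 0)"
  have X: "\<forall>l\<in>L. dotp K (\<lambda>k. unit_mat j k - mv L A (X j) k) (\<lambda>k. A k l) = 0" for j
    unfolding X_def by (rule someI_ex[OF least_squares[OF L]])
  define Q where "Q = (\<lambda>i j. if i \<in> K \<and> j \<in> K then mv L A (X j) i else 0)"
  have Q: "mv K Q x = (\<lambda>i. if i \<in> K then mv L A (\<lambda>l. \<Sum>j\<in>K. x j * X j l) i else 0)" for x
    by (auto simp: fun_eq_iff mv_sum mv_scale Q_def) (auto simp: mv_def[of K] mult.commute)
  have "dotp K (\<lambda>i. x i - mv K Q x i) (\<lambda>i. if i \<in> K then mv L A y i else 0) = 0" for x y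
  proof -
    have "dotp K (\<lambda>i. x i - mv K Q x i) (\<lambda>i. if i \<in> K then mv L A y i else 0)
        = dotp K (\<lambda>i. \<Sum>j\<in>K. x j * (unit_mat j i - mv L A (X j) i)) (\<lambda>i. \<Sum>l\<in>L. y l * A i l)"
    proof (rule dotp_cong)
      fix i assume i: "i \<in> K"
      have "x i = (\<Sum>j\<in>K. x j * unit_mat j i)"
        using K i by (simp add: unit_mat_def if_distrib[of "(*) _"] cong: if_cong)
      moreover have "mv K Q x i = (\<Sum>j\<in>K. x j * mv L A (X j) i)"
        using i by (simp add: Q mv_sum mv_scale)
      ultimately show "x i - mv K Q x i = (\<Sum>j\<in>K. x j * (unit_mat j i - mv L A (X j) i))"
        by (simp add: right_diff_distrib sum_subtractf)
    qed (auto simp: mv_def mult.commute)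
    also have "\<dots> = 0"
      using X by (simp only: dotp_sum dotp_scale) simp
    finally show ?thesis .
  qed
  then have "is_orth_proj K (mat_range K L A) Q"
    unfolding is_orth_proj_def mat_range_def using Q by (auto simp: Q_def)
  then show ?thesis by (rule exI[of _ Q])
qed

lemma mat_range_diff:
  "x \<in> mat_range K L A \<Longrightarrow> y \<in> mat_range K L A \<Longrightarrow> (\<lambda>i. x i - y i) \<in> mat_range K L A"
proof -
  assume "x \<in> mat_range K L A" "y \<in> mat_range K L A"
  then obtain u v where "x = (\<lambda>i. if i \<in> K then mv L A u i else 0)"
    "y = (\<lambda>i. if i \<in> K then mv L A v i else 0)"
    by (auto simp: mat_range_def)
  then have "(\<lambda>i. x i - y i) = (\<lambda>i. if i \<in> K then mv L A (\<lambda>l. u l - v l) i else 0)"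
    by (auto simp: mv_diff)
  then show ?thesis unfolding mat_range_def by blast
qed

text \<open>
  Two projections of the same vector differ by an element of the range that is orthogonal to the
  range.
\<close>

lemma is_orth_proj_unique:
  assumes K: "finite K" and R: "R = mat_range K L A"
    and Q: "is_orth_proj K R Q" and Q': "is_orth_proj K R Q'"
  shows "Q = Q'"
proof (intro ext)
  fix i j
  show "Q i j = Q' i j"
  proof (cases "i \<in> K \<and> j \<in> K")
    case True
    let ?x = "unit_mat j"
    define d where "d = (\<lambda>i. mv K Q ?x i - mv K Q' ?x i)"
    have dR: "d \<in> R"
      unfolding R d_def by (intro mat_range_diff) (use is_orth_projD(1) Q Q' R in blast)+
    have "dotp K d d = dotp K (\<lambda>i. ?x i - mv K Q' ?x i) d - dotp K (\<lambda>i. ?x i - mv K Q ?x i) d"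
      unfolding dotp_diff(1)[symmetric] by (rule dotp_cong) (simp_all add: d_def)
    also have "\<dots> = 0 - 0"
      by (intro arg_cong2[of _ _ _ _ "(-)"] is_orth_projD(2)[OF Q dR] is_orth_projD(2)[OF Q' dR])
    finally have "d i = 0" using dotp_self_eq_0[OF K, of d i] True by simp
    moreover have "mv K M ?x i = M i j" for M :: "('a, 'a) fmat"
      using True K by (simp add: mv_def unit_mat_def if_distrib[of "(*) _"] cong: if_cong)
    ultimately show ?thesis by (simp add: d_def)
  next
    case False
    then have *: "i \<notin> K \<or> j \<notin> K" by blast
    show ?thesis unfolding is_orth_projD(3)[OF Q *] is_orth_projD(3)[OF Q' *] ..
  qed
qed

lemma orth_proj_range:
  assumes K: "finite K" and L: "finite L"
  shows "is_orth_proj K (mat_range K L A) (orth_proj K (mat_range K L A))"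
proof -
  obtain Q where Q: "is_orth_proj K (mat_range K L A) Q"
    using is_orth_proj_exists[OF assms, of A] by (rule exE)
  then have "orth_proj K (mat_range K L A) = Q"
    unfolding orth_proj_def
    by (rule the_equality[of "is_orth_proj K (mat_range K L A)"])
      (rule is_orth_proj_unique[OF K refl _ Q])
  then show ?thesis using Q by (simp only:)
qed

lemma orth_proj_fixes_range:
  assumes K: "finite K" and Q: "is_orth_proj K (mat_range K L A) Q" and y: "y \<in> mat_range K L A"
    and "i \<in> K"
  shows "mv K Q y i = y i"
proof -
  let ?d = "\<lambda>i. y i - mv K Q y i"
  have "?d \<in> mat_range K L A"
    by (intro mat_range_diff y is_orth_projD(1)[OF Q])
  then have "dotp K ?d ?d = 0" by (rule is_orth_projD(2)[OF Q])
  then have "?d i = 0" by (rule dotp_self_eq_0[OF K]) (rule assms(4))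
  then show ?thesis by simp
qed

text \<open>
  Truncation to \<open>K \<times> K\<close> turns entrywise equalities on \<open>K\<close> into equalities of functions, so that
  the Penrose equations can be handled by associativity and transposition alone.
\<close>

definition restrict_mat :: "'a set \<Rightarrow> ('a, 'a) fmat \<Rightarrow> ('a, 'a) fmat" where
  "restrict_mat K A = (\<lambda>i j. if i \<in> K \<and> j \<in> K then A i j else 0)"

lemma restrict_mat_eq_iff:
  "restrict_mat K A = restrict_mat K B \<longleftrightarrow> (\<forall>i\<in>K. \<forall>j\<in>K. A i j = B i j)"
  by (auto simp: restrict_mat_def fun_eq_iff)

lemma restrict_mat_mm: "restrict_mat K (mm K A B) = mm K (restrict_mat K A) (restrict_mat K B)"
  by (auto simp: restrict_mat_def mm_def fun_eq_iff intro!: sum.cong sum.neutral)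

lemma symmetric_on_iff: "symmetric_on K A \<longleftrightarrow> mtr (restrict_mat K A) = restrict_mat K A"
  by (auto simp: symmetric_on_def restrict_mat_def mtr_def fun_eq_iff)

lemma is_pinv_iff:
  "is_pinv K A G \<longleftrightarrow> restrict_mat K G = G \<and>
     mm K (restrict_mat K A) (mm K G (restrict_mat K A)) = restrict_mat K A \<and>
     mm K G (mm K (restrict_mat K A) G) = G \<and>
     mtr (mm K (restrict_mat K A) G) = mm K (restrict_mat K A) G \<and>
     mtr (mm K G (restrict_mat K A)) = mm K G (restrict_mat K A)"
proof -
  have supp: "(\<forall>i j. i \<notin> K \<or> j \<notin> K \<longrightarrow> G i j = 0) \<longleftrightarrow> restrict_mat K G = G"
    unfolding restrict_mat_def fun_eq_iff by metis
  have "is_pinv K A G \<longleftrightarrow> restrict_mat K G = G \<and>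
     restrict_mat K (mm K A (mm K G A)) = restrict_mat K A \<and>
     restrict_mat K (mm K G (mm K A G)) = restrict_mat K G \<and>
     symmetric_on K (mm K A G) \<and> symmetric_on K (mm K G A)"
    unfolding is_pinv_def supp restrict_mat_eq_iff[of K "mm K A (mm K G A)"]
      restrict_mat_eq_iff[of K "mm K G (mm K A G)"] symmetric_on_def
    by (simp only: ball_conj_distrib conj_assoc)
  then show ?thesis
    unfolding symmetric_on_iff restrict_mat_mm by (simp cong: conj_cong)
qed

text \<open>
  \<open>A G\<close> and \<open>A H\<close> are both the orthogonal projection onto the range of \<open>A\<close>, and \<open>G A\<close> and \<open>H A\<close>
  are both the orthogonal projection onto the range of its transpose.
\<close>

lemma is_pinv_unique:
  assumes K: "finite K" and G: "is_pinv K A G" and H: "is_pinv K A H"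
  shows "G = H"
proof -
  note assoc = mm_assoc[OF K K]
  define A' where "A' = restrict_mat K A"
  have g: "mm K A' (mm K G A') = A'" "mm K G (mm K A' G) = G" "mtr (mm K A' G) = mm K A' G"
      "mtr (mm K G A') = mm K G A'"
    using G unfolding is_pinv_iff A'_def by simp_all
  have h: "mm K A' (mm K H A') = A'" "mm K H (mm K A' H) = H" "mtr (mm K A' H) = mm K A' H"
      "mtr (mm K H A') = mm K H A'"
    using H unfolding is_pinv_iff A'_def by simp_all
  have AHG: "mm K (mm K A' H) (mm K A' G) = mm K A' G"
    using arg_cong[OF h(1), of "\<lambda>M. mm K M G"] by (simp only: assoc)
  have AGH: "mm K (mm K A' G) (mm K A' H) = mm K A' H"
    using arg_cong[OF g(1), of "\<lambda>M. mm K M H"] by (simp only: assoc)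
  have GHA: "mm K (mm K G A') (mm K H A') = mm K G A'"
    using arg_cong[OF h(1), of "\<lambda>M. mm K G M"] by (simp only: assoc)
  have HGA: "mm K (mm K H A') (mm K G A') = mm K H A'"
    using arg_cong[OF g(1), of "\<lambda>M. mm K H M"] by (simp only: assoc)
  have AG: "mm K A' G = mm K A' H"
  proof -
    have "mm K A' H = mtr (mm K (mm K A' G) (mm K A' H))" by (simp only: AGH h(3))
    also have "\<dots> = mm K (mm K A' H) (mm K A' G)" by (simp only: mtr_mm[of K "mm K A' G"] g(3) h(3))
    finally show ?thesis by (simp only: AHG)
  qed
  have GA: "mm K G A' = mm K H A'"
  proof -
    have "mm K H A' = mtr (mm K (mm K H A') (mm K G A'))" by (simp only: HGA h(4))
    also have "\<dots> = mm K (mm K G A') (mm K H A')" by (simp only: mtr_mm[of K "mm K H A'"] g(4) h(4))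
    finally show ?thesis by (simp only: GHA)
  qed
  have "G = mm K G (mm K A' H)" using g(2) unfolding AG by (rule sym)
  also have "\<dots> = mm K (mm K G A') H" by (rule assoc)
  also have "\<dots> = mm K H (mm K A' H)" unfolding GA by (rule assoc[symmetric])
  also have "\<dots> = H" by (rule h(2))
  finally show ?thesis .
qed

text \<open>
  The least squares solutions \<open>X\<close> for the unit vectors satisfy \<open>A A X = A\<close>.  Hence \<open>A X\<close> is
  symmetric, it is the orthogonal projection onto the range of \<open>A\<close>, and \<open>X\<^sup>T A X\<close> is a symmetric
  pseudo-inverse.
\<close>

lemma is_pinv_exists:
  assumes K: "finite K" and A: "symmetric_on K A"
  shows "\<exists>G. is_pinv K A G \<and> symmetric_on K G"
proof -
  note assoc = mm_assoc[OF K K]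
  define A' where "A' = restrict_mat K A"
  have trA: "mtr A' = A'" using A by (simp add: symmetric_on_iff A'_def)
  define Y where "Y = (\<lambda>j. SOME x. \<forall>l\<in>K. dotp K (\<lambda>k. unit_mat j k - mv K A' x k) (\<lambda>k. A' k l) = 0)"
  have Y: "\<forall>l\<in>K. dotp K (\<lambda>k. unit_mat j k - mv K A' (Y j) k) (\<lambda>k. A' k l) = 0" for j
    unfolding Y_def by (rule someI_ex[OF least_squares[OF K]])
  define X where "X = restrict_mat K (\<lambda>i j. Y j i)"
  have AAX: "mm K A' (mm K A' X) = A'"
  proof (intro ext)
    fix i j
    show "mm K A' (mm K A' X) i j = A' i j"
    proof (cases "i \<in> K \<and> j \<in> K")
      case True
      have "mm K A' X k j = mv K A' (Y j) k" for k
        using True by (auto simp: mm_def mv_def X_def restrict_mat_def intro!: sum.cong)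
      then have "mm K A' (mm K A' X) i j = dotp K (mv K A' (Y j)) (\<lambda>k. A' k i)"
        using fun_cong[OF fun_cong[OF trA]] unfolding mm_def[of K A' "mm K A' X"] dotp_def
        by (intro sum.cong) (auto simp: mtr_def mult.commute)
      also have "\<dots> = dotp K (unit_mat j) (\<lambda>k. A' k i)"
        using Y[of j] True by (simp add: dotp_diff)
      also have "\<dots> = A' j i"
        using True K by (simp add: dotp_def unit_mat_def if_distrib[of "\<lambda>x. x * _"] cong: if_cong)
      finally show ?thesis using fun_cong[OF fun_cong[OF trA]] by (simp add: mtr_def)
    qed (auto simp: mm_def A'_def X_def restrict_mat_def)
  qed
  have XAA: "mm K (mtr X) (mm K A' A') = A'"
    using arg_cong[OF AAX, of mtr] trA by (simp add: mtr_mm assoc)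
  have AX: "mm K A' X = mm K (mtr X) A'"
  proof -
    have "mm K (mm K (mtr X) (mm K A' A')) X = mm K (mtr X) (mm K A' (mm K A' X))"
      by (simp only: assoc)
    then show ?thesis by (simp only: AAX XAA)
  qed
  have trAX: "mtr (mm K A' X) = mm K A' X"
    using AX trA by (simp add: mtr_mm)
  define G where "G = mm K (mtr X) (mm K A' X)"
  have trG: "mtr G = G" by (simp add: G_def mtr_mm assoc trA)
  have AG: "mm K A' G = mm K A' X"
  proof -
    have "mm K A' G = mm K A' (mm K (mm K (mtr X) A') X)" by (simp only: G_def assoc)
    also have "\<dots> = mm K (mm K A' (mm K A' X)) X" by (simp only: AX[symmetric] assoc)
    finally show ?thesis by (simp only: AAX)
  qed
  have GA: "mm K G A' = mm K A' X"
    using arg_cong[OF AG, of mtr] trG trA trAX by (simp add: mtr_mm)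
  have rG: "restrict_mat K G = G"
    by (auto simp: fun_eq_iff restrict_mat_def G_def mm_def mtr_def X_def)
  have 1: "mm K A' (mm K G A') = A'" using GA AAX by simp
  have 2: "mm K G (mm K A' G) = G"
  proof -
    have "mm K (mm K A' X) A' = A'" unfolding AX using XAA by (simp only: assoc)
    then have "mm K (mtr X) (mm K (mm K (mm K A' X) A') X) = G" by (simp only: G_def)
    then show ?thesis unfolding AG by (simp only: G_def assoc)
  qed
  have "is_pinv K A G"
    unfolding is_pinv_iff A'_def[symmetric] using rG 1 2 by (simp add: AG GA trAX)
  then show ?thesis using trG rG by (auto simp: symmetric_on_iff)
qed

lemma pinv_symmetric:
  assumes "finite K" "symmetric_on K A"
  shows "is_pinv K A (pinv K A)" "symmetric_on K (pinv K A)"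
proof -
  obtain G where G: "is_pinv K A G" "symmetric_on K G" using is_pinv_exists[OF assms] by auto
  then have "pinv K A = G"
    unfolding pinv_def using is_pinv_unique[OF assms(1)] by (intro the_equality) auto
  then show "is_pinv K A (pinv K A)" "symmetric_on K (pinv K A)" using G by auto
qed

lemma mv_cong_mat:
  assumes "i \<in> K" "\<And>i j. i \<in> K \<Longrightarrow> j \<in> K \<Longrightarrow> C i j = E i j"
  shows "mv K C x i = mv K E x i"
  using assms by (intro mv_cong) auto

lemma pinv_reflexive:
  assumes "finite K" "symmetric_on K A" "i \<in> K"
  shows "mv K A (mv K (pinv K A) (mv K A x)) i = mv K A x i"
    "mv K (pinv K A) (mv K A (mv K (pinv K A) x)) i = mv K (pinv K A) x i"
  using pinv_symmetric(1)[OF assms(1,2)] assms(3) unfolding is_pinv_def mv_mm[symmetric]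
  by (auto intro!: mv_cong_mat)

text \<open>
  By the second Penrose equation \<open>G = G A G\<close>.
\<close>

lemma pinv_psd:
  assumes K: "finite K" and A: "psd_on K A"
  shows "psd_on K (pinv K A)"
proof -
  note s = psd_onD(1)[OF A]
  have "bil K (pinv K A) x x = bil K A (mv K (pinv K A) x) (mv K (pinv K A) x)" for x
  proof -
    have "bil K (pinv K A) x x = bil K (pinv K A) (mv K A (mv K (pinv K A) x)) x"
      unfolding bil_def using pinv_reflexive(2)[OF K s] by (intro dotp_cong) auto
    also have "\<dots> = bil K (pinv K A) x (mv K A (mv K (pinv K A) x))"
      by (rule bil_commute[OF pinv_symmetric(2)[OF K s]])
    finally show ?thesis by (simp add: bil_def dotp_commute)
  qed
  then show ?thesis using A pinv_symmetric(2)[OF K s] by (auto simp: psd_on_def)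
qed

text \<open>
  \<open>A G\<close> projects orthogonally onto the range of \<open>A\<close>, which is the orthogonal complement of the
  kernel since \<open>A\<close> is symmetric.  This is the form in which pseudo-inverses are used below: a
  semidefiniteness argument shows that the right-hand side is orthogonal to the kernel.
\<close>

lemma pinv_solves:
  assumes K: "finite K" and A: "symmetric_on K A"
    and h: "\<And>y. (\<And>i. i \<in> K \<Longrightarrow> mv K A y i = 0) \<Longrightarrow> dotp K h y = 0" and i: "i \<in> K"
  shows "mv K A (mv K (pinv K A) h) i = h i"
proof -
  let ?G = "pinv K A"
  define r where "r = (\<lambda>i. h i - mv K A (mv K ?G h) i)"
  note G = pinv_symmetric[OF K A]
  have sE: "symmetric_on K (mm K A ?G)"
    using G(1) by (auto simp: is_pinv_def symmetric_on_def)
  have "mv K A r i = 0" if "i \<in> K" for i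
  proof -
    have "bil K A r x = 0" for x
    proof -
      have "bil K A r x = bil K A x r" by (rule bil_commute[OF A])
      also have "\<dots> = dotp K (mv K A x) h - bil K (mm K A ?G) h (mv K A x)"
        by (simp add: bil_def r_def dotp_diff mv_mm dotp_commute)
      also have "bil K (mm K A ?G) h (mv K A x) = dotp K (mv K A (mv K ?G (mv K A x))) h"
        by (subst bil_commute[OF sE]) (simp add: bil_def mv_mm)
      also have "\<dots> = dotp K (mv K A x) h"
        using pinv_reflexive(1)[OF K A] by (intro dotp_cong) auto
      finally show ?thesis by simp
    qed
    from this[of "mv K A r"] show ?thesis
      using dotp_self_eq_0[OF K] that by (auto simp: bil_def)
  qed
  note Ar = this
  have "dotp K h r = 0" by (rule h) (rule Ar)
  moreover have "dotp K (mv K A (mv K ?G h)) r = 0"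
  proof -
    have "dotp K (mv K A (mv K ?G h)) r = bil K A (mv K ?G h) r" by (simp add: bil_def)
    also have "\<dots> = bil K A r (mv K ?G h)" by (rule bil_commute[OF A])
    also have "\<dots> = 0" using Ar by (simp add: bil_def dotp_def)
    finally show ?thesis .
  qed
  ultimately have "dotp K r r = 0" by (subst (1) r_def) (simp add: dotp_diff)
  then show ?thesis using dotp_self_eq_0[OF K _ i, of r] by (simp add: r_def)
qed


section \<open>Schur complements and parallel sums\<close>

lemma symmetric_on_subset: "symmetric_on K A \<Longrightarrow> L \<subseteq> K \<Longrightarrow> symmetric_on L A"
  by (auto simp: symmetric_on_def)

lemma bil_zero_outside:
  assumes "finite K" "L \<subseteq> K" "\<And>i. i \<in> K - L \<Longrightarrow> x i = 0" "\<And>i. i \<in> K - L \<Longrightarrow> y i = 0"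
  shows "bil K A x y = bil L A x y"
  unfolding bil_def dotp_def mv_def using assms
  by (intro sum.mono_neutral_cong_right)
    (auto intro!: sum.mono_neutral_cong_right)

lemma bil_extend_zero:
  assumes "finite K" "L \<subseteq> K"
  shows "bil K A (\<lambda>i. if i \<in> L then x i else 0) (\<lambda>i. if i \<in> L then y i else 0) = bil L A x y"
  by (subst bil_zero_outside[OF assms]) (auto intro: bil_cong)

lemma psd_on_subset:
  assumes "finite K" "psd_on K A" "L \<subseteq> K"
  shows "psd_on L A"
  using assms bil_extend_zero[OF assms(1,3), of A] symmetric_on_subset[of K A L]
  unfolding psd_on_def by metis

text \<open>
  A vector in the kernel of the block on \<open>L\<close>, extended by zero, has zero energy for the whole matrix
  and therefore lies in its kernel.
\<close>

lemma psd_column_orthogonal_to_block_kernel: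
  assumes K: "finite K" and A: "psd_on K A" and L: "L \<subseteq> K" and j: "j \<in> K"
    and y: "\<And>i. i \<in> L \<Longrightarrow> mv L A y i = 0"
  shows "dotp L (\<lambda>i. A i j) y = 0"
proof -
  let ?y = "\<lambda>i. if i \<in> L then y i else 0"
  have "bil K A ?y ?y = 0"
    unfolding bil_extend_zero[OF K L] using y by (simp add: bil_def dotp_def)
  then have "bil K A ?y (unit_mat j) = 0" by (rule psd_bil_zero[OF A])
  also have "bil K A ?y (unit_mat j) = mv K A ?y j"
    using K j by (simp add: bil_def dotp_def unit_mat_def if_distrib[of "(*) _"] cong: if_cong)
  also have "\<dots> = (\<Sum>k\<in>L. A j k * y k)"
    unfolding mv_def using K L by (intro sum.mono_neutral_cong_right) auto
  also have "\<dots> = dotp L (\<lambda>i. A i j) y"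
    using psd_onD(1)[OF A] j L unfolding dotp_def symmetric_on_def by (intro sum.cong) auto
  finally show ?thesis .
qed

lemma bil_join:
  assumes K: "finite K" and L: "L \<subseteq> K" and s: "symmetric_on K A"
  shows "bil K A x x = bil (K - L) A x x + 2 * dotp (K - L) (mv L A x) x + bil L A x x"
proof -
  have split: "sum f K = sum f (K - L) + sum f L" for f :: "_ \<Rightarrow> real"
    using sum.subset_diff[OF L K] .
  have "bil K A x x = bil (K - L) A x x + dotp (K - L) (mv L A x) x
      + (dotp L (mv (K - L) A x) x + bil L A x x)"
    unfolding bil_def dotp_def mv_def by (simp add: split sum.distrib algebra_simps)
  also have "dotp L (mv (K - L) A x) x = dotp (K - L) (mv L A x) x"
    unfolding dotp_mv_mtr[of L "K - L"] dotp_commute[of "K - L" x]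
    using s L by (intro dotp_cong mv_cong) (auto simp: mtr_def symmetric_on_def)
  finally show ?thesis by simp
qed

text \<open>
  Completing the square: the energy splits into the energy of the Schur complement of the retained
  unknowns and the energy of the deviation of the eliminated unknowns from the minimal extension.
\<close>

lemma schur_energy:
  assumes K: "finite K" and A: "psd_on K A" and L: "L \<subseteq> K"
  shows "bil K A x x = bil (K - L) (schur L A) x x
    + bil L A (\<lambda>i. x i + mv L (pinv L A) (mv (K - L) A x) i) (\<lambda>i. x i + mv L (pinv L A) (mv (K - L) A x) i)"
proof -
  have fL: "finite L" using K L by (rule finite_subset[rotated])
  have sK: "symmetric_on K A" and AL: "psd_on L A" and sL: "symmetric_on L A"
    using psd_onD(1)[OF A] psd_on_subset[OF K A L] by (auto dest: psd_onD)
  define h where "h = mv (K - L) A x"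
  define g where "g = mv L (pinv L A) h"
  have Ag: "mv L A g i = h i" if "i \<in> L" for i
    unfolding g_def
  proof (rule pinv_solves[OF fL sL _ that])
    fix y assume y: "\<And>i. i \<in> L \<Longrightarrow> mv L A y i = 0"
    have "h = (\<lambda>i. \<Sum>j\<in>K - L. x j * A i j)" by (simp add: h_def mv_def mult.commute)
    then show "dotp L h y = 0"
      using psd_column_orthogonal_to_block_kernel[OF K A L _ y] by (simp add: dotp_sum dotp_scale)
  qed
  have hx: "dotp L h x = dotp (K - L) (mv L A x) x"
    unfolding h_def dotp_mv_mtr[of L "K - L"] dotp_commute[of "K - L" x]
    using sK L by (intro dotp_cong mv_cong) (auto simp: mtr_def symmetric_on_def)
  have gg: "bil L A g g = dotp L h g" "bil L A g x = dotp L h x"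
    unfolding bil_def using Ag by (auto intro: dotp_cong)
  have "bil (K - L) (schur L A) x x = bil (K - L) A x x - dotp L h g"
  proof -
    have "bil (K - L) (mm L A (mm L (pinv L A) A)) x x = dotp (K - L) (mv L A g) x"
      by (simp add: bil_def mv_mm g_def h_def)
    also have "\<dots> = dotp L g (mv (K - L) (mtr A) x)" by (rule dotp_mv_mtr)
    also have "\<dots> = dotp L g h"
      unfolding h_def using sK L by (intro dotp_cong mv_cong) (auto simp: mtr_def symmetric_on_def)
    finally show ?thesis by (simp add: schur_def bil_diff_mat dotp_commute)
  qed
  moreover have "bil L A (\<lambda>i. x i + g i) (\<lambda>i. x i + g i) = bil L A x x + 2 * dotp L h x + dotp L h g"
    using bil_commute[OF sL, of x g] by (simp add: bil_add gg)
  ultimately show ?thesis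
    using bil_join[OF K L sK, of x] hx by (simp add: g_def h_def)
qed

lemma schur_symmetric:
  assumes K: "finite K" and A: "psd_on K A" and L: "L \<subseteq> K"
  shows "symmetric_on K (schur L A)"
proof -
  have fL: "finite L" using K L by (rule finite_subset[rotated])
  have sL: "symmetric_on L A" using psd_on_subset[OF K A L] by (rule psd_onD)
  note sG = pinv_symmetric(2)[OF fL sL] and s = psd_onD(1)[OF A]
  have "mm L A (mm L (pinv L A) A) i j = mm L A (mm L (pinv L A) A) j i" if "i \<in> K" "j \<in> K" for i j
  proof -
    have "mm L A (mm L (pinv L A) A) i j = (\<Sum>k\<in>L. \<Sum>l\<in>L. A i k * pinv L A k l * A l j)"
      by (simp add: mm_def sum_distrib_left mult.assoc)
    also have "\<dots> = (\<Sum>l\<in>L. \<Sum>k\<in>L. A j l * pinv L A l k * A k i)"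
    proof (subst sum.swap, intro sum.cong refl)
      fix k l assume "k \<in> L" "l \<in> L"
      then have "A i k = A k i" "pinv L A k l = pinv L A l k" "A l j = A j l"
        using s sG L that unfolding symmetric_on_def by auto
      then show "A i k * pinv L A k l * A l j = A j l * pinv L A l k * A k i"
        by (simp only: mult_ac)
    qed
    also have "\<dots> = mm L A (mm L (pinv L A) A) j i"
      by (simp add: mm_def sum_distrib_left mult.assoc)
    finally show ?thesis .
  qed
  then show ?thesis using s by (auto simp: symmetric_on_def schur_def)
qed

text \<open>
  The energy of \<open>x\<close> for the Schur complement is the energy of its minimal extension \<open>?x\<close> for \<open>A\<close>.
\<close>

lemma schur_psd:
  assumes K: "finite K" and A: "psd_on K A" and L: "L \<subseteq> K"
  shows "psd_on (K - L) (schur L A)"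
  unfolding psd_on_def
proof (intro conjI allI)
  show "symmetric_on (K - L) (schur L A)"
    using schur_symmetric[OF assms] symmetric_on_subset by blast
next
  fix x
  have fL: "finite L" using K L by (rule finite_subset[rotated])
  let ?g = "mv L (pinv L A) (mv (K - L) A x)"
  let ?x = "\<lambda>i. if i \<in> L then - ?g i else x i"
  have g: "mv L (pinv L A) (mv (K - L) A ?x) = ?g"
  proof -
    have "mv (K - L) A ?x = mv (K - L) A x" by (rule ext, rule mv_cong) auto
    then show ?thesis by simp
  qed
  have "0 \<le> bil K A ?x ?x" using A by (rule psd_onD)
  also have "\<dots> = bil (K - L) (schur L A) ?x ?x + bil L A (\<lambda>i. ?x i + ?g i) (\<lambda>i. ?x i + ?g i)"
    unfolding schur_energy[OF assms, of ?x] g ..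
  also have "bil L A (\<lambda>i. ?x i + ?g i) (\<lambda>i. ?x i + ?g i) = bil L A (\<lambda>_. 0) (\<lambda>_. 0)"
    by (rule bil_cong) auto
  also have "bil (K - L) (schur L A) ?x ?x = bil (K - L) (schur L A) x x"
    by (rule bil_cong) auto
  finally show "0 \<le> bil (K - L) (schur L A) x x" by (simp add: bil_def mv_zero dotp_def)
qed

lemma schur_le:
  assumes K: "finite K" and A: "psd_on K A" and L: "L \<subseteq> K"
  shows "bil (K - L) (schur L A) x x \<le> bil K A x x"
  unfolding schur_energy[OF assms, of x] using psd_on_subset[OF K A L] by (simp add: psd_on_def)

lemma psd_add:
  "psd_on K A \<Longrightarrow> psd_on K B \<Longrightarrow> psd_on K (\<lambda>i j. A i j + B i j)"
  by (auto simp: psd_on_def symmetric_on_def bil_add_mat)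

text \<open>
  With \<open>G\<close> the pseudo-inverse of \<open>A + B\<close>, the parallel sum \<open>B G A\<close> equals \<open>A - A G A\<close> and
  \<open>A G B\<close>: the ranges of \<open>A\<close> and \<open>B\<close> lie in that of \<open>A + B\<close>, on which \<open>(A + B) G\<close> and
  \<open>G (A + B)\<close> act as the identity.
\<close>

lemma par_sum_forms:
  assumes K: "finite K" and A: "psd_on K A" and B: "psd_on K B"
  defines "G \<equiv> pinv K (\<lambda>i j. A i j + B i j)"
  shows "i \<in> K \<Longrightarrow> mv K (par_sum K A B) x i = mv K A x i - mv K A (mv K G (mv K A x)) i"
    and "i \<in> K \<Longrightarrow> mv K (par_sum K A B) x i = mv K A (mv K G (mv K B x)) i"
proof -
  let ?M = "\<lambda>i j. A i j + B i j"
  have sM: "symmetric_on K ?M" using psd_add[OF A B] by (rule psd_onD)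
  have "mv K ?M (mv K G (mv K C x)) i = mv K C x i"
    if i: "i \<in> K" and C: "psd_on K C" "\<And>y. bil K C y y \<le> bil K ?M y y" for C x i
    unfolding G_def
  proof (rule pinv_solves[OF K sM _ i])
    fix y assume "\<And>i. i \<in> K \<Longrightarrow> mv K ?M y i = 0"
    then have "bil K ?M y y = 0" by (simp add: bil_def dotp_def)
    then have "bil K C y y = 0" using C(2)[of y] psd_onD(2)[OF C(1), of y] by linarith
    then have "bil K C y x = 0" by (rule psd_bil_zero[OF C(1)])
    then show "dotp K (mv K C x) y = 0"
      using bil_commute[OF psd_onD(1)[OF C(1)], of x y] by (simp add: bil_def)
  qed
  then have MA: "mv K ?M (mv K G (mv K A x)) i = mv K A x i"
    and MB: "mv K ?M (mv K G (mv K B x)) i = mv K B x i" if "i \<in> K" for x i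
    using that A B psd_onD(2)[OF A] psd_onD(2)[OF B] by (simp_all add: bil_add_mat)
  show 1: "mv K (par_sum K A B) x i = mv K A x i - mv K A (mv K G (mv K A x)) i" if i: "i \<in> K" for i x
    using MA[OF i, of x] by (simp add: par_sum_def mv_mm G_def mv_add_mat)
  have GM: "mv K A (mv K G (mv K ?M x)) i = mv K A x i" if i: "i \<in> K" for i x
  proof -
    have "bil K (mm K A (mm K G ?M)) x y = bil K A x y" for x y
    proof -
      have "bil K (mm K A (mm K G ?M)) x y = bil K A (mv K G (mv K ?M x)) y"
        by (simp add: bil_def mv_mm)
      also have "\<dots> = bil K G (mv K ?M x) (mv K A y)"
        using bil_commute[OF psd_onD(1)[OF A], of _ y] by (simp add: bil_def dotp_commute)
      also have "\<dots> = bil K ?M (mv K G (mv K A y)) x"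
        using bil_commute[OF pinv_symmetric(2)[OF K sM], of "mv K ?M x"] bil_commute[OF sM, of _ x]
        by (simp add: bil_def dotp_commute G_def)
      also have "\<dots> = dotp K (mv K A y) x"
        unfolding bil_def using MA by (intro dotp_cong) auto
      also have "\<dots> = bil K A x y"
        using bil_commute[OF psd_onD(1)[OF A]] by (simp add: bil_def)
      finally show ?thesis .
    qed
    then have "dotp K (\<lambda>i. mv K (mm K A (mm K G ?M)) x i - mv K A x i) y = 0" for y
      by (simp add: bil_def dotp_diff)
    then show ?thesis using dotp_self_eq_0[OF K _ i] by (fastforce simp: mv_mm)
  qed
  show "mv K (par_sum K A B) x i = mv K A (mv K G (mv K B x)) i" if i: "i \<in> K"
    using 1[OF i, of x] GM[OF i, of x] by (simp add: mv_add_mat mv_add)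
qed

text \<open>
  With \<open>u = G A x\<close> and \<open>v = G B x\<close>, which add up to \<open>x\<close> modulo the common kernel, one has
  \<open>B u = A v\<close>, and the energy of \<open>x\<close> for the parallel sum is that of \<open>u\<close> for \<open>B\<close> plus that of \<open>v\<close>
  for \<open>A\<close>.  The upper bound comes from the form \<open>A - A G A\<close>.
\<close>

lemma par_sum_psd_le:
  assumes K: "finite K" and A: "psd_on K A" and B: "psd_on K B"
  shows "psd_on K (par_sum K A B)" "bil K (par_sum K A B) x x \<le> bil K A x x"
proof -
  let ?M = "\<lambda>i j. A i j + B i j"
  define G where "G = pinv K ?M"
  have M: "psd_on K ?M" by (rule psd_add[OF A B])
  have G: "psd_on K G" unfolding G_def by (rule pinv_psd[OF K M])
  note f = par_sum_forms[OF K A B, folded G_def]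
  note sA = bil_commute[OF psd_onD(1)[OF A]] and sB = bil_commute[OF psd_onD(1)[OF B]]
    and sG = bil_commute[OF psd_onD(1)[OF G]]
  have AGA: "bil K (par_sum K A B) x y = bil K A x y - bil K G (mv K A x) (mv K A y)" for x y
  proof -
    have "bil K (par_sum K A B) x y = bil K A x y - bil K A (mv K G (mv K A x)) y"
      unfolding bil_def dotp_diff(1)[symmetric] using f(1) by (intro dotp_cong) auto
    then show ?thesis using sA[of _ y] by (simp add: bil_def dotp_commute)
  qed
  have BGA: "bil K (par_sum K A B) x y = bil K B (mv K G (mv K A x)) y" for x y
    by (simp add: bil_def par_sum_def mv_mm G_def)
  have AGB: "bil K (par_sum K A B) x y = bil K A (mv K G (mv K B x)) y" for x y
    unfolding bil_def using f(2) by (intro dotp_cong) auto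
  have sym: "bil K (par_sum K A B) x y = bil K (par_sum K A B) y x" for x y
    unfolding AGA using sA[of x y] sG by simp
  have GMG: "mv K G (mv K ?M (mv K G y)) i = mv K G y i" if "i \<in> K" for y i
    unfolding G_def by (rule pinv_reflexive(2)[OF K psd_onD(1)[OF M] that])
  have nonneg: "0 \<le> bil K (par_sum K A B) x x" for x
  proof -
    define u where "u = mv K G (mv K A x)"
    define v where "v = mv K G (mv K B x)"
    have uv: "bil K B u y = bil K A v y" for y
      using BGA[of x y] AGB[of x y] by (simp add: u_def v_def)
    have Buv: "bil K (par_sum K A B) x x = bil K B u u + bil K A v v"
    proof -
      have "bil K (par_sum K A B) x x = bil K B u x" by (simp add: BGA u_def)
      also have "\<dots> = bil K A v x" by (rule uv)
      also have "\<dots> = bil K A (\<lambda>i. u i + v i) v"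
      proof -
        have eq: "bil K A z (\<lambda>i. u i + v i) = bil K A z x" for z
        proof -
          have "(\<lambda>i. u i + v i) = mv K G (mv K ?M x)"
            by (simp add: u_def v_def mv_add_mat mv_add)
          then have "bil K A z (\<lambda>i. u i + v i) = bil K G (mv K ?M x) (mv K A z)"
            by (simp add: bil_def dotp_commute)
          also have "\<dots> = bil K ?M x (mv K G (mv K A z))"
            by (subst sG) (simp add: bil_def dotp_commute)
          also have "\<dots> = bil K A x (mv K G (mv K A z)) + bil K B x (mv K G (mv K A z))"
            by (rule bil_add_mat)
          also have "\<dots> = bil K G (mv K A z) (mv K A x) + bil K (par_sum K A B) z x"
            using sB[of x] by (simp add: BGA) (simp add: bil_def dotp_commute)
          also have "\<dots> = bil K A z x" by (simp add: AGA)
          finally show ?thesis .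
        qed
        show ?thesis by (metis eq sA)
      qed
      also have "\<dots> = bil K A v u + bil K A v v" using sA[of u v] by (simp add: bil_add)
      also have "bil K A v u = bil K B u u" by (rule uv[symmetric])
      finally show ?thesis .
    qed
    then show ?thesis using psd_onD(2)[OF A, of v] psd_onD(2)[OF B, of u] by simp
  qed
  then show "psd_on K (par_sum K A B)"
    using symmetric_onI_bil[OF K sym] by (auto simp: psd_on_def)
  show "bil K (par_sum K A B) x x \<le> bil K A x x"
    unfolding AGA using psd_onD(2)[OF G] by simp
qed

lemma par_sum_commute:
  assumes K: "finite K" and A: "psd_on K A" and B: "psd_on K B"
  shows "bil K (par_sum K A B) x y = bil K (par_sum K B A) x y"
proof -
  have "pinv K (\<lambda>i j. B i j + A i j) = pinv K (\<lambda>i j. A i j + B i j)"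
    by (simp add: add.commute)
  then show ?thesis
    unfolding bil_def using par_sum_forms(2)[OF assms]
    by (intro dotp_cong) (auto simp: par_sum_def[of K B A] mv_mm)
qed
text \<open>
  The bound by the second summand of a parallel sum follows from the one by the first, because the
  parallel sum is commutative.
\<close>

lemma par_sum_list_psd_le:
  assumes K: "finite K" and "As \<noteq> []" "\<And>A. A \<in> set As \<Longrightarrow> psd_on K A"
  shows "psd_on K (par_sum_list K As) \<and> (\<forall>A\<in>set As. bil K (par_sum_list K As) x x \<le> bil K A x x)"
  using assms
proof (induction K As rule: par_sum_list.induct)
  case (3 K A B As)
  note K = \<open>finite K\<close>
  let ?R = "par_sum_list K (B # As)"
  have R: "psd_on K ?R" "\<forall>C\<in>set (B # As). bil K ?R x x \<le> bil K C x x" and A: "psd_on K A"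
    using 3 by auto
  have "bil K (par_sum K A ?R) x x \<le> bil K ?R x x"
    using par_sum_psd_le(2)[OF K R(1) A] par_sum_commute[OF K A R(1)] by simp
  then show ?case
    using par_sum_psd_le[OF K A R(1)] R(2) by (auto intro: order_trans)
qed auto


section \<open>Piecewise affine functions on the mesh\<close>

text \<open>
  The differences to a fixed vertex are independent, so a linear functional with prescribed values on
  them exists.
\<close>

lemma affine_interpolation:
  fixes S :: "'a::euclidean_space set" and f :: "'a \<Rightarrow> real"
  assumes "\<not> affine_dependent S"
  shows "\<exists>g c. \<forall>x\<in>S. g \<bullet> x + c = f x"
proof (cases "S = {}")
  case False
  then obtain a where a: "a \<in> S" by auto
  have "independent ((\<lambda>x. - a + x) ` (S - {a}))"
    using assms affine_dependent_iff_dependent2[OF a] by simp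
  from linear_independent_extend[OF this, of "\<lambda>y. f (a + y) - f a"]
  obtain h where h: "linear h" "\<forall>x\<in>(\<lambda>x. - a + x) ` (S - {a}). h x = f (a + x) - f a"
    by blast
  have "h x = adjoint h 1 \<bullet> x" for x
    using adjoint_works[OF h(1), of x 1] by (simp add: inner_commute)
  moreover have "h (x - a) = f x - f a" if "x \<in> S" for x
    using h(2) that linear_0[OF h(1)] by (cases "x = a") auto
  ultimately have "\<forall>x\<in>S. adjoint h 1 \<bullet> x + (f a - adjoint h 1 \<bullet> a) = f x"
    by (simp add: inner_diff_right algebra_simps)
  then show ?thesis by blast
qed auto

lemma affine_eq_on_convex_hull:
  fixes g g' :: "'a::euclidean_space"
  assumes "\<And>x. x \<in> S \<Longrightarrow> g \<bullet> x + c = g' \<bullet> x + c'" "x \<in> convex hull S"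
  shows "g \<bullet> x + c = g' \<bullet> x + c'"
proof -
  have "convex hull S \<subseteq> {x. (g - g') \<bullet> x = c' - c}"
    using assms(1)
    by (intro hull_minimal convex_hyperplane) (auto simp: inner_diff_left algebra_simps)
  then show ?thesis using assms(2) by (auto simp: inner_diff_left algebra_simps)
qed

lemma grad_eq:
  assumes "open S" "x \<in> S" "\<And>y. y \<in> S \<Longrightarrow> u y = g \<bullet> y + c"
  shows "grad u x = g"
proof -
  have "((\<lambda>y. g \<bullet> y + c) has_derivative (\<lambda>h. h \<bullet> g)) (at x)"
    by (auto intro!: derivative_eq_intros simp: inner_commute)
  then have "GDERIV u x :> g"
    unfolding gderiv_def
    by (rule has_derivative_transform_within_open[OF _ assms(1,2)]) (simp add: assms(3))
  moreover have "g' = g" if "GDERIV u x :> g'" for g'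
  proof -
    have "(\<lambda>h. h \<bullet> g') = (\<lambda>h. h \<bullet> g)"
      using that \<open>GDERIV u x :> g\<close> unfolding gderiv_def by (rule has_derivative_unique)
    then show ?thesis by (metis inner_commute vector_eq_ldot)
  qed
  ultimately show ?thesis unfolding grad_def by (rule the_equality)
qed

context decomposed_mesh
begin

lemma finite_tetrahedron: "K \<in> T \<Longrightarrow> finite K"
  using tetrahedra card.infinite by fastforce

lemma finite_nodes: "finite nodes"
  unfolding nodes_def using finite_mesh finite_tetrahedron by auto

lemma closed_hull: "K \<in> T \<Longrightarrow> closed (convex hull K)"
  by (simp add: finite_tetrahedron finite_imp_compact_convex_hull compact_imp_closed)

lemma in_some_tetrahedron: "x \<in> \<Omega> \<Longrightarrow> \<exists>K\<in>T. x \<in> convex hull K"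
  using covers closure_subset by blast

text \<open>
  Two different elements meet in the hull of at most three points.
\<close>

lemma negligible_hull_Int:
  assumes "K \<in> T" "L \<in> T" "K \<noteq> L"
  shows "negligible (convex hull K \<inter> convex hull L)"
proof -
  have "card (K \<inter> L) < card K"
  proof (rule psubset_card_mono[OF finite_tetrahedron[OF assms(1)]])
    have "card K = card L" using tetrahedra assms by simp
    then have "\<not> K \<subseteq> L" using card_subset_eq[OF finite_tetrahedron[OF assms(2)]] assms(3) by blast
    then show "K \<inter> L \<subset> K" by blast
  qed
  then have "interior (convex hull (K \<inter> L)) = {}"
    using tetrahedra[OF assms(1)] finite_tetrahedron[OF assms(1)]
    by (intro empty_interior_convex_hull) auto
  then show ?thesis
    unfolding conforming[OF assms(1,2)] by (simp add: negligible_convex_interior)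
qed

lemma V\<^sub>h_eqI:
  assumes u: "u \<in> V\<^sub>h" and v: "v \<in> V\<^sub>h" and eq: "\<And>q. q \<in> nodes \<Longrightarrow> u q = v q"
  shows "u = v"
proof
  fix x
  show "u x = v x"
  proof (cases "x \<in> \<Omega>")
    case True
    then obtain K where K: "K \<in> T" "x \<in> convex hull K" using in_some_tetrahedron by blast
    obtain g c g' c' where *: "\<forall>x\<in>convex hull K. u x = g \<bullet> x + c" "\<forall>x\<in>convex hull K. v x = g' \<bullet> x + c'"
      using u v K(1) unfolding V\<^sub>h_def by blast
    have "g \<bullet> x + c = g' \<bullet> x + c'"
    proof (rule affine_eq_on_convex_hull[OF _ K(2)])
      fix q assume q: "q \<in> K"
      then have "u q = v q" using K(1) by (intro eq) (auto simp: nodes_def)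
      then show "g \<bullet> q + c = g' \<bullet> q + c'" using * q hull_inc by metis
    qed
    then show ?thesis using * K(2) by simp
  qed (use u v in \<open>auto simp: V\<^sub>h_def\<close>)
qed

text \<open>
  Barycentric interpolation on the tetrahedra is consistent because the mesh is conforming, and it
  vanishes on the boundary because the boundary is a union of mesh triangles without nodes in \<open>\<Omega>\<close>.
\<close>

lemma nodal_function_exists:
  assumes p: "p \<in> \<Omega>"
  shows "\<exists>u\<in>V\<^sub>h. \<forall>q\<in>nodes. u q = (if q = p then 1 else 0)"
proof -
  let ?\<delta> = "\<lambda>q. if q = p then 1 else (0::real)"
  have "\<forall>K\<in>T. \<exists>g c. \<forall>x\<in>K. g \<bullet> x + c = ?\<delta> x"
    using tetrahedra by (intro ballI affine_interpolation) simp
  then obtain g c where gc: "\<And>K x. K \<in> T \<Longrightarrow> x \<in> K \<Longrightarrow> g K \<bullet> x + c K = ?\<delta> x"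
    by metis
  define \<phi> where "\<phi> = (\<lambda>K x. g K \<bullet> x + c K)"
  have consistent: "\<phi> K x = \<phi> L x" if "K \<in> T" "L \<in> T" "x \<in> convex hull K" "x \<in> convex hull L" for K L x
  proof -
    have "x \<in> convex hull (K \<inter> L)" using conforming that by blast
    then show ?thesis unfolding \<phi>_def
    proof (rule affine_eq_on_convex_hull[rotated])
      fix q assume "q \<in> K \<inter> L"
      then show "g K \<bullet> q + c K = g L \<bullet> q + c L"
        using gc[OF that(1), of q] gc[OF that(2), of q] by simp
    qed
  qed
  have boundary: "\<phi> K x = 0" if "K \<in> T" "x \<in> convex hull K" "x \<notin> \<Omega>" for K x
  proof -
    obtain \<B> where \<B>: "\<B> \<subseteq> {f. card f = 3 \<and> (\<exists>K\<in>T. f \<subseteq> K)}"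
      "frontier \<Omega> = (\<Union>f\<in>\<B>. convex hull f)"
      using boundary_resolved by blast
    have "x \<in> frontier \<Omega>"
      using that covers dom(1) by (auto simp: frontier_def interior_open)
    then obtain f where f: "f \<in> \<B>" "x \<in> convex hull f" unfolding \<B>(2) by blast
    then obtain L where L: "L \<in> T" "f \<subseteq> L" using \<B>(1) by blast
    have "q \<notin> \<Omega>" if "q \<in> f" for q
    proof -
      have "q \<in> frontier \<Omega>" unfolding \<B>(2) using f(1) hull_inc[OF that] by blast
      then show ?thesis using dom(1) by (simp add: frontier_def interior_open)
    qed
    then have "g L \<bullet> q + c L = 0 \<bullet> q + 0" if "q \<in> f" for q
    proof -
      have "q \<noteq> p" "q \<in> L" using that p \<open>\<And>q. q \<in> f \<Longrightarrow> q \<notin> \<Omega>\<close> L(2) by blast+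
      then show ?thesis using gc[OF L(1), of q] by simp
    qed
    then have "\<phi> L x = 0" using affine_eq_on_convex_hull[OF _ f(2), of "g L" "c L" 0 0] by (simp add: \<phi>_def)
    moreover have "x \<in> convex hull L" using f(2) hull_mono[OF L(2)] by blast
    ultimately show ?thesis using consistent[OF that(1) L(1) that(2)] by simp
  qed
  define u where "u = (\<lambda>x. if x \<in> \<Omega> then \<phi> (SOME K. K \<in> T \<and> x \<in> convex hull K) x else 0)"
  have u: "u x = \<phi> K x" if K: "K \<in> T" "x \<in> convex hull K" for K x
  proof (cases "x \<in> \<Omega>")
    case True
    have "(SOME K. K \<in> T \<and> x \<in> convex hull K) \<in> T \<and> x \<in> convex hull (SOME K. K \<in> T \<and> x \<in> convex hull K)"
      by (rule someI[of _ K]) (use K in simp)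
    then show ?thesis using consistent[OF _ K(1) _ K(2)] True by (simp add: u_def)
  qed (use boundary[OF K] in \<open>simp add: u_def\<close>)
  have "continuous_on (closure \<Omega>) u"
    unfolding covers
  proof (rule continuous_on_closed_Union[OF finite_mesh closed_hull])
    fix K assume K: "K \<in> T"
    have "continuous_on (convex hull K) (\<phi> K)" unfolding \<phi>_def by (intro continuous_intros)
    then show "continuous_on (convex hull K) u" by (rule continuous_on_eq) (simp add: u[OF K])
  qed
  moreover have "continuous_on (- \<Omega>) u"
    by (rule continuous_on_eq[of _ "\<lambda>_. 0"]) (auto simp: u_def)
  ultimately have "continuous_on (closure \<Omega> \<union> - \<Omega>) u"
    using dom(1) by (intro continuous_on_closed_Un) auto
  moreover have "closure \<Omega> \<union> - \<Omega> = UNIV" using closure_subset by blast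
  ultimately have "continuous_on UNIV u" by (simp only:)
  moreover have "u x = 0" if "x \<notin> \<Omega>" for x using that by (simp add: u_def)
  moreover have "\<exists>g c. \<forall>x\<in>convex hull K. u x = g \<bullet> x + c" if "K \<in> T" for K
    using u[OF that] by (intro exI[of _ "g K"] exI[of _ "c K"]) (simp add: \<phi>_def)
  ultimately have "u \<in> V\<^sub>h" unfolding V\<^sub>h_def by blast
  moreover have "u q = ?\<delta> q" if q: "q \<in> nodes" for q
  proof -
    obtain K where "K \<in> T" "q \<in> K" using q by (auto simp: nodes_def)
    then show ?thesis using u[of K q] gc[of K q] hull_inc[of q K] by (simp add: \<phi>_def)
  qed
  ultimately show ?thesis by blast
qed

lemma hat_in_V\<^sub>h:
  assumes "p \<in> \<Omega>"
  shows "hat p \<in> V\<^sub>h"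
proof -
  obtain u where u: "u \<in> V\<^sub>h" "\<forall>q\<in>nodes. u q = (if q = p then 1 else 0)"
    using nodal_function_exists[OF assms] by blast
  have "hat p = u" unfolding hat_def
    using u by (intro the_equality conjI V\<^sub>h_eqI) simp_all
  then show ?thesis using u by simp
qed

lemma open_subdom: "open (subdom i)"
  unfolding subdom_def using dom(1) by auto

lemma subdom_subset: "subdom i \<subseteq> \<Omega>"
  by (auto simp: subdom_def)

text \<open>Up to the null set of element boundaries the gradients are constant on each element.\<close>

lemma energy_density_integrable:
  assumes u: "u \<in> V\<^sub>h" and v: "v \<in> V\<^sub>h" and \<rho>: "set_integrable lebesgue \<Omega> \<rho>"
  shows "set_integrable lebesgue (subdom i) (\<lambda>x. \<rho> x * (grad u x \<bullet> grad v x))"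
proof -
  let ?f = "\<lambda>x. \<rho> x * (grad u x \<bullet> grad v x)"
  have piece: "set_integrable lebesgue (subdom i \<inter> interior (convex hull K)) ?f" if K: "K \<in> T" for K
  proof -
    let ?S = "subdom i \<inter> interior (convex hull K)"
    obtain g c g' c' where *: "\<And>x. x \<in> convex hull K \<Longrightarrow> u x = g \<bullet> x + c"
      "\<And>x. x \<in> convex hull K \<Longrightarrow> v x = g' \<bullet> x + c'"
      using u v K unfolding V\<^sub>h_def by blast
    have o: "open ?S" using open_subdom by auto
    have S: "y \<in> convex hull K" if "y \<in> ?S" for y using that interior_subset by blast
    have gr: "grad u x = g" "grad v x = g'" if "x \<in> ?S" for x
      using grad_eq[OF o that *(1)[OF S]] grad_eq[OF o that *(2)[OF S]] by blast+
    have "set_integrable lebesgue ?S (\<lambda>x. (g \<bullet> g') * \<rho> x)"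
    proof (intro set_integrable_mult_right set_integrable_subset[OF \<rho>])
      show "?S \<in> sets lebesgue" using o by (simp add: lmeasurable_open borel_open)
      show "?S \<subseteq> \<Omega>" using subdom_subset by blast
    qed
    then show ?thesis
      by (rule absolutely_integrable_spike[OF _ negligible_empty]) (simp add: gr)
  qed
  let ?U = "\<Union>K\<in>T. subdom i \<inter> interior (convex hull K)"
  have union: "set_integrable lebesgue (\<Union>K\<in>\<T>. subdom i \<inter> interior (convex hull K)) ?f"
    if "finite \<T>" "\<T> \<subseteq> T" for \<T>
    using that
  proof (induction \<T> rule: finite_induct)
    case (insert K \<T>)
    then show ?case
      unfolding UN_insert by (intro absolutely_integrable_Un piece) auto
  qed (simp add: absolutely_integrable_negligible)
  have "negligible (\<Union>K\<in>T. frontier (convex hull K))"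
    by (rule negligible_Union) (use finite_mesh in \<open>auto simp: negligible_convex_frontier\<close>)
  moreover have "{x \<in> subdom i - ?U. ?f x \<noteq> 0} \<subseteq> (\<Union>K\<in>T. frontier (convex hull K))"
  proof
    fix x assume x: "x \<in> {x \<in> subdom i - ?U. ?f x \<noteq> 0}"
    then have xs: "x \<in> subdom i" "x \<notin> ?U" by auto
    then obtain K where K: "K \<in> T" "x \<in> convex hull K"
      using in_some_tetrahedron[of x] subdom_subset[of i] by auto
    have "x \<in> closure (convex hull K)" using K(2) closure_subset by (rule rev_subsetD)
    moreover have "x \<notin> interior (convex hull K)" using xs K(1) by simp
    ultimately have "x \<in> frontier (convex hull K)" unfolding frontier_def by (rule DiffI)
    then show "x \<in> (\<Union>K\<in>T. frontier (convex hull K))" by (rule UN_I[OF K(1)])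
  qed
  ultimately have "negligible {x \<in> subdom i - ?U. ?f x \<noteq> 0}" by (rule negligible_subset)
  moreover have "{x \<in> ?U - subdom i. ?f x \<noteq> 0} = {}" by blast
  ultimately show ?thesis
    using absolutely_integrable_spike_set[OF union[OF finite_mesh order.refl], of "subdom i"]
      negligible_empty by metis
qed


section \<open>Combinatorics of the interface\<close>

text \<open>
  The intersection is open and covered by finitely many null sets, the intersections of elements of
  different subdomains.
\<close>

lemma subdom_disjoint:
  assumes "i \<in> {1..N}" "j \<in> {1..N}" "i \<noteq> j"
  shows "subdom i \<inter> subdom j = {}"
proof (rule ccontr)
  assume ne: "subdom i \<inter> subdom j \<noteq> {}"
  have sub: "sub i \<subseteq> T" "sub j \<subseteq> T" "sub i \<inter> sub j = {}"
    using sub_cover sub_disjoint assms by (auto simp: disjoint_family_on_def)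
  then have fin: "finite (sub i \<times> sub j)" using finite_mesh finite_subset by blast
  have "subdom i \<inter> subdom j \<subseteq> (\<Union>(K, L)\<in>sub i \<times> sub j. convex hull K \<inter> convex hull L)"
  proof
    fix x assume "x \<in> subdom i \<inter> subdom j"
    then have "x \<in> (\<Union>K\<in>sub i. convex hull K)" "x \<in> (\<Union>L\<in>sub j. convex hull L)"
      unfolding subdom_def using interior_subset by blast+
    then show "x \<in> (\<Union>(K, L)\<in>sub i \<times> sub j. convex hull K \<inter> convex hull L)" by auto
  qed
  moreover have "negligible (\<Union>(K, L)\<in>sub i \<times> sub j. convex hull K \<inter> convex hull L)"
  proof (rule negligible_Union)
    fix A assume "A \<in> (\<lambda>(K, L). convex hull K \<inter> convex hull L) ` (sub i \<times> sub j)"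
    then obtain K L where KL: "K \<in> sub i" "L \<in> sub j" "A = convex hull K \<inter> convex hull L" by auto
    then have "K \<noteq> L" "K \<in> T" "L \<in> T" using sub by auto
    then show "negligible A" using negligible_hull_Int KL(3) by simp
  qed (use fin in simp)
  ultimately have "negligible (subdom i \<inter> subdom j)" using negligible_subset by blast
  then show False using open_not_negligible[OF _ ne] open_subdom by blast
qed

lemma stratum_subset: "stratum x \<subseteq> {y \<in> interface. sharing_pt y = sharing_pt x}"
  unfolding stratum_def by (rule connected_component_subset)

lemma stratum_refl: "x \<in> interface \<Longrightarrow> x \<in> stratum x"
  by (simp add: stratum_def connected_component_refl)

lemma stratum_eq: "y \<in> stratum x \<Longrightarrow> stratum y = stratum x"
  using connected_component_eq stratum_subset unfolding stratum_def by fastforce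

lemma finite_sharing_pt: "finite (sharing_pt x)"
  by (simp add: sharing_pt_def)

text \<open>
  A point which a class accumulates at is shared by all subdomains that share the class.
\<close>

lemma shared_by_two_not_vertex:
  assumes "card (sharing_pt p) = 2"
  shows "p \<notin> vertices"
proof
  assume "p \<in> vertices"
  then obtain x where x: "card (sharing_pt x) > 2" "p \<in> closure (stratum x)"
    by (auto simp: vertices_def)
  have "sharing_pt x \<subseteq> sharing_pt p"
  proof
    fix i assume i: "i \<in> sharing_pt x"
    have "stratum x \<subseteq> closure (subdom i)"
      using stratum_subset i by (force simp: sharing_pt_def)
    then have "closure (stratum x) \<subseteq> closure (subdom i)" by (simp add: closure_minimal)
    then show "i \<in> sharing_pt p" using x(2) i by (auto simp: sharing_pt_def)
  qed
  then have "card (sharing_pt x) \<le> card (sharing_pt p)" by (intro card_mono finite_sharing_pt)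
  then show False using x assms by simp
qed

text \<open>
  Faces never contain end points of edges, so that faces and edges have the same description.
\<close>

lemma face_or_edge_cases:
  assumes "Z \<in> faces \<union> edges"
  obtains x where "x \<in> Z" "x \<in> nodes \<inter> interface" "Z = nodes \<inter> stratum x - vertices"
    "Z \<in> faces \<and> card (sharing_pt x) = 2 \<or> Z \<in> edges \<and> card (sharing_pt x) > 2"
proof -
  consider x where "Z = nodes \<inter> stratum x" "x \<in> nodes \<inter> interface" "card (sharing_pt x) = 2" "Z \<in> faces"
    | x where "Z = nodes \<inter> stratum x - vertices" "x \<in> nodes \<inter> interface - vertices" "card (sharing_pt x) > 2" "Z \<in> edges"
    using assms unfolding faces_def edges_def by blast
  then show thesis
  proof cases
    case 1
    then have "stratum x \<inter> vertices = {}"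
      using shared_by_two_not_vertex stratum_subset[of x] by fastforce
    then show thesis using 1 stratum_refl by (intro that[of x]) auto
  next
    case 2
    then show thesis using stratum_refl by (intro that[of x]) auto
  qed
qed

lemma sharing_eq:
  assumes "Z \<in> faces \<union> edges" "p \<in> Z"
  shows "sharing Z = sharing_pt p"
proof -
  obtain x where x: "x \<in> Z" "Z = nodes \<inter> stratum x - vertices"
    using face_or_edge_cases[OF assms(1)] by metis
  have *: "sharing_pt y = sharing_pt x" if "y \<in> Z" for y
    using that x(2) stratum_subset by blast
  show ?thesis
  proof
    show "sharing Z \<subseteq> sharing_pt p" using assms(2) by (auto simp: sharing_def sharing_pt_def)
    show "sharing_pt p \<subseteq> sharing Z"
      using * assms(2) by (fastforce simp: sharing_def sharing_pt_def)
  qed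
qed

lemma card_sharing_face: "F \<in> faces \<Longrightarrow> card (sharing F) = 2"
  and card_sharing_edge: "E \<in> edges \<Longrightarrow> card (sharing E) > 2"
proof -
  have *: "x \<in> nodes \<inter> stratum x" if "x \<in> nodes \<inter> interface" for x
    using that stratum_refl by auto
  show "card (sharing F) = 2" if F: "F \<in> faces"
  proof -
    obtain x where "F = nodes \<inter> stratum x" "x \<in> nodes \<inter> interface" "card (sharing_pt x) = 2"
      using F unfolding faces_def by blast
    then show ?thesis using sharing_eq[of F x] F * by auto
  qed
  show "card (sharing E) > 2" if E: "E \<in> edges"
  proof -
    obtain x where "E = nodes \<inter> stratum x - vertices" "x \<in> nodes \<inter> interface - vertices" "card (sharing_pt x) > 2"
      using E unfolding edges_def by blast
    then show ?thesis using sharing_eq[of E x] E * by auto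
  qed
qed

lemma faces_edges_disjoint: "Z \<in> faces \<Longrightarrow> Z \<notin> edges"
  using card_sharing_face card_sharing_edge by fastforce

lemma face_or_edge_unique:
  assumes "Z \<in> faces \<union> edges" "Z' \<in> faces \<union> edges" "p \<in> Z" "p \<in> Z'"
  shows "Z = Z'"
proof -
  obtain x where x: "Z = nodes \<inter> stratum x - vertices"
    using face_or_edge_cases[OF assms(1)] by metis
  obtain x' where x': "Z' = nodes \<inter> stratum x' - vertices"
    using face_or_edge_cases[OF assms(2)] by metis
  have "stratum x = stratum p" "stratum x' = stratum p"
    using stratum_eq[of p] assms(3,4) x x' by auto
  then show ?thesis using x x' by simp
qed

lemma finite_faces_edges: "finite (faces \<union> edges)" "Z \<in> faces \<union> edges \<Longrightarrow> finite Z"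
proof -
  have *: "Z \<subseteq> nodes" if "Z \<in> faces \<union> edges" for Z
    using face_or_edge_cases[OF that] by blast
  then show "finite (faces \<union> edges)"
    using finite_nodes by (intro finite_subset[of "faces \<union> edges" "Pow nodes"]) auto
  show "Z \<in> faces \<union> edges \<Longrightarrow> finite Z" using * finite_nodes finite_subset by blast
qed

lemma finite_sharing: "finite (sharing Z)"
  by (simp add: sharing_def)

lemma sharing_subset: "sharing Z \<subseteq> {1..N}"
  by (auto simp: sharing_def)

text \<open>
  A node on the boundary of one subdomain cannot lie inside another one, because the subdomains are
  open and disjoint.
\<close>

lemma face_or_edge_subset_W_nodes:
  assumes Z: "Z \<in> faces \<union> edges" and l: "l \<in> sharing Z"
  shows "Z \<subseteq> W_nodes l - vertices"
proof
  fix p assume p: "p \<in> Z"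
  obtain x where "Z = nodes \<inter> stratum x - vertices"
    using face_or_edge_cases[OF Z] by metis
  then have p': "p \<in> nodes" "p \<notin> vertices" "p \<in> interface"
    using p stratum_subset by auto
  then obtain i where i: "i \<in> {1..N}" "p \<in> frontier (subdom i)" "p \<in> \<Omega>"
    by (auto simp: interface_def)
  have "p \<notin> subdom l"
  proof (cases "i = l")
    case True
    then show ?thesis using i open_subdom by (simp add: frontier_def interior_open)
  next
    case False
    then have "subdom i \<inter> subdom l = {}" using subdom_disjoint i l sharing_subset by blast
    then have "closure (subdom i) \<inter> subdom l = {}"
      using open_Int_closure_eq_empty[OF open_subdom] by (metis inf_commute)
    then show ?thesis using i by (auto simp: frontier_def)
  qed
  moreover have "p \<in> closure (subdom l)" using l p by (auto simp: sharing_def)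
  ultimately show "p \<in> W_nodes l - vertices"
    using p' i open_subdom by (simp add: W_nodes_def frontier_def interior_open)
qed

lemma W_nodes_subset: "W_nodes i \<subseteq> X_nodes i"
  by (auto simp: W_nodes_def X_nodes_def frontier_def)

lemma finite_X_nodes: "finite (X_nodes i)" and finite_W_nodes: "finite (W_nodes i)"
  using finite_nodes by (simp_all add: X_nodes_def W_nodes_def)

end


section \<open>Positive semidefiniteness of the local matrices\<close>

context feti_dp
begin

text \<open>
  The energy is the integral of \<open>\<rho>\<close> times the squared length of the combined gradient.  The
  integrability of each entry is needed to pass from the sum of integrals to the integral of the
  sum.
\<close>

lemma A_loc_psd: "psd_on (X_nodes i) (A_loc i)"
  unfolding psd_on_def
proof (intro conjI allI)
  show "symmetric_on (X_nodes i) (A_loc i)"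
    by (simp add: symmetric_on_def A_loc_def energy_def inner_commute)
next
  fix x
  let ?K = "X_nodes i"
  let ?f = "\<lambda>p q z. indicator (subdom i) z *\<^sub>R (\<rho> z * (grad (hat p) z \<bullet> grad (hat q) z))"
  have int: "integrable lebesgue (?f p q)" if "p \<in> ?K" "q \<in> ?K" for p q
    using energy_density_integrable[OF _ _ rho_integrable, of "hat p" "hat q" i] hat_in_V\<^sub>h that
    by (simp add: set_integrable_def X_nodes_def)
  have "bil ?K (A_loc i) x x = (\<Sum>p\<in>?K. \<Sum>q\<in>?K. (x p * x q) * integral\<^sup>L lebesgue (?f p q))"
    unfolding bil_def dotp_def mv_def A_loc_def energy_def set_lebesgue_integral_def
    by (simp add: sum_distrib_right sum_distrib_left mult_ac)
  also have "\<dots> = (LINT z|lebesgue. (\<Sum>p\<in>?K. \<Sum>q\<in>?K. (x p * x q) * ?f p q z))"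
    using int by (simp add: Bochner_Integration.integral_sum)
  also have "\<dots> \<ge> 0"
  proof (rule integral_nonneg_AE)
    obtain \<rho>\<^sub>0 where "\<rho>\<^sub>0 > 0" and \<rho>\<^sub>0: "AE z in lebesgue. z \<in> \<Omega> \<longrightarrow> \<rho>\<^sub>0 \<le> \<rho> z"
      using rho_uniformly_positive by blast
    from \<rho>\<^sub>0 show "AE z in lebesgue. 0 \<le> (\<Sum>p\<in>?K. \<Sum>q\<in>?K. (x p * x q) * ?f p q z)"
    proof eventually_elim
      fix z assume z: "z \<in> \<Omega> \<longrightarrow> \<rho>\<^sub>0 \<le> \<rho> z"
      let ?G = "\<Sum>p\<in>?K. x p *\<^sub>R grad (hat p) z"
      have "(\<Sum>p\<in>?K. \<Sum>q\<in>?K. (x p * x q) * ?f p q z) = indicator (subdom i) z * \<rho> z * (?G \<bullet> ?G)"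
        by (simp add: inner_sum_left inner_sum_right sum_distrib_left mult_ac) (simp add: inner_commute)
      also have "\<dots> \<ge> 0"
        using z \<open>\<rho>\<^sub>0 > 0\<close> subdom_subset by (cases "z \<in> subdom i") auto
      finally show "0 \<le> (\<Sum>p\<in>?K. \<Sum>q\<in>?K. (x p * x q) * ?f p q z)" .
    qed
  qed
  finally show "0 \<le> bil ?K (A_loc i) x x" .
qed

lemma S_loc_psd: "psd_on (W_nodes i) (S_loc i)"
proof -
  have "X_nodes i - (X_nodes i - W_nodes i) = W_nodes i" using W_nodes_subset by blast
  then show ?thesis
    unfolding S_loc_def using schur_psd[OF finite_X_nodes A_loc_psd, of "X_nodes i - W_nodes i" i] by simp
qed

text \<open>
  Restriction to \<open>Z\<close> followed by the minimal extension does not increase the energy.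
\<close>

lemma S_tilde_loc_psd_le:
  assumes "Z \<subseteq> W_nodes i"
  shows "psd_on Z (S_tilde_loc i Z)" "bil Z (S_tilde_loc i Z) x x \<le> bil (W_nodes i) (S_loc i) x x"
proof -
  have Z: "W_nodes i - (W_nodes i - Z) = Z" using assms by blast
  show "psd_on Z (S_tilde_loc i Z)" "bil Z (S_tilde_loc i Z) x x \<le> bil (W_nodes i) (S_loc i) x x"
    unfolding S_tilde_loc_def
    using schur_psd[OF finite_W_nodes S_loc_psd, of "W_nodes i - Z" i]
      schur_le[OF finite_W_nodes S_loc_psd, of "W_nodes i - Z" i x] Z by simp_all
qed

lemma S_Z_le:
  assumes Z: "Z \<in> faces \<union> edges" and m: "m \<in> sharing Z"
  shows "bil Z (S_Z Z) x x \<le> bil Z (S_tilde_loc m Z) x x"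
proof -
  let ?As = "map (\<lambda>m. S_tilde_loc m Z) (sorted_list_of_set (sharing Z))"
  have "psd_on Z A" if A: "A \<in> set ?As" for A
  proof -
    obtain l where "l \<in> sharing Z" "A = S_tilde_loc l Z" using A finite_sharing by auto
    then show ?thesis using face_or_edge_subset_W_nodes[OF Z, of l] S_tilde_loc_psd_le(1)[of Z l] by auto
  qed
  moreover have m: "S_tilde_loc m Z \<in> set ?As" using m finite_sharing by auto
  moreover from m have "?As \<noteq> []" by (metis empty_iff empty_set)
  ultimately show ?thesis
    unfolding S_Z_def using par_sum_list_psd_le[OF finite_faces_edges(2)[OF Z], of ?As] by blast
qed

lemma S_loc_psd_on:
  assumes "Z \<in> faces \<union> edges" "m \<in> sharing Z"
  shows "psd_on Z (S_loc m)"
  using psd_on_subset[OF finite_W_nodes S_loc_psd] face_or_edge_subset_W_nodes[OF assms] by blast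

lemma A_Z_energy:
  "bil Z (A_Z Z) x y = (\<Sum>m\<in>sharing Z. \<Sum>l\<in>sharing Z - {m}.
     bil Z (S_loc m) (mv Z (D Z l) x) (mv Z (D Z l) y))"
proof -
  have "mv Z (A_Z Z) x = (\<lambda>i. \<Sum>m\<in>sharing Z. \<Sum>l\<in>sharing Z - {m}.
      mv Z (mtr (D Z l)) (mv Z (S_loc m) (mv Z (D Z l) x)) i)"
  proof
    fix i
    have "mv Z (A_Z Z) x i = (\<Sum>m\<in>sharing Z. \<Sum>l\<in>sharing Z - {m}.
        mv Z (mm Z (mtr (D Z l)) (mm Z (S_loc m) (D Z l))) x i)"
      unfolding A_Z_def mv_def sum_distrib_right
      by (subst sum.swap, intro sum.cong refl, subst sum.swap, simp)
    then show "mv Z (A_Z Z) x i = (\<Sum>m\<in>sharing Z. \<Sum>l\<in>sharing Z - {m}.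
        mv Z (mtr (D Z l)) (mv Z (S_loc m) (mv Z (D Z l) x)) i)"
      by (simp add: mv_mm)
  qed
  then show ?thesis
    unfolding bil_def by (simp add: dotp_sum dotp_mv_mtr[of Z Z "mtr _"])
qed

lemma A_Z_psd:
  assumes "Z \<in> faces \<union> edges"
  shows "psd_on Z (A_Z Z)"
proof -
  note S = S_loc_psd_on[OF assms]
  have "bil Z (A_Z Z) x y = bil Z (A_Z Z) y x" for x y
    unfolding A_Z_energy using S by (intro sum.cong refl bil_commute psd_onD(1)) auto
  moreover have "0 \<le> bil Z (A_Z Z) x x" for x
    unfolding A_Z_energy using S by (intro sum_nonneg psd_onD(2)) auto
  ultimately show ?thesis
    using symmetric_onI_bil[OF finite_faces_edges(2)[OF assms]] by (simp add: psd_on_def)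
qed

end


section \<open>Generalized eigenvectors as an orthonormal basis\<close>

text \<open>
  The \<open>card K\<close> orthonormal vectors together with \<open>w\<close> are dependent, and \<open>w\<close> takes part in the
  relation since the orthonormal vectors alone are independent.
\<close>

lemma orthonormal_expansion:
  assumes K: "finite K"
    and on: "\<And>k l. k < card K \<Longrightarrow> l < card K \<Longrightarrow> bil K A (e k) (e l) = unit_mat k l"
    and i: "i \<in> K"
  shows "w i = (\<Sum>k<card K. bil K A w (e k) * e k i)"
proof -
  let ?n = "card K"
  have sum_unit: "(\<Sum>k<?n. c k * unit_mat k l) = c l" if "l < ?n" for c :: "nat \<Rightarrow> real" and l
    using that by (simp add: unit_mat_def if_distrib[of "(*) _"] cong: if_cong)
  have coeff: "bil K A (\<lambda>i. \<Sum>k<?n. c k * e k i) (e l) = c l" if "l < ?n" for c l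
  proof -
    have "bil K A (\<lambda>i. \<Sum>k<?n. c k * e k i) (e l) = (\<Sum>k<?n. c k * unit_mat k l)"
      unfolding bil_sum bil_scale using that on by (intro sum.cong) auto
    then show ?thesis using sum_unit[OF that] by simp
  qed
  define v where "v = (\<lambda>k. if k = ?n then w else e k)"
  obtain c where c: "\<exists>k\<in>{..?n}. c k \<noteq> 0" "\<forall>i\<in>K. (\<Sum>k\<le>?n. c k * v k i) = 0"
    using more_vectors_than_dimension_dependent[OF K, of "{..?n}" v] by auto
  have rel: "c ?n * w i + (\<Sum>k<?n. c k * e k i) = 0" if "i \<in> K" for i
  proof -
    have "(\<Sum>k\<le>?n. c k * v k i) = (\<Sum>k<?n. c k * v k i) + c ?n * v ?n i"
      by (simp add: lessThan_Suc_atMost[symmetric])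
    also have "(\<Sum>k<?n. c k * v k i) = (\<Sum>k<?n. c k * e k i)"
      by (intro sum.cong) (auto simp: v_def)
    finally show ?thesis using c(2) that by (simp add: v_def)
  qed
  have "c ?n * bil K A w (e l) + c l = 0" if "l < ?n" for l
  proof -
    have "bil K A (\<lambda>i. c ?n * w i + (\<Sum>k<?n. c k * e k i)) (e l) = bil K A (\<lambda>i. 0) (e l)"
      using rel by (intro bil_cong) auto
    then show ?thesis using coeff[OF that, of c] by (simp add: bil_add bil_scale) (simp add: bil_def mv_zero dotp_def)
  qed
  note cl = this
  have "c ?n \<noteq> 0"
  proof
    assume "c ?n = 0"
    then have "c k = 0" if "k \<le> ?n" for k using cl[of k] that by (cases "k = ?n") auto
    then show False using c(1) by auto
  qed
  moreover have "c ?n * w i = c ?n * (\<Sum>k<?n. bil K A w (e k) * e k i)"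
  proof -
    have "c ?n * w i = (\<Sum>k<?n. - c k * e k i)" using rel[OF i] by (simp add: sum_negf)
    also have "\<dots> = (\<Sum>k<?n. c ?n * (bil K A w (e k) * e k i))"
    proof (rule sum.cong)
      fix k assume "k \<in> {..<?n}"
      then have "- c k = c ?n * bil K A w (e k)" using cl[of k] by auto
      then show "- c k * e k i = c ?n * (bil K A w (e k) * e k i)" by simp
    qed simp
    finally show ?thesis by (simp add: sum_distrib_left)
  qed
  ultimately show ?thesis by simp
qed

lemma orthonormal_energy:
  fixes J :: "nat set"
  assumes J: "finite J"
    and diag: "\<And>k l. k \<in> J \<Longrightarrow> l \<in> J \<Longrightarrow> bil K S (e k) (e l) = \<theta> k * unit_mat k l"
  shows "bil K S (\<lambda>i. \<Sum>k\<in>J. c k * e k i) (\<lambda>i. \<Sum>k\<in>J. c k * e k i) = (\<Sum>k\<in>J. \<theta> k * (c k)\<^sup>2)"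
proof -
  have "bil K S (\<lambda>i. \<Sum>k\<in>J. c k * e k i) (\<lambda>i. \<Sum>k\<in>J. c k * e k i)
      = (\<Sum>k\<in>J. \<Sum>l\<in>J. if k = l then \<theta> k * (c k)\<^sup>2 else 0)"
    unfolding bil_sum bil_scale
    by (intro sum.cong refl) (auto simp: diag unit_mat_def power2_eq_square)
  also have "\<dots> = (\<Sum>k\<in>J. \<theta> k * (c k)\<^sup>2)" using J by simp
  finally show ?thesis .
qed

context adaptive_feti_dp
begin

lemma ev_orthonormal:
  assumes "Z \<in> faces \<union> edges" "k < card Z" "l < card Z"
  shows "bil Z (A_Z Z) (ev Z k) (ev Z l) = unit_mat k l"
  unfolding bil_def by (rule orthonormal[OF assms])

lemma ev_expansion:
  assumes Z: "Z \<in> faces \<union> edges" and p: "p \<in> Z"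
  shows "w p = (\<Sum>k<card Z. bil Z (A_Z Z) w (ev Z k) * ev Z k p)"
  by (rule orthonormal_expansion[OF finite_faces_edges(2)[OF Z] _ p]) (rule ev_orthonormal[OF Z])

text \<open>
  In the basis of eigenvectors the form \<open>S_Z\<close> is diagonal with entries \<open>\<theta> = 1 / \<lambda>\<close>, read as 0
  for \<open>\<lambda> = \<infinity>\<close>.  An eigenvector that is not selected has \<open>\<lambda> \<le> tol\<close>, which forces \<open>tol > 0\<close>; using \<open>max tol 0\<close>
  keeps the bound meaningful when everything is selected.
\<close>

lemma S_Z_diagonal:
  assumes Z: "Z \<in> faces \<union> edges"
  shows "\<exists>\<theta>. \<forall>k<card Z. 0 \<le> \<theta> k \<and> (k \<notin> selected Z \<longrightarrow> 1 \<le> max tol 0 * \<theta> k) \<and>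
      (\<forall>l<card Z. bil Z (S_Z Z) (ev Z k) (ev Z l) = \<theta> k * unit_mat k l)"
proof -
  have "\<exists>t\<ge>0. (k \<notin> selected Z \<longrightarrow> 1 \<le> max tol 0 * t) \<and>
      (\<forall>l<card Z. bil Z (S_Z Z) (ev Z k) (ev Z l) = t * unit_mat k l)" if k: "k < card Z" for k
  proof -
    consider "lam Z k = \<infinity>" "\<forall>p\<in>Z. mv Z (S_Z Z) (ev Z k) p = 0"
      | r where "r > 0" "lam Z k = ereal r" "\<forall>p\<in>Z. mv Z (A_Z Z) (ev Z k) p = r * mv Z (S_Z Z) (ev Z k) p"
      using eigenpairs[OF Z k] unfolding gen_eigenpair_def by blast
    then show ?thesis
    proof cases
      case 1
      have "k \<in> selected Z" using Z k 1(1) by (auto simp: selected_def)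
      moreover have "bil Z (S_Z Z) (ev Z k) (ev Z l) = 0" for l
        unfolding bil_def dotp_def using 1(2) by simp
      ultimately show ?thesis by (intro exI[of _ 0]) simp
    next
      case 2
      have "1 \<le> max tol 0 * (1 / r)" if "k \<notin> selected Z"
      proof -
        have "r \<le> tol" using that Z k 2(2) by (auto simp: selected_def not_le not_less)
        then show ?thesis using 2(1) by (simp add: field_simps)
      qed
      moreover have "bil Z (S_Z Z) (ev Z k) (ev Z l) = 1 / r * unit_mat k l" if "l < card Z" for l
      proof -
        have "unit_mat k l = r * bil Z (S_Z Z) (ev Z k) (ev Z l)"
          unfolding ev_orthonormal[OF Z k that, symmetric] bil_def dotp_scale[symmetric]
          using 2(3) by (intro dotp_cong) auto
        then show ?thesis using 2(1) by simp
      qed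
      ultimately show ?thesis using 2(1) by (intro exI[of _ "1 / r"]) simp
    qed
  qed
  then show ?thesis by metis
qed

text \<open>
  The projection onto the span of the eigenvectors left out of the coarse space, orthogonal with
  respect to \<open>A_Z\<close>.
\<close>

definition unselected_part :: "pt set \<Rightarrow> (pt \<Rightarrow> real) \<Rightarrow> pt \<Rightarrow> real" where
  "unselected_part Z w = (\<lambda>p. \<Sum>k\<in>{..<card Z} - selected Z. bil Z (A_Z Z) w (ev Z k) * ev Z k p)"

text \<open>
  Coefficientwise \<open>1 \<le> max tol 0 * \<theta>\<close> on the unselected eigenvectors, and leaving
  out the selected ones only decreases the energy for \<open>S_Z\<close>.
\<close>

lemma unselected_part_energy:
  assumes Z: "Z \<in> faces \<union> edges"
  shows "bil Z (A_Z Z) (unselected_part Z w) (unselected_part Z w) \<le> max tol 0 * bil Z (S_Z Z) w w"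
proof -
  define c where "c = (\<lambda>k. bil Z (A_Z Z) w (ev Z k))"
  let ?J = "{..<card Z} - selected Z"
  obtain \<theta> where "\<forall>k<card Z. 0 \<le> \<theta> k \<and> (k \<notin> selected Z \<longrightarrow> 1 \<le> max tol 0 * \<theta> k) \<and>
      (\<forall>l<card Z. bil Z (S_Z Z) (ev Z k) (ev Z l) = \<theta> k * unit_mat k l)"
    using S_Z_diagonal[OF Z] by (rule exE)
  then have \<theta>: "\<And>k. k < card Z \<Longrightarrow> 0 \<le> \<theta> k"
    "\<And>k. k < card Z \<Longrightarrow> k \<notin> selected Z \<Longrightarrow> 1 \<le> max tol 0 * \<theta> k"
    "\<And>k l. k < card Z \<Longrightarrow> l < card Z \<Longrightarrow> bil Z (S_Z Z) (ev Z k) (ev Z l) = \<theta> k * unit_mat k l"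
    by simp_all
  have "unselected_part Z w = (\<lambda>p. \<Sum>k\<in>?J. c k * ev Z k p)"
    by (simp add: unselected_part_def c_def)
  moreover have "bil Z (A_Z Z) (\<lambda>p. \<Sum>k\<in>?J. c k * ev Z k p) (\<lambda>p. \<Sum>k\<in>?J. c k * ev Z k p)
      = (\<Sum>k\<in>?J. 1 * (c k)\<^sup>2)"
    by (rule orthonormal_energy) (simp_all add: ev_orthonormal[OF Z])
  ultimately have "bil Z (A_Z Z) (unselected_part Z w) (unselected_part Z w) = (\<Sum>k\<in>?J. 1 * (c k)\<^sup>2)"
    by (simp only:)
  also have "\<dots> \<le> (\<Sum>k\<in>?J. (max tol 0 * \<theta> k) * (c k)\<^sup>2)"
    using \<theta>(2) by (intro sum_mono mult_right_mono) auto
  also have "\<dots> \<le> (\<Sum>k<card Z. (max tol 0 * \<theta> k) * (c k)\<^sup>2)"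
    using \<theta>(1) by (intro sum_mono2) auto
  also have "\<dots> = max tol 0 * (\<Sum>k<card Z. \<theta> k * (c k)\<^sup>2)"
    by (simp add: sum_distrib_left mult.assoc)
  also have "(\<Sum>k<card Z. \<theta> k * (c k)\<^sup>2)
      = bil Z (S_Z Z) (\<lambda>p. \<Sum>k<card Z. c k * ev Z k p) (\<lambda>p. \<Sum>k<card Z. c k * ev Z k p)"
    by (rule orthonormal_energy[symmetric]) (simp_all add: \<theta>(3))
  also have "\<dots> = bil Z (S_Z Z) w w"
    unfolding c_def
    by (intro bil_cong ev_expansion[OF Z, symmetric])
  finally show ?thesis .
qed

text \<open>
  If the difference of two traces is orthogonal to the selected eigenvectors, it is its own
  projection.  The projection can then be applied to each trace separately, although the traces
  themselves are in general not orthogonal to the selected eigenvectors.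
\<close>

lemma unselected_part_diff:
  assumes Z: "Z \<in> faces \<union> edges" and p: "p \<in> Z"
    and eq: "\<And>s. s \<in> selected Z \<Longrightarrow> bil Z (A_Z Z) w (ev Z s) = bil Z (A_Z Z) w' (ev Z s)"
  shows "w p - w' p = unselected_part Z w p - unselected_part Z w' p"
proof -
  have s: "selected Z \<subseteq> {..<card Z}" by (auto simp: selected_def)
  have split: "v p = unselected_part Z v p + (\<Sum>k\<in>selected Z. bil Z (A_Z Z) v (ev Z k) * ev Z k p)" for v
    using ev_expansion[OF Z p, of v]
      sum.subset_diff[OF s finite_lessThan, of "\<lambda>k. bil Z (A_Z Z) v (ev Z k) * ev Z k p"]
    unfolding unselected_part_def by (rule trans)
  have "(\<Sum>k\<in>selected Z. bil Z (A_Z Z) w (ev Z k) * ev Z k p)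
      = (\<Sum>k\<in>selected Z. bil Z (A_Z Z) w' (ev Z k) * ev Z k p)"
    using eq by (intro sum.cong) auto
  then show ?thesis using split[of w] split[of w'] by linarith
qed


section \<open>The estimate on one face or edge\<close>

text \<open>
  For traces \<open>w\<close>, the contribution of \<open>Z\<close> to the jump operator on subdomain \<open>l\<close>.
\<close>

definition weighted_jump :: "pt set \<Rightarrow> (nat \<Rightarrow> pt \<Rightarrow> real) \<Rightarrow> nat \<Rightarrow> pt \<Rightarrow> real" where
  "weighted_jump Z w l = (\<lambda>p. \<Sum>k\<in>sharing Z - {l}. mv Z (D Z k) (\<lambda>q. w l q - w k q) p)"

text \<open>
  Write \<open>g l\<close> for the projected trace of subdomain \<open>l\<close> and \<open>q l k x\<close> for the energy of
  \<open>D Z k x\<close> in subdomain \<open>l\<close>.  The Cauchy--Schwarz inequality over the \<open>n - 1\<close> neighbours bounds the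
  left-hand side by \<open>2 (n - 1)\<close> times the sum of the terms \<open>q l k (g l)\<close> and \<open>q l k (g k)\<close>.
  Collecting for each \<open>l\<close> the terms that contain \<open>g l\<close> gives the row \<open>m = l\<close> and the column \<open>k = l\<close>
  of the double sum defining the energy of \<open>g l\<close> for \<open>A_Z\<close>.  Row and column do not overlap, so
  together they cost this energy only once; a separate estimate of the two groups would lose a factor
  2 in the final constant.
\<close>

lemma weighted_jump_energy:
  assumes Z: "Z \<in> faces \<union> edges"
    and orth: "\<And>l k s. l \<in> sharing Z \<Longrightarrow> k \<in> sharing Z \<Longrightarrow> s \<in> selected Z \<Longrightarrow>
      bil Z (A_Z Z) (w l) (ev Z s) = bil Z (A_Z Z) (w k) (ev Z s)"
  shows "(\<Sum>l\<in>sharing Z. bil Z (S_loc l) (weighted_jump Z w l) (weighted_jump Z w l))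
    \<le> 2 * real (card (sharing Z) - 1) * max tol 0
       * (\<Sum>l\<in>sharing Z. bil (W_nodes l) (S_loc l) (w l) (w l))"
proof -
  let ?I = "sharing Z" and ?n = "real (card (sharing Z) - 1)"
  have fI: "finite ?I" by (rule finite_sharing)
  define g where "g = (\<lambda>l. unselected_part Z (w l))"
  define q where "q = (\<lambda>l k x. bil Z (S_loc l) (mv Z (D Z k) x) (mv Z (D Z k) x))"
  have psd: "psd_on Z (S_loc l)" if "l \<in> ?I" for l using S_loc_psd_on[OF Z that] .
  have q0: "0 \<le> q l k x" if "l \<in> ?I" for l k x
    unfolding q_def using psd_onD(2)[OF psd[OF that]] .
  have one: "bil Z (S_loc l) (weighted_jump Z w l) (weighted_jump Z w l)
      \<le> ?n * (\<Sum>k\<in>?I - {l}. 2 * q l k (g l) + 2 * q l k (g k))" if l: "l \<in> ?I" for l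
  proof -
    have term_le: "q l k (\<lambda>p. w l p - w k p) \<le> 2 * q l k (g l) + 2 * q l k (g k)" if k: "k \<in> ?I" for k
    proof -
      have "mv Z (D Z k) (\<lambda>p. w l p - w k p) = mv Z (D Z k) (\<lambda>p. g l p - g k p)"
        unfolding g_def using unselected_part_diff[OF Z _ orth[OF l k]] by (intro ext mv_cong) auto
      then show ?thesis
        unfolding q_def by (simp only: mv_diff psd_diff_bound[OF psd[OF l]])
    qed
    have "bil Z (S_loc l) (weighted_jump Z w l) (weighted_jump Z w l)
        \<le> card (?I - {l}) * (\<Sum>k\<in>?I - {l}. q l k (\<lambda>p. w l p - w k p))"
      unfolding weighted_jump_def q_def using fI by (intro psd_sum_bound psd[OF l]) auto
    also have "\<dots> \<le> card (?I - {l}) * (\<Sum>k\<in>?I - {l}. 2 * q l k (g l) + 2 * q l k (g k))"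
      by (intro mult_left_mono sum_mono term_le) auto
    finally show ?thesis using l fI by (simp add: card_Diff_singleton)
  qed
  have two: "(\<Sum>k\<in>?I - {l}. q l k (g l)) + (\<Sum>k\<in>?I - {l}. q k l (g l))
      \<le> max tol 0 * bil (W_nodes l) (S_loc l) (w l) (w l)" if l: "l \<in> ?I" for l
  proof -
    have "(\<Sum>k\<in>?I - {l}. q l k (g l)) + (\<Sum>m\<in>?I - {l}. q m l (g l))
        \<le> (\<Sum>k\<in>?I - {l}. q l k (g l)) + (\<Sum>m\<in>?I - {l}. \<Sum>k\<in>?I - {m}. q m k (g l))"
    proof (intro add_left_mono sum_mono)
      fix m assume m: "m \<in> ?I - {l}"
      show "q m l (g l) \<le> (\<Sum>k\<in>?I - {m}. q m k (g l))"
        using m l fI q0 by (intro member_le_sum) auto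
    qed
    also have "\<dots> = bil Z (A_Z Z) (g l) (g l)"
    proof -
      have "bil Z (A_Z Z) (g l) (g l) = (\<Sum>m\<in>?I. \<Sum>k\<in>?I - {m}. q m k (g l))"
        by (simp only: A_Z_energy q_def)
      then show ?thesis using sum.remove[OF fI l, of "\<lambda>m. \<Sum>k\<in>?I - {m}. q m k (g l)"] by simp
    qed
    also have "\<dots> \<le> max tol 0 * bil Z (S_Z Z) (w l) (w l)"
      unfolding g_def by (rule unselected_part_energy[OF Z])
    also have "\<dots> \<le> max tol 0 * bil (W_nodes l) (S_loc l) (w l) (w l)"
      using S_Z_le[OF Z l, of "w l"] S_tilde_loc_psd_le(2)[of Z l "w l"]
        order.trans[OF face_or_edge_subset_W_nodes[OF Z l] Diff_subset]
      by (intro mult_left_mono) (auto intro: order.trans)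
    finally show ?thesis .
  qed
  have "(\<Sum>l\<in>?I. bil Z (S_loc l) (weighted_jump Z w l) (weighted_jump Z w l))
      \<le> (\<Sum>l\<in>?I. ?n * (\<Sum>k\<in>?I - {l}. 2 * q l k (g l) + 2 * q l k (g k)))"
    by (rule sum_mono) (rule one)
  also have "\<dots> = 2 * ?n * ((\<Sum>l\<in>?I. \<Sum>k\<in>?I - {l}. q l k (g l)) + (\<Sum>l\<in>?I. \<Sum>k\<in>?I - {l}. q l k (g k)))"
    by (simp add: sum.distrib sum_distrib_left algebra_simps)
  also have "(\<Sum>l\<in>?I. \<Sum>k\<in>?I - {l}. q l k (g k)) = (\<Sum>l\<in>?I. \<Sum>k\<in>?I - {l}. q k l (g l))"
  proof -
    have *: "(\<Sum>l\<in>?I. \<Sum>k\<in>?I - {l}. f l k) = (\<Sum>l\<in>?I. \<Sum>k\<in>?I. if l = k then 0 else f l k)" for f :: "nat \<Rightarrow> nat \<Rightarrow> real"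
      using fI by (intro sum.cong refl sum.mono_neutral_cong_left) auto
    show ?thesis unfolding * by (subst sum.swap) (intro sum.cong refl, simp)
  qed
  also have "2 * ?n * ((\<Sum>l\<in>?I. \<Sum>k\<in>?I - {l}. q l k (g l)) + (\<Sum>l\<in>?I. \<Sum>k\<in>?I - {l}. q k l (g l)))
      \<le> 2 * ?n * (\<Sum>l\<in>?I. max tol 0 * bil (W_nodes l) (S_loc l) (w l) (w l))"
    unfolding sum.distrib[symmetric] by (intro mult_left_mono sum_mono two[folded sum.distrib]) auto
  also have "\<dots> = 2 * ?n * max tol 0 * (\<Sum>l\<in>?I. bil (W_nodes l) (S_loc l) (w l) (w l))"
    by (simp only: sum_distrib_left mult.assoc)
  finally show ?thesis .
qed

end


section \<open>Jumps, their weighted average and the assembled energy\<close>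

text \<open>
  Multipliers are indexed by ordered pairs \<open>l < k\<close>.  Those containing a given \<open>i\<close> correspond to the
  other elements of \<open>I\<close>, which are the partners \<open>k > i\<close> and \<open>l < i\<close>.
\<close>

lemma sum_ordered_pairs:
  fixes h :: "nat \<Rightarrow> real"
  assumes I: "finite I"
  shows "(\<Sum>l\<in>I. \<Sum>k\<in>I. if l < k then (if i = l then h k else if i = k then h l else 0) else 0)
    = (if i \<in> I then \<Sum>k\<in>I - {i}. h k else 0)"
proof -
  have "(\<Sum>l\<in>I. \<Sum>k\<in>I. if l < k then (if i = l then h k else if i = k then h l else 0) else 0)
     = (\<Sum>l\<in>I. \<Sum>k\<in>I. (if i = l then (if i < k then h k else 0) else 0)
         + (if i = k then (if l < i then h l else 0) else 0))"
    by (intro sum.cong refl) auto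
  also have "\<dots> = (\<Sum>l\<in>I. if i = l then (\<Sum>k\<in>I. if i < k then h k else 0) else 0)
      + (\<Sum>l\<in>I. if i \<in> I then (if l < i then h l else 0) else 0)"
    unfolding sum.distrib using I by (intro arg_cong2[of _ _ _ _ "(+)"] sum.cong refl) auto
  also have "\<dots> = (if i \<in> I then (\<Sum>k\<in>I. (if i < k then h k else 0) + (if k < i then h k else 0)) else 0)"
    using I by (simp add: sum.distrib)
  also have "(\<Sum>k\<in>I. (if i < k then h k else 0) + (if k < i then h k else 0)) = (\<Sum>k\<in>I - {i}. h k)"
    using I by (intro sum.mono_neutral_cong_right) auto
  finally show ?thesis .
qed

context feti_dp
begin

definition jump :: "(dof \<Rightarrow> real) \<Rightarrow> multiplier \<Rightarrow> real" where
  "jump w = mv dofs B w"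

text \<open>
  The jump operator \<open>B_D\<^sup>T B\<close>; its norm on the constrained functions governs the condition number.
\<close>

definition P_D :: "(dof \<Rightarrow> real) \<Rightarrow> dof \<Rightarrow> real" where
  "P_D w = mv mults (mtr B_D) (jump w)"

lemma finite_dofs: "finite dofs"
proof -
  have "dofs \<subseteq> (\<lambda>(i, p). Dual i p) ` ({1..N} \<times> nodes) \<union> Primal ` nodes"
    by (auto simp: dofs_def W_nodes_def vertices_def)
  then show ?thesis using finite_nodes by (auto intro: finite_subset)
qed

lemma mults_Sigma:
  "mults = (SIGMA Z:faces \<union> edges. {(l, k) \<in> sharing Z \<times> sharing Z. l < k} \<times> Z)"
  by (auto simp: mults_def)

lemma finite_mults: "finite mults"
proof -
  have "finite {(l, k) \<in> sharing Z \<times> sharing Z. l < k}" for Z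
    by (rule finite_subset[of _ "sharing Z \<times> sharing Z"]) (auto simp: finite_sharing)
  then show ?thesis
    unfolding mults_Sigma using finite_faces_edges by (intro finite_SigmaI finite_cartesian_product) auto
qed

lemma sum_mults:
  "(\<Sum>m\<in>mults. f m)
     = (\<Sum>Z\<in>faces \<union> edges. \<Sum>l\<in>sharing Z. \<Sum>k\<in>sharing Z. if l < k then \<Sum>p\<in>Z. f (Z, (l, k), p) else 0)"
  for f :: "multiplier \<Rightarrow> real"
proof -
  have fin: "finite {(l, k) \<in> sharing Z \<times> sharing Z. l < k}" for Z
    by (rule finite_subset[of _ "sharing Z \<times> sharing Z"]) (auto simp: finite_sharing)
  have "(\<Sum>m\<in>mults. f m)
      = (\<Sum>Z\<in>faces \<union> edges. \<Sum>m\<in>{(l, k) \<in> sharing Z \<times> sharing Z. l < k} \<times> Z. f (Z, m))"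
    unfolding mults_Sigma using finite_faces_edges fin
    by (subst sum.Sigma) (auto simp: case_prod_unfold intro!: finite_cartesian_product)
  also have "\<dots> = (\<Sum>Z\<in>faces \<union> edges. \<Sum>l\<in>sharing Z. \<Sum>k\<in>sharing Z. if l < k then \<Sum>p\<in>Z. f (Z, (l, k), p) else 0)"
  proof (intro sum.cong refl)
    fix Z
    let ?Q = "{(l, k) \<in> sharing Z \<times> sharing Z. l < k}"
    have "(\<Sum>m\<in>?Q \<times> Z. f (Z, m)) = (\<Sum>lk\<in>?Q. \<Sum>p\<in>Z. f (Z, lk, p))"
      by (simp add: sum.cartesian_product case_prod_unfold)
    also have "\<dots> = (\<Sum>lk\<in>sharing Z \<times> sharing Z. if fst lk < snd lk then \<Sum>p\<in>Z. f (Z, lk, p) else 0)"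
      using finite_sharing by (intro sum.mono_neutral_cong_left) auto
    also have "\<dots> = (\<Sum>l\<in>sharing Z. \<Sum>k\<in>sharing Z. if l < k then \<Sum>p\<in>Z. f (Z, (l, k), p) else 0)"
      by (simp only: sum.cartesian_product case_prod_unfold prod.collapse)
    finally show "(\<Sum>m\<in>?Q \<times> Z. f (Z, m))
      = (\<Sum>l\<in>sharing Z. \<Sum>k\<in>sharing Z. if l < k then \<Sum>p\<in>Z. f (Z, (l, k), p) else 0)" .
  qed
  finally show ?thesis .
qed

lemma jump_eq:
  assumes Z: "Z \<in> faces \<union> edges" and lk: "l \<in> sharing Z" "k \<in> sharing Z" "l < k" and p: "p \<in> Z"
  shows "jump w (Z, (l, k), p) = w (Dual l p) - w (Dual k p)"
proof -
  have "Dual l p \<in> dofs" "Dual k p \<in> dofs"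
    using face_or_edge_subset_W_nodes[OF Z lk(1)] face_or_edge_subset_W_nodes[OF Z lk(2)]
      subsetD[OF sharing_subset lk(1)] subsetD[OF sharing_subset lk(2)] p
    by (auto simp: dofs_def)
  moreover have "B (Z, (l, k), p) \<beta> = 0" if "\<beta> \<notin> {Dual l p, Dual k p}" for \<beta>
    using that by (cases \<beta>) (auto simp: B_def)
  ultimately have "jump w (Z, (l, k), p) = (\<Sum>\<beta>\<in>{Dual l p, Dual k p}. B (Z, (l, k), p) \<beta> * w \<beta>)"
    unfolding jump_def mv_def using finite_dofs by (intro sum.mono_neutral_right) auto
  then show ?thesis using lk(3) by (simp add: B_def)
qed

lemma B_D_Dual:
  assumes Z: "finite Z" and lk: "l < k"
  shows "B_D (Z, (l, k), p) (Dual i q) = (if q \<in> Z then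
     (if i = l then D Z k q p else if i = k then - D Z l q p else 0) else 0)"
proof -
  have "B_D (Z, (l, k), p) (Dual i q)
      = (\<Sum>r\<in>Z. if q = r then D Z (if i = l then k else l) r p * (if i = l then 1 else if i = k then - 1 else 0) else 0)"
    unfolding B_D_def prod.case dof.case by (intro sum.cong refl) (simp add: mtr_def B_def)
  also have "\<dots> = (\<Sum>r\<in>Z. if q = r then (if i = l then D Z k r p else if i = k then - D Z l r p else 0) else 0)"
    using lk by (intro sum.cong refl) auto
  finally show ?thesis using Z by simp
qed

lemma P_D_Primal: "P_D w (Primal p) = 0"
  by (auto simp: P_D_def mv_def mtr_def B_D_def intro!: sum.neutral split: prod.splits)

lemma face_or_edge_not_vertex: "Z \<in> faces \<union> edges \<Longrightarrow> p \<in> Z \<Longrightarrow> p \<notin> vertices"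
  using face_or_edge_cases by blast

lemma restr_on_face_or_edge: "Z \<in> faces \<union> edges \<Longrightarrow> p \<in> Z \<Longrightarrow> restr i w p = w (Dual i p)"
  using face_or_edge_not_vertex by (simp add: restr_def)

end

context adaptive_feti_dp
begin

text \<open>
  For the pair formed by \<open>i\<close> and \<open>k\<close> the sign in the column of \<open>i\<close> always turns the jump into the value on
  \<open>i\<close> minus the value on \<open>k\<close>, and the scaling is that of \<open>k\<close>.
\<close>

lemma P_D_Dual:
  "P_D w (Dual i q) = (\<Sum>Z\<in>{Z \<in> faces \<union> edges. i \<in> sharing Z}.
     if q \<in> Z then weighted_jump Z (\<lambda>l. restr l w) i q else 0)"
proof -
  let ?FE = "faces \<union> edges"
  define h where "h = (\<lambda>Z k. if q \<in> Z then mv Z (D Z k) (\<lambda>p. restr i w p - restr k w p) q else 0)"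
  have "P_D w (Dual i q) = (\<Sum>Z\<in>?FE. \<Sum>l\<in>sharing Z. \<Sum>k\<in>sharing Z.
      if l < k then \<Sum>p\<in>Z. B_D (Z, (l, k), p) (Dual i q) * jump w (Z, (l, k), p) else 0)"
    unfolding P_D_def mv_def mtr_def by (rule sum_mults)
  also have "\<dots> = (\<Sum>Z\<in>?FE. \<Sum>l\<in>sharing Z. \<Sum>k\<in>sharing Z.
      if l < k then (if i = l then h Z k else if i = k then h Z l else 0) else 0)"
  proof (intro sum.cong refl)
    fix Z l k assume Z: "Z \<in> ?FE" and l: "l \<in> sharing Z" and k: "k \<in> sharing Z"
    show "(if l < k then \<Sum>p\<in>Z. B_D (Z, (l, k), p) (Dual i q) * jump w (Z, (l, k), p) else 0)
      = (if l < k then (if i = l then h Z k else if i = k then h Z l else 0) else 0)"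
    proof (cases "l < k")
      case lk: True
      have "(\<Sum>p\<in>Z. B_D (Z, (l, k), p) (Dual i q) * jump w (Z, (l, k), p))
        = (\<Sum>p\<in>Z. if q \<in> Z then (if i = l then D Z k q p * (restr i w p - restr k w p)
             else if i = k then D Z l q p * (restr i w p - restr l w p) else 0) else 0)"
        using lk
        by (intro sum.cong refl)
          (auto simp: B_D_Dual[OF finite_faces_edges(2)[OF Z]] jump_eq[OF Z l k] restr_on_face_or_edge[OF Z]
            algebra_simps)
      also have "\<dots> = (if i = l then h Z k else if i = k then h Z l else 0)"
        using lk by (auto simp: h_def mv_def)
      finally show ?thesis using lk by simp
    qed simp
  qed
  also have "\<dots> = (\<Sum>Z\<in>?FE. if i \<in> sharing Z then \<Sum>k\<in>sharing Z - {i}. h Z k else 0)"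
    by (intro sum.cong refl sum_ordered_pairs finite_sharing)
  also have "\<dots> = (\<Sum>Z\<in>{Z \<in> ?FE. i \<in> sharing Z}. \<Sum>k\<in>sharing Z - {i}. h Z k)"
    by (rule sum.inter_filter[OF finite_faces_edges(1), symmetric])
  also have "\<dots> = (\<Sum>Z\<in>{Z \<in> ?FE. i \<in> sharing Z}.
     if q \<in> Z then weighted_jump Z (\<lambda>l. restr l w) i q else 0)"
    by (intro sum.cong refl) (auto simp: h_def weighted_jump_def)
  finally show ?thesis .
qed

text \<open>
  As the scaling matrices add up to the identity, \<open>P_D\<close> subtracts from each trace a weighted average
  that is the same for all subdomains sharing \<open>Z\<close>.
\<close>

lemma P_D_on_face_or_edge:
  assumes Z: "Z \<in> faces \<union> edges" and i: "i \<in> sharing Z" and p: "p \<in> Z"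
  shows "P_D w (Dual i p) = w (Dual i p) - (\<Sum>k\<in>sharing Z. mv Z (D Z k) (restr k w) p)"
proof -
  have "P_D w (Dual i p) = (\<Sum>Z'\<in>{Z' \<in> faces \<union> edges. i \<in> sharing Z'}.
     if Z' = Z then weighted_jump Z (\<lambda>l. restr l w) i p else 0)"
    unfolding P_D_Dual using face_or_edge_unique[OF Z _ p] p by (intro sum.cong refl) auto
  also have "\<dots> = weighted_jump Z (\<lambda>l. restr l w) i p"
    using Z i finite_faces_edges(1) by simp
  also have "\<dots> = (\<Sum>k\<in>sharing Z. mv Z (D Z k) (\<lambda>q. restr i w q - restr k w q) p)"
    unfolding weighted_jump_def using finite_sharing
    by (intro sum.mono_neutral_left) (auto simp: mv_def)
  also have "\<dots> = (\<Sum>k\<in>sharing Z. mv Z (D Z k) (restr i w) p) - (\<Sum>k\<in>sharing Z. mv Z (D Z k) (restr k w) p)"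
    by (simp add: mv_diff sum_subtractf)
  also have "(\<Sum>k\<in>sharing Z. mv Z (D Z k) (restr i w) p) = mv Z unit_mat (restr i w) p"
  proof -
    have "(\<Sum>k\<in>sharing Z. mv Z (D Z k) (restr i w) p) = (\<Sum>q\<in>Z. (\<Sum>k\<in>sharing Z. D Z k p q) * restr i w q)"
      unfolding mv_def sum_distrib_right by (rule sum.swap)
    also have "\<dots> = mv Z unit_mat (restr i w) p"
      unfolding mv_def using scaling[OF Z p] by (intro sum.cong) auto
    finally show ?thesis .
  qed
  also have "\<dots> = w (Dual i p)"
    using mv_unit_mat[OF finite_faces_edges(2)[OF Z] p] restr_on_face_or_edge[OF Z p] by simp
  finally show ?thesis .
qed

text \<open>
  The common average drops out of the jumps.
\<close>

lemma jump_P_D: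
  assumes "m \<in> mults"
  shows "jump (P_D w) m = jump w m"
proof -
  obtain Z l k p where m: "m = (Z, (l, k), p)" and Z: "Z \<in> faces \<union> edges"
    and lk: "l \<in> sharing Z" "k \<in> sharing Z" "l < k" and p: "p \<in> Z"
    using assms unfolding mults_def by blast
  show ?thesis
    unfolding m jump_eq[OF Z lk p] P_D_on_face_or_edge[OF Z lk(1) p] P_D_on_face_or_edge[OF Z lk(2) p]
    by simp
qed

lemma S_tilde_energy:
  "bil dofs S_tilde x y = (\<Sum>i\<in>{1..N}. bil (W_nodes i) (S_loc i) (restr i x) (restr i y))"
proof -
  have expand: "(\<Sum>\<beta>\<in>dofs. x \<beta> * restr i (unit_mat \<beta>) p) = restr i x p"
    if "i \<in> {1..N}" "p \<in> W_nodes i" for i p x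
  proof -
    let ?\<gamma> = "if p \<in> vertices then Primal p else Dual i p"
    have "?\<gamma> \<in> dofs" using that by (auto simp: dofs_def)
    have "(\<Sum>\<beta>\<in>dofs. x \<beta> * restr i (unit_mat \<beta>) p) = (\<Sum>\<beta>\<in>dofs. if \<beta> = ?\<gamma> then x \<beta> else 0)"
      by (intro sum.cong refl) (simp add: restr_def unit_mat_def)
    also have "\<dots> = x ?\<gamma>" using finite_dofs \<open>?\<gamma> \<in> dofs\<close> by (simp only: sum.delta if_True)
    finally show ?thesis by (simp add: restr_def)
  qed
  have "bil dofs S_tilde x y = (\<Sum>\<alpha>\<in>dofs. \<Sum>\<beta>\<in>dofs. \<Sum>i\<in>{1..N}.
      y \<alpha> * (x \<beta> * bil (W_nodes i) (S_loc i) (restr i (unit_mat \<beta>)) (restr i (unit_mat \<alpha>))))"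
    unfolding bil_def[of dofs] dotp_def[of dofs] mv_def[of dofs] S_tilde_def bil_def[symmetric]
    by (simp add: sum_distrib_right sum_distrib_left mult_ac)
  also have "\<dots> = (\<Sum>\<alpha>\<in>dofs. \<Sum>i\<in>{1..N}. \<Sum>\<beta>\<in>dofs.
      y \<alpha> * (x \<beta> * bil (W_nodes i) (S_loc i) (restr i (unit_mat \<beta>)) (restr i (unit_mat \<alpha>))))"
    by (intro sum.cong refl sum.swap)
  also have "\<dots> = (\<Sum>i\<in>{1..N}. \<Sum>\<alpha>\<in>dofs. \<Sum>\<beta>\<in>dofs.
      y \<alpha> * (x \<beta> * bil (W_nodes i) (S_loc i) (restr i (unit_mat \<beta>)) (restr i (unit_mat \<alpha>))))"
    by (rule sum.swap)
  also have "\<dots> = (\<Sum>i\<in>{1..N}. bil (W_nodes i) (S_loc i)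
      (\<lambda>p. \<Sum>\<beta>\<in>dofs. x \<beta> * restr i (unit_mat \<beta>) p) (\<lambda>p. \<Sum>\<alpha>\<in>dofs. y \<alpha> * restr i (unit_mat \<alpha>) p))"
    unfolding bil_sum(2) bil_scale(2) bil_sum(1) bil_scale(1) by (simp add: sum_distrib_left)
  also have "\<dots> = (\<Sum>i\<in>{1..N}. bil (W_nodes i) (S_loc i) (restr i x) (restr i y))"
    by (intro sum.cong refl bil_cong expand)
  finally show ?thesis .
qed

lemma S_tilde_psd: "psd_on dofs S_tilde"
proof -
  have "bil dofs S_tilde x y = bil dofs S_tilde y x" for x y
    unfolding S_tilde_energy by (intro sum.cong refl bil_commute psd_onD(1)[OF S_loc_psd])
  moreover have "0 \<le> bil dofs S_tilde x x" for x
    unfolding S_tilde_energy by (intro sum_nonneg psd_onD(2)[OF S_loc_psd])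
  ultimately show ?thesis using symmetric_onI_bil[OF finite_dofs] by (simp add: psd_on_def)
qed

lemma S_tilde_positive:
  assumes "\<alpha> \<in> dofs" "x \<alpha> \<noteq> 0"
  shows "0 < bil dofs S_tilde x x"
  using S_tilde_pos_def assms unfolding pos_def_def bil_def by blast

end

section \<open>Summation over overlapping neighbourhoods\<close>

text \<open>
  A subdomain \<open>i\<close> enters with its own multiplicity \<open>a i\<close>, but its energy is also charged by its
  neighbours.  Since \<open>a l \<le> sqrt (M / c Z)\<close> for every neighbour \<open>l\<close> across \<open>Z\<close>, and
  \<open>sqrt (M * c Z) \<le> M / a i\<close>, the charges of one subdomain add up to at most \<open>M\<close>.
\<close>

lemma overlap_sum_bound:
  fixes q :: "'z \<Rightarrow> nat \<Rightarrow> real" and c :: "'z \<Rightarrow> real"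
  assumes J: "finite J" and \<Z>: "finite \<Z>" and I: "\<And>Z. Z \<in> \<Z> \<Longrightarrow> I Z \<subseteq> J"
    and c: "\<And>Z. Z \<in> \<Z> \<Longrightarrow> 0 < c Z"
    and a: "\<And>i. a i = real (card {Z \<in> \<Z>. i \<in> I Z})"
    and M: "0 \<le> M" "\<And>Z l. Z \<in> \<Z> \<Longrightarrow> l \<in> I Z \<Longrightarrow> (a l)\<^sup>2 * c Z \<le> M"
    and q: "\<And>Z l. Z \<in> \<Z> \<Longrightarrow> l \<in> I Z \<Longrightarrow> 0 \<le> q Z l"
    and e: "\<And>i. i \<in> J \<Longrightarrow> 0 \<le> e i" and t: "0 \<le> t"
    and le: "\<And>Z. Z \<in> \<Z> \<Longrightarrow> (\<Sum>l\<in>I Z. q Z l) \<le> 2 * c Z * t * (\<Sum>l\<in>I Z. e l)"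
  shows "(\<Sum>i\<in>J. a i * (\<Sum>Z\<in>{Z \<in> \<Z>. i \<in> I Z}. q Z i)) \<le> 2 * M * t * (\<Sum>i\<in>J. e i)"
proof -
  have IJ: "{i \<in> J. i \<in> I Z} = I Z" if "Z \<in> \<Z>" for Z using I[OF that] by blast
  have swap: "(\<Sum>i\<in>J. \<Sum>Z\<in>{Z \<in> \<Z>. i \<in> I Z}. f Z i) = (\<Sum>Z\<in>\<Z>. \<Sum>i\<in>I Z. f Z i)" for f :: "'z \<Rightarrow> nat \<Rightarrow> real"
    using sum.swap_restrict[OF J \<Z>, of "\<lambda>i Z. f Z i" "\<lambda>i Z. i \<in> I Z"] IJ by simp
  have "(\<Sum>i\<in>J. a i * (\<Sum>Z\<in>{Z \<in> \<Z>. i \<in> I Z}. q Z i)) = (\<Sum>Z\<in>\<Z>. \<Sum>i\<in>I Z. a i * q Z i)"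
    unfolding sum_distrib_left by (rule swap)
  also have "\<dots> \<le> (\<Sum>Z\<in>\<Z>. \<Sum>i\<in>I Z. 2 * t * (sqrt (M * c Z) * e i))"
  proof (rule sum_mono)
    fix Z assume Z: "Z \<in> \<Z>"
    have "a i \<le> sqrt (M / c Z)" if "i \<in> I Z" for i
      using M(2)[OF Z that] c[OF Z] by (intro real_le_rsqrt) (simp add: field_simps)
    then have "(\<Sum>i\<in>I Z. a i * q Z i) \<le> (\<Sum>i\<in>I Z. sqrt (M / c Z) * q Z i)"
      using q[OF Z] by (intro sum_mono mult_right_mono)
    also have "\<dots> \<le> sqrt (M / c Z) * (2 * c Z * t * (\<Sum>i\<in>I Z. e i))"
      unfolding sum_distrib_left[symmetric] using le[OF Z] c[OF Z] M(1) by (intro mult_left_mono) auto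
    also have "sqrt (M / c Z) * (2 * c Z * t * (\<Sum>i\<in>I Z. e i)) = 2 * t * (sqrt (M / c Z) * c Z) * (\<Sum>i\<in>I Z. e i)"
      by (simp add: mult_ac)
    also have "sqrt (M / c Z) * c Z = sqrt (M * c Z)"
      using c[OF Z] by (simp add: real_sqrt_divide real_sqrt_mult real_div_sqrt field_simps)
    finally show "(\<Sum>i\<in>I Z. a i * q Z i) \<le> (\<Sum>i\<in>I Z. 2 * t * (sqrt (M * c Z) * e i))"
      by (simp add: sum_distrib_left sum_distrib_right mult_ac)
  qed
  also have "\<dots> = (\<Sum>i\<in>J. \<Sum>Z\<in>{Z \<in> \<Z>. i \<in> I Z}. 2 * t * (sqrt (M * c Z) * e i))"
    by (rule swap[symmetric])
  also have "\<dots> \<le> (\<Sum>i\<in>J. 2 * t * (M * e i))"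
  proof (rule sum_mono)
    fix i assume i: "i \<in> J"
    let ?\<Z> = "{Z \<in> \<Z>. i \<in> I Z}"
    have "(\<Sum>Z\<in>?\<Z>. sqrt (M * c Z)) \<le> M"
    proof (cases "?\<Z> = {}")
      case False
      then have pos: "a i > 0" using \<Z> by (simp add: a card_gt_0_iff)
      have "sqrt (M * c Z) \<le> M / a i" if "Z \<in> ?\<Z>" for Z
      proof (rule real_le_lsqrt)
        have "M * ((a i)\<^sup>2 * c Z) \<le> M * M" using that M by (intro mult_left_mono) auto
        then show "M * c Z \<le> (M / a i)\<^sup>2"
          using pos by (simp add: field_simps power2_eq_square)
      qed (use M(1) pos in auto)
      then have "(\<Sum>Z\<in>?\<Z>. sqrt (M * c Z)) \<le> (\<Sum>Z\<in>?\<Z>. M / a i)" by (rule sum_mono)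
      also have "\<dots> = a i * (M / a i)" by (simp add: a)
      also have "\<dots> = M" using pos by simp
      finally show ?thesis .
    next
      case True
      then show ?thesis using M(1) by (simp only: sum.empty)
    qed
    then have "2 * t * ((\<Sum>Z\<in>?\<Z>. sqrt (M * c Z)) * e i) \<le> 2 * t * (M * e i)"
      using e[OF i] t by (intro mult_left_mono mult_right_mono) auto
    then show "(\<Sum>Z\<in>?\<Z>. 2 * t * (sqrt (M * c Z) * e i)) \<le> 2 * t * (M * e i)"
      by (simp add: sum_distrib_left sum_distrib_right)
  qed
  also have "\<dots> = 2 * M * t * (\<Sum>i\<in>J. e i)"
    by (simp add: sum_distrib_left sum_distrib_right mult_ac)
  finally show ?thesis .
qed


section \<open>The energy bound for the jump operator\<close>

context adaptive_feti_dp
begin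

lemma faces_of_eq: "faces_of i = {Z \<in> faces. i \<in> sharing Z}"
  and edges_of_eq: "edges_of i = {Z \<in> edges. i \<in> sharing Z}"
  by (simp_all add: faces_of_def edges_of_def)

text \<open>
  The constraint expressed by the transpose of \<open>U\<close>: the jumps of \<open>w\<close> across each face and edge are
  orthogonal to the selected eigenvectors.
\<close>

definition coarse_orthogonal :: "(dof \<Rightarrow> real) \<Rightarrow> bool" where
  "coarse_orthogonal w \<longleftrightarrow> (\<forall>Z\<in>faces \<union> edges. \<forall>l\<in>sharing Z. \<forall>k\<in>sharing Z. \<forall>s\<in>selected Z.
     bil Z (A_Z Z) (restr l w) (ev Z s) = bil Z (A_Z Z) (restr k w) (ev Z s))"

text \<open>
  Inside one subdomain the function \<open>P_D w\<close> is the sum of its parts on the faces and on the edges,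
  extended by zero.  Each of the two groups is bounded by the Cauchy--Schwarz inequality.
\<close>

lemma P_D_energy_split:
  fixes w
  defines "q \<equiv> \<lambda>Z i. bil Z (S_loc i) (weighted_jump Z (\<lambda>l. restr l w) i) (weighted_jump Z (\<lambda>l. restr l w) i)"
  shows "bil (W_nodes i) (S_loc i) (restr i (P_D w)) (restr i (P_D w))
    \<le> 2 * (real (card (faces_of i)) * (\<Sum>Z\<in>faces_of i. q Z i))
      + 2 * (real (card (edges_of i)) * (\<Sum>Z\<in>edges_of i. q Z i))"
proof -
  let ?W = "W_nodes i" and ?S = "S_loc i"
  define v where "v = (\<lambda>Z p. if p \<in> Z then weighted_jump Z (\<lambda>l. restr l w) i p else 0)"
  have fin: "finite (faces_of i)" "finite (edges_of i)" and disj: "faces_of i \<inter> edges_of i = {}"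
    using finite_faces_edges(1) faces_edges_disjoint by (auto simp: faces_of_eq edges_of_eq)
  have un: "{Z \<in> faces \<union> edges. i \<in> sharing Z} = faces_of i \<union> edges_of i"
    by (auto simp: faces_of_eq edges_of_eq)
  have W: "Z \<subseteq> ?W" if "Z \<in> faces_of i \<union> edges_of i" for Z
    using face_or_edge_subset_W_nodes[of Z i] that un by blast
  have restr: "restr i (P_D w) p = (\<Sum>Z\<in>faces_of i. v Z p) + (\<Sum>Z\<in>edges_of i. v Z p)" for p
  proof (cases "p \<in> vertices")
    case True
    then have "v Z p = 0" if "Z \<in> faces_of i \<union> edges_of i" for Z
      using face_or_edge_not_vertex[of Z p] that un by (auto simp: v_def)
    then show ?thesis using True by (simp add: restr_def P_D_Primal)
  next
    case False
    then have "restr i (P_D w) p = (\<Sum>Z\<in>faces_of i \<union> edges_of i. v Z p)"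
      unfolding restr_def P_D_Dual un v_def by simp
    then show ?thesis using sum.union_disjoint[OF fin disj] by simp
  qed
  have q: "bil ?W ?S (v Z) (v Z) = q Z i" if "Z \<in> faces_of i \<union> edges_of i" for Z
    unfolding v_def q_def by (rule bil_extend_zero[OF finite_W_nodes W[OF that]])
  have part: "bil ?W ?S (\<lambda>p. \<Sum>Z\<in>\<Z>. v Z p) (\<lambda>p. \<Sum>Z\<in>\<Z>. v Z p) \<le> card \<Z> * (\<Sum>Z\<in>\<Z>. q Z i)"
    if "finite \<Z>" "\<Z> \<subseteq> faces_of i \<union> edges_of i" for \<Z>
  proof -
    have "(\<Sum>Z\<in>\<Z>. bil ?W ?S (v Z) (v Z)) = (\<Sum>Z\<in>\<Z>. q Z i)"
      using that(2) by (intro sum.cong refl q) auto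
    then show ?thesis using psd_sum_bound[OF S_loc_psd that(1), of i v] by simp
  qed
  have "bil ?W ?S (restr i (P_D w)) (restr i (P_D w))
    = bil ?W ?S (\<lambda>p. (\<Sum>Z\<in>faces_of i. v Z p) + (\<Sum>Z\<in>edges_of i. v Z p))
        (\<lambda>p. (\<Sum>Z\<in>faces_of i. v Z p) + (\<Sum>Z\<in>edges_of i. v Z p))"
    by (intro bil_cong restr)
  also have "\<dots> \<le> 2 * bil ?W ?S (\<lambda>p. \<Sum>Z\<in>faces_of i. v Z p) (\<lambda>p. \<Sum>Z\<in>faces_of i. v Z p)
      + 2 * bil ?W ?S (\<lambda>p. \<Sum>Z\<in>edges_of i. v Z p) (\<lambda>p. \<Sum>Z\<in>edges_of i. v Z p)"
    by (rule psd_add_bound[OF S_loc_psd])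
  also have "\<dots> \<le> 2 * (real (card (faces_of i)) * (\<Sum>Z\<in>faces_of i. q Z i))
      + 2 * (real (card (edges_of i)) * (\<Sum>Z\<in>edges_of i. q Z i))"
    using part[of "faces_of i"] part[of "edges_of i"] fin by (intro add_mono mult_left_mono) auto
  finally show ?thesis .
qed

text \<open>
  Both groups are treated by \<open>overlap_sum_bound\<close> with the weight \<open>c Z\<close> equal to the number of
  subdomains sharing \<open>Z\<close> minus one, which is 1 on faces.  The two bounds add up to
  \<open>4 (MF + ME) \<le> 8 max MF ME\<close>.
\<close>

lemma P_D_energy_bound:
  assumes w: "coarse_orthogonal w"
  shows "bil dofs S_tilde (P_D w) (P_D w) \<le> C_const * max tol 0 * bil dofs S_tilde w w"
proof -
  let ?J = "{1..N}" and ?t = "max tol 0"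
  define q where "q = (\<lambda>Z i. bil Z (S_loc i) (weighted_jump Z (\<lambda>l. restr l w) i) (weighted_jump Z (\<lambda>l. restr l w) i))"
  define e where "e = (\<lambda>i. bil (W_nodes i) (S_loc i) (restr i w) (restr i w))"
  define c where "c = (\<lambda>Z. real (card (sharing Z) - 1))"
  define MF where "MF = (MAX i\<in>?J. card (faces_of i) ^ 2)"
  define ME where "ME = (MAX i\<in>?J. card (edges_of i) ^ 2 * (MAX E\<in>edges_of i. card (sharing E)))"
  have fin: "finite faces" "finite edges" using finite_faces_edges(1) by auto
  have e0: "0 \<le> e i" for i unfolding e_def by (rule psd_onD(2)[OF S_loc_psd])
  have q0: "0 \<le> q Z i" if "Z \<in> faces \<union> edges" "i \<in> sharing Z" for Z i
    unfolding q_def by (rule psd_onD(2)[OF S_loc_psd_on[OF that]])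
  have le: "(\<Sum>l\<in>sharing Z. q Z l) \<le> 2 * c Z * ?t * (\<Sum>l\<in>sharing Z. e l)" if "Z \<in> faces \<union> edges" for Z
    unfolding q_def e_def c_def
    by (rule weighted_jump_energy[OF that]) (use w that in \<open>unfold coarse_orthogonal_def, blast\<close>)
  have F: "(\<Sum>i\<in>?J. real (card (faces_of i)) * (\<Sum>Z\<in>faces_of i. q Z i)) \<le> 2 * real MF * ?t * (\<Sum>i\<in>?J. e i)"
    unfolding faces_of_eq
  proof (rule overlap_sum_bound[where c = c, OF _ fin(1) _ _ refl])
    fix Z l assume Z: "Z \<in> faces" and l: "l \<in> sharing Z"
    have "card (faces_of l) ^ 2 \<le> MF"
      unfolding MF_def using l sharing_subset[of Z] by (intro Max_ge) auto
    then have "real (card (faces_of l) ^ 2) \<le> real MF" by (rule of_nat_mono)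
    then show "(real (card {Z \<in> faces. l \<in> sharing Z}))\<^sup>2 * c Z \<le> real MF"
      using card_sharing_face[OF Z] by (simp add: c_def faces_of_eq)
  next
    fix Z assume "Z \<in> faces"
    then show "0 < c Z" using card_sharing_face[of Z] by (simp add: c_def)
  qed (use sharing_subset e0 q0 le in auto)
  have E: "(\<Sum>i\<in>?J. real (card (edges_of i)) * (\<Sum>Z\<in>edges_of i. q Z i)) \<le> 2 * real ME * ?t * (\<Sum>i\<in>?J. e i)"
    unfolding edges_of_eq
  proof (rule overlap_sum_bound[where c = c, OF _ fin(2) _ _ refl])
    fix Z l assume Z: "Z \<in> edges" and l: "l \<in> sharing Z"
    have Zl: "Z \<in> edges_of l" using Z l by (simp add: edges_of_eq)
    have "card (sharing Z) \<le> (MAX E\<in>edges_of l. card (sharing E))"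
      using Zl fin(2) by (intro Max_ge) (auto simp: edges_of_eq)
    then have "card (edges_of l) ^ 2 * (card (sharing Z) - 1)
        \<le> card (edges_of l) ^ 2 * (MAX E\<in>edges_of l. card (sharing E))"
      by (intro mult_le_mono2) simp
    also have "\<dots> \<le> ME"
      unfolding ME_def using l sharing_subset[of Z] by (intro Max_ge) auto
    finally have "real (card (edges_of l) ^ 2 * (card (sharing Z) - 1)) \<le> real ME" by (rule of_nat_mono)
    then show "(real (card {Z \<in> edges. l \<in> sharing Z}))\<^sup>2 * c Z \<le> real ME"
      by (simp only: c_def edges_of_eq of_nat_mult of_nat_power)
  next
    fix Z assume "Z \<in> edges"
    then show "0 < c Z" using card_sharing_edge[of Z] by (simp add: c_def)
  qed (use sharing_subset e0 q0 le in auto)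
  have "bil dofs S_tilde (P_D w) (P_D w)
      \<le> (\<Sum>i\<in>?J. 2 * (real (card (faces_of i)) * (\<Sum>Z\<in>faces_of i. q Z i))
          + 2 * (real (card (edges_of i)) * (\<Sum>Z\<in>edges_of i. q Z i)))"
    unfolding S_tilde_energy q_def by (intro sum_mono P_D_energy_split)
  also have "\<dots> = 2 * (\<Sum>i\<in>?J. real (card (faces_of i)) * (\<Sum>Z\<in>faces_of i. q Z i))
      + 2 * (\<Sum>i\<in>?J. real (card (edges_of i)) * (\<Sum>Z\<in>edges_of i. q Z i))"
    by (simp only: sum.distrib sum_distrib_left)
  also have "\<dots> \<le> 2 * (2 * real MF * ?t * (\<Sum>i\<in>?J. e i)) + 2 * (2 * real ME * ?t * (\<Sum>i\<in>?J. e i))"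
    by (intro add_mono mult_left_mono F E) simp_all
  also have "\<dots> = 4 * (real MF + real ME) * (?t * (\<Sum>i\<in>?J. e i))" by (simp add: algebra_simps)
  also have "\<dots> \<le> C_const * (?t * (\<Sum>i\<in>?J. e i))"
  proof (rule mult_right_mono)
    show "4 * (real MF + real ME) \<le> C_const"
      unfolding C_const_def MF_def[symmetric] ME_def[symmetric] by (simp add: max_def)
  qed (use e0 in \<open>simp add: sum_nonneg\<close>)
  finally show ?thesis
    unfolding S_tilde_energy e_def by (simp only: mult.assoc)
qed


section \<open>Eigenvalues of the preconditioned system\<close>

lemma S_tilde_inverse:
  assumes "\<alpha> \<in> dofs"
  shows "mv dofs S_tilde (mv dofs (pinv dofs S_tilde) h) \<alpha> = h \<alpha>"
proof (rule pinv_solves[OF finite_dofs psd_onD(1)[OF S_tilde_psd] _ assms])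
  fix y assume y: "\<And>\<alpha>. \<alpha> \<in> dofs \<Longrightarrow> mv dofs S_tilde y \<alpha> = 0"
  then have "bil dofs S_tilde y y = 0" by (simp add: bil_def dotp_def)
  then have "y \<alpha> = 0" if "\<alpha> \<in> dofs" for \<alpha> using S_tilde_positive[OF that, of y] by fastforce
  then show "dotp dofs h y = 0" by (simp add: dotp_def)
qed

text \<open>
  The solution of the partially assembled problem with the right-hand side generated by the
  multiplier \<open>z\<close>.
\<close>

definition primal :: "(multiplier \<Rightarrow> real) \<Rightarrow> dof \<Rightarrow> real" where
  "primal z = mv dofs (pinv dofs S_tilde) (mv mults (mtr B) z)"

lemma F_DP_eq_jump: "mv mults F_DP z = jump (primal z)"
  by (simp add: F_DP_def mv_mm primal_def jump_def)

lemma bil_S_tilde_primal: "bil dofs S_tilde (primal z) v = dotp mults z (jump v)"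
proof -
  have "bil dofs S_tilde (primal z) v = dotp dofs (mv mults (mtr B) z) v"
    unfolding bil_def primal_def using S_tilde_inverse by (intro dotp_cong) auto
  then show ?thesis by (simp add: dotp_mv_mtr jump_def)
qed

lemma bil_F_DP: "bil mults F_DP z y = bil dofs S_tilde (primal y) (primal z)"
  unfolding bil_S_tilde_primal by (simp add: bil_def F_DP_eq_jump dotp_commute)

lemma F_DP_psd: "psd_on mults F_DP"
proof -
  have "bil mults F_DP x y = bil mults F_DP y x" for x y
    unfolding bil_F_DP by (rule bil_commute[OF psd_onD(1)[OF S_tilde_psd]])
  moreover have "0 \<le> bil mults F_DP x x" for x
    unfolding bil_F_DP by (rule psd_onD(2)[OF S_tilde_psd])
  ultimately show ?thesis using symmetric_onI_bil[OF finite_mults] by (simp add: psd_on_def)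
qed

lemma bil_M_FETI: "bil mults M_FETI (jump w) (jump w) = bil dofs S_tilde (P_D w) (P_D w)"
  by (simp add: bil_def M_FETI_def mv_mm P_D_def dotp_mv_mtr[of mults])

lemma finite_cols: "finite cols"
proof -
  have "selected Z \<subseteq> {..<card Z}" for Z by (auto simp: selected_def)
  then have "finite (selected Z)" for Z using finite_subset by blast
  moreover have "cols \<subseteq> (SIGMA Z:faces \<union> edges. (sharing Z \<times> sharing Z) \<times> selected Z)"
    by (auto simp: cols_def)
  ultimately show ?thesis
    using finite_faces_edges(1) finite_sharing
    by (elim finite_subset) (intro finite_SigmaI finite_cartesian_product; simp)
qed

definition U_F_U :: "(pt set \<times> (nat \<times> nat) \<times> nat, pt set \<times> (nat \<times> nat) \<times> nat) fmat" where
  "U_F_U = mm mults (mtr U) (mm mults F_DP U)"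

definition coarse_residual :: "(multiplier \<Rightarrow> real) \<Rightarrow> pt set \<times> (nat \<times> nat) \<times> nat \<Rightarrow> real" where
  "coarse_residual x = mv mults (mtr U) (mv mults F_DP x)"

lemma bil_U_F_U: "bil cols U_F_U c d = bil mults F_DP (mv cols U c) (mv cols U d)"
  by (simp add: bil_def U_F_U_def mv_mm dotp_mv_mtr[of cols])

lemma U_F_U_psd: "psd_on cols U_F_U"
proof -
  have "bil cols U_F_U x y = bil cols U_F_U y x" for x y
    unfolding bil_U_F_U by (rule bil_commute[OF psd_onD(1)[OF F_DP_psd]])
  moreover have "0 \<le> bil cols U_F_U x x" for x
    unfolding bil_U_F_U by (rule psd_onD(2)[OF F_DP_psd])
  ultimately show ?thesis using symmetric_onI_bil[OF finite_cols] by (simp add: psd_on_def)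
qed

lemma P_apply: "mv mults P x = mv cols U (mv cols (pinv cols U_F_U) (coarse_residual x))"
  by (simp add: P_def mv_mm U_F_U_def[symmetric] coarse_residual_def)

lemma coarse_residual_mv_U: "coarse_residual (mv cols U c) = mv cols U_F_U c"
  by (simp add: coarse_residual_def U_F_U_def mv_mm)

lemma dotp_coarse_residual: "dotp cols (coarse_residual x) c = bil mults F_DP x (mv cols U c)"
  by (simp add: coarse_residual_def bil_def dotp_mv_mtr[of cols])

lemma coarse_residual_diff: "coarse_residual (\<lambda>i. x i - y i) = (\<lambda>c. coarse_residual x c - coarse_residual y c)"
  by (simp add: coarse_residual_def mv_diff)

text \<open>
  The coarse residual of any vector lies in the range of \<open>U_F_U\<close>, because \<open>F_DP\<close> is semidefinite;
  so the pseudo-inverse acts on it like an inverse.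
\<close>

lemma coarse_residual_complement:
  assumes "c \<in> cols"
  shows "coarse_residual (\<lambda>i. x i - mv mults P x i) c = 0"
proof -
  have "mv cols U_F_U (mv cols (pinv cols U_F_U) (coarse_residual x)) c = coarse_residual x c"
  proof (rule pinv_solves[OF finite_cols psd_onD(1)[OF U_F_U_psd] _ assms])
    fix y assume y: "\<And>i. i \<in> cols \<Longrightarrow> mv cols U_F_U y i = 0"
    then have "bil cols U_F_U y y = 0" by (simp add: bil_def dotp_def)
    then have "bil mults F_DP (mv cols U y) (mv cols U y) = 0" by (simp add: bil_U_F_U)
    then have "bil mults F_DP (mv cols U y) x = 0" by (rule psd_bil_zero[OF F_DP_psd])
    then show "dotp cols (coarse_residual x) y = 0"
      unfolding dotp_coarse_residual using bil_commute[OF psd_onD(1)[OF F_DP_psd]] by simp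
  qed
  then show ?thesis by (simp add: coarse_residual_diff P_apply coarse_residual_mv_U)
qed

lemma bil_F_DP_P:
  "bil mults F_DP x (mv mults P y) = bil cols (pinv cols U_F_U) (coarse_residual y) (coarse_residual x)"
  unfolding P_apply dotp_coarse_residual[symmetric] by (simp add: bil_def dotp_commute)

text \<open>
  \<open>F_DP P = F_DP U G U\<^sup>T F_DP\<close> is symmetric; that is, \<open>P\<close> is self-adjoint for \<open>F_DP\<close>.
\<close>

lemma bil_F_DP_P_commute: "bil mults F_DP x (mv mults P y) = bil mults F_DP (mv mults P x) y"
proof -
  have "symmetric_on cols (pinv cols U_F_U)"
    by (rule pinv_symmetric(2)[OF finite_cols psd_onD(1)[OF U_F_U_psd]])
  then show ?thesis
    unfolding bil_commute[OF psd_onD(1)[OF F_DP_psd], of "mv mults P x" y] bil_F_DP_P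
    by (rule bil_commute)
qed

definition IP :: "(multiplier, multiplier) fmat" where
  "IP = (\<lambda>m n. unit_mat m n - P m n)"

lemma mv_IP: "m \<in> mults \<Longrightarrow> mv mults IP x m = x m - mv mults P x m"
  by (simp add: IP_def mv_diff_mat mv_unit_mat[OF finite_mults])

lemma IP_transpose_F_DP:
  assumes "m \<in> mults"
  shows "mv mults (mtr IP) (mv mults F_DP x) m = mv mults F_DP (\<lambda>i. x i - mv mults P x i) m"
proof -
  let ?d = "\<lambda>m. mv mults (mtr IP) (mv mults F_DP x) m - mv mults F_DP (\<lambda>i. x i - mv mults P x i) m"
  have "dotp mults ?d v = 0" for v
  proof -
    have "dotp mults (mv mults (mtr IP) (mv mults F_DP x)) v = bil mults F_DP x (mv mults IP v)"
      by (simp add: dotp_mv_mtr[of mults mults "mtr IP"] bil_def)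
    also have "\<dots> = bil mults F_DP x (\<lambda>i. v i - mv mults P v i)"
      by (intro bil_cong refl mv_IP)
    also have "\<dots> = bil mults F_DP (\<lambda>i. x i - mv mults P x i) v"
      by (simp add: bil_diff bil_F_DP_P_commute)
    finally show ?thesis by (simp add: dotp_diff bil_def)
  qed
  from dotp_self_eq_0[OF finite_mults this assms] show ?thesis by simp
qed

text \<open>
  The values of \<open>F_DP\<close> are jumps and hence lie in the range of \<open>B\<close>.
\<close>

lemma P_B_fixes_F_DP:
  assumes "m \<in> mults"
  shows "mv mults P_B (mv mults F_DP x) m = mv mults F_DP x m"
proof -
  let ?y = "\<lambda>m. if m \<in> mults then mv dofs B (primal x) m else 0"
  have "?y \<in> mat_range mults dofs B" unfolding mat_range_def by blast
  then have "mv mults P_B ?y m = ?y m"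
    unfolding P_B_def
    by (rule orth_proj_fixes_range[OF finite_mults orth_proj_range[OF finite_mults finite_dofs] _ assms])
  moreover have "mv mults P_B ?y m = mv mults P_B (mv mults F_DP x) m"
    unfolding F_DP_eq_jump jump_def by (intro mv_cong) auto
  ultimately show ?thesis using assms by (simp add: F_DP_eq_jump jump_def)
qed

lemma preconditioned_system_apply:
  "mv mults preconditioned_system x
     = mv mults (mtr P_B) (mv mults IP (mv mults M_FETI (mv mults F_DP (\<lambda>i. x i - mv mults P x i))))"
proof -
  have "mv mults preconditioned_system x
     = mv mults (mtr P_B) (mv mults IP (mv mults M_FETI (mv mults (mtr IP) (mv mults P_B (mv mults F_DP x)))))"
    unfolding preconditioned_system_def M_PP_def IP_def[symmetric] Let_def by (simp add: mv_mm)
  also have "mv mults (mtr IP) (mv mults P_B (mv mults F_DP x)) = mv mults (mtr IP) (mv mults F_DP x)"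
    by (intro ext mv_cong refl P_B_fixes_F_DP)
  also have "mv mults M_FETI (mv mults (mtr IP) (mv mults F_DP x))
      = mv mults M_FETI (mv mults F_DP (\<lambda>i. x i - mv mults P x i))"
    by (intro ext mv_cong refl IP_transpose_F_DP)
  finally show ?thesis .
qed

text \<open>
  A column of \<open>U\<close> tests the jump across a single face or edge between a single pair of
  subdomains.
\<close>

lemma coarse_orthogonalI:
  assumes "\<And>c. c \<in> cols \<Longrightarrow> mv mults (mtr U) (jump w) c = 0"
  shows "coarse_orthogonal w"
proof -
  have less_pair: "bil Z (A_Z Z) (restr l w) (ev Z s) = bil Z (A_Z Z) (restr k w) (ev Z s)"
    if Z: "Z \<in> faces \<union> edges" and lk: "l \<in> sharing Z" "k \<in> sharing Z" "l < k" and s: "s \<in> selected Z"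
    for Z l k s
  proof -
    have "(Z, (l, k), s) \<in> cols" using Z lk s by (auto simp: cols_def)
    then have "0 = (\<Sum>m\<in>mults. U m (Z, (l, k), s) * jump w m)"
      using assms[of "(Z, (l, k), s)"] by (simp add: mv_def mtr_def)
    also have "\<dots> = (\<Sum>m\<in>(\<lambda>p. (Z, (l, k), p)) ` Z. U m (Z, (l, k), s) * jump w m)"
    proof (rule sum.mono_neutral_right[OF finite_mults])
      show "(\<lambda>p. (Z, (l, k), p)) ` Z \<subseteq> mults" using Z lk by (auto simp: mults_def)
      show "\<forall>m\<in>mults - (\<lambda>p. (Z, (l, k), p)) ` Z. U m (Z, (l, k), s) * jump w m = 0"
      proof
        fix m assume m: "m \<in> mults - (\<lambda>p. (Z, (l, k), p)) ` Z"
        obtain Z' lk' p where m': "m = (Z', lk', p)" by (cases m)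
        then have "p \<in> Z'" using m by (auto simp: mults_def)
        then have "\<not> (Z' = Z \<and> lk' = (l, k))" using m m' by blast
        then show "U m (Z, (l, k), s) * jump w m = 0" by (auto simp: m' U_def)
      qed
    qed
    also have "\<dots> = (\<Sum>p\<in>Z. mv Z (A_Z Z) (ev Z s) p * (restr l w p - restr k w p))"
    proof (subst sum.reindex)
      show "inj_on (\<lambda>p. (Z, (l, k), p)) Z" by (simp add: inj_on_def)
      show "sum ((\<lambda>m. U m (Z, (l, k), s) * jump w m) \<circ> (\<lambda>p. (Z, (l, k), p))) Z
        = (\<Sum>p\<in>Z. mv Z (A_Z Z) (ev Z s) p * (restr l w p - restr k w p))"
        by (intro sum.cong refl) (simp add: U_def jump_eq[OF Z lk] restr_on_face_or_edge[OF Z])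
    qed
    also have "\<dots> = bil Z (A_Z Z) (ev Z s) (restr l w) - bil Z (A_Z Z) (ev Z s) (restr k w)"
      unfolding bil_def dotp_def by (simp add: right_diff_distrib sum_subtractf)
    finally show ?thesis
      unfolding bil_commute[OF psd_onD(1)[OF A_Z_psd[OF Z]], of _ "ev Z s"] by simp
  qed
  show ?thesis
    unfolding coarse_orthogonal_def
  proof (intro ballI)
    fix Z l k s
    assume Z: "Z \<in> faces \<union> edges" and l: "l \<in> sharing Z" and k: "k \<in> sharing Z" and s: "s \<in> selected Z"
    show "bil Z (A_Z Z) (restr l w) (ev Z s) = bil Z (A_Z Z) (restr k w) (ev Z s)"
    proof (cases l k rule: linorder_cases)
      case less
      then show ?thesis by (rule less_pair[OF Z l k _ s])
    next
      case greater
      then show ?thesis by (rule less_pair[OF Z k l _ s, symmetric])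
    qed simp
  qed
qed

text \<open>
  For an eigenvector \<open>x\<close> let \<open>z = x - P x\<close> and let \<open>w\<close> be its primal counterpart, so that the jump of
  \<open>w\<close> is \<open>F_DP z\<close>.  Since the coarse residual of \<open>z\<close> vanishes, \<open>w\<close> satisfies the coarse constraints.
  Testing the eigenvalue equation with this jump turns it into
  \<open>\<mu> |w|\<^sup>2 = |P_D w|\<^sup>2\<close> in the norm of \<open>S_tilde\<close>.  The upper bound is the energy bound for \<open>P_D\<close>.  For the
  lower bound, \<open>P_D w\<close> and \<open>w\<close> have the same jumps, hence the inner product of \<open>P_D w\<close> and \<open>w\<close> is
  \<open>|w|\<^sup>2\<close>, and so \<open>|w| \<le> |P_D w|\<close>.
\<close>

lemma nonzero_eigenvalue_bounds:
  assumes "\<mu> \<in> nonzero_eigenvalues mults preconditioned_system"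
  shows "1 \<le> \<mu>" "\<mu> \<le> C_const * max tol 0"
proof -
  obtain x where \<mu>: "\<mu> \<noteq> 0" and x: "\<exists>m\<in>mults. x m \<noteq> 0"
    and eig: "\<And>m. m \<in> mults \<Longrightarrow> mv mults preconditioned_system x m = \<mu> * x m"
    using assms unfolding nonzero_eigenvalues_def eigenvalues_def by blast
  define z where "z = (\<lambda>i. x i - mv mults P x i)"
  define w where "w = primal z"
  let ?E = "bil dofs S_tilde"
  have Fz: "mv mults F_DP z = jump w" by (simp add: w_def F_DP_eq_jump)
  have Uz: "coarse_residual z c = 0" if "c \<in> cols" for c
    unfolding z_def by (rule coarse_residual_complement[OF that])
  have orth: "coarse_orthogonal w"
    by (rule coarse_orthogonalI) (use Uz in \<open>simp add: coarse_residual_def Fz\<close>)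
  have Pz: "mv mults P z m = 0" for m
  proof -
    have "mv cols (pinv cols U_F_U) (coarse_residual z) = mv cols (pinv cols U_F_U) (\<lambda>_. 0)"
      by (intro ext mv_cong refl Uz)
    then show ?thesis by (simp add: P_apply mv_zero)
  qed
  have ww: "?E w w = dotp mults z (jump w)" unfolding w_def by (rule bil_S_tilde_primal)
  \<comment> \<open>\<open>x\<close> may replace \<open>z\<close>, because \<open>P x\<close> is orthogonal to \<open>z\<close> for \<open>F_DP\<close>\<close>
  have "?E w w = dotp mults x (jump w)"
  proof -
    have "dotp mults (mv mults P x) (jump w) = bil mults F_DP z (mv mults P x)"
      by (simp add: bil_def Fz dotp_commute)
    also have "\<dots> = bil mults F_DP (mv mults P z) x" by (rule bil_F_DP_P_commute)
    also have "\<dots> = 0" using Pz by (simp add: bil_def dotp_def mv_def)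
    finally show ?thesis unfolding ww by (simp add: z_def dotp_diff)
  qed
  moreover have "\<mu> * dotp mults x (jump w) = ?E (P_D w) (P_D w)"
  proof -
    have "\<mu> * dotp mults x (jump w) = dotp mults (mv mults preconditioned_system x) (jump w)"
      unfolding dotp_scale(1)[symmetric] using eig by (intro dotp_cong) auto
    also have "\<dots> = dotp mults (mv mults IP (mv mults M_FETI (jump w))) (mv mults P_B (jump w))"
      unfolding preconditioned_system_apply z_def[symmetric] Fz
      by (simp add: dotp_mv_mtr[of mults mults "mtr P_B"])
    also have "\<dots> = dotp mults (mv mults IP (mv mults M_FETI (jump w))) (jump w)"
      using P_B_fixes_F_DP[of _ z] by (intro dotp_cong) (simp_all add: Fz)
    also have "\<dots> = dotp mults (mv mults M_FETI (jump w)) (mv mults (mtr IP) (jump w))"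
      by (rule dotp_mv_mtr)
    also have "\<dots> = dotp mults (mv mults M_FETI (jump w)) (jump w)"
      using IP_transpose_F_DP[of _ z] by (intro dotp_cong) (simp_all add: Fz Pz)
    finally show ?thesis using bil_M_FETI[of w] by (simp add: bil_def)
  qed
  ultimately have main: "\<mu> * ?E w w = ?E (P_D w) (P_D w)" by simp
  \<comment> \<open>otherwise the jump of \<open>w\<close>, and with it \<open>\<mu> x\<close>, would vanish\<close>
  have "0 < ?E w w"
  proof (rule ccontr)
    assume "\<not> 0 < ?E w w"
    then have "w \<alpha> = 0" if "\<alpha> \<in> dofs" for \<alpha> using S_tilde_positive[OF that, of w] by blast
    then have "jump w = jump (\<lambda>_. 0)" unfolding jump_def by (intro ext mv_cong) auto
    then have "jump w = (\<lambda>_. 0)" by (simp add: jump_def mv_zero)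
    then have "mv mults preconditioned_system x m = 0" for m
      unfolding preconditioned_system_apply z_def[symmetric] Fz by (simp add: mv_zero)
    then show False using eig \<mu> x by force
  qed
  note pos = this
  have "?E w w \<le> ?E (P_D w) (P_D w)"
  proof -
    have "?E w (P_D w) = ?E w w"
      unfolding w_def bil_S_tilde_primal using jump_P_D by (intro dotp_cong) auto
    moreover have "0 \<le> ?E (\<lambda>\<alpha>. P_D w \<alpha> - w \<alpha>) (\<lambda>\<alpha>. P_D w \<alpha> - w \<alpha>)"
      by (rule psd_onD(2)[OF S_tilde_psd])
    ultimately show ?thesis
      using bil_commute[OF psd_onD(1)[OF S_tilde_psd], of "P_D w" w] by (simp add: bil_diff)
  qed
  then show "1 \<le> \<mu>" using pos main by (metis mult_le_cancel_right1 mult.commute not_less)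
  have "\<mu> * ?E w w \<le> (C_const * max tol 0) * ?E w w"
    unfolding main by (rule P_D_energy_bound[OF orth])
  then show "\<mu> \<le> C_const * max tol 0" using pos by simp
qed

end

theorem theorem2:
  fixes \<Omega> :: "pt set" and T :: "pt set set" and N :: nat and sub :: "nat \<Rightarrow> pt set set"
    and \<rho> :: "pt \<Rightarrow> real" and D :: "pt set \<Rightarrow> nat \<Rightarrow> (pt, pt) fmat"
    and ev :: "pt set \<Rightarrow> nat \<Rightarrow> pt \<Rightarrow> real" and lam :: "pt set \<Rightarrow> nat \<Rightarrow> ereal" and tol :: real
  assumes "adaptive_feti_dp \<Omega> T N sub \<rho> D ev lam"
    and "nonzero_eigenvalues (feti_dp.mults \<Omega> T N sub)
           (adaptive_feti_dp.preconditioned_system \<Omega> T N sub \<rho> D ev lam tol) \<noteq> {}"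
  shows "cond_number (feti_dp.mults \<Omega> T N sub)
           (adaptive_feti_dp.preconditioned_system \<Omega> T N sub \<rho> D ev lam tol)
         \<le> decomposed_mesh.C_const \<Omega> T N sub * tol"
proof -
  interpret adaptive_feti_dp \<Omega> T N sub \<rho> D ev lam tol by (rule assms(1))
  let ?E = "nonzero_eigenvalues mults preconditioned_system"
  have fin: "finite ?E"
    unfolding nonzero_eigenvalues_def using finite_eigenvalues[OF finite_mults] by (rule finite_Diff)
  have max_in: "Max ?E \<in> ?E" and min_in: "Min ?E \<in> ?E" using fin assms(2) by simp_all
  note max = nonzero_eigenvalue_bounds[OF max_in] and min = nonzero_eigenvalue_bounds[OF min_in]
  \<comment> \<open>for \<open>tol \<le> 0\<close> the two bounds would contradict each other\<close>
  have "tol > 0"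
  proof (rule ccontr)
    assume "\<not> tol > 0"
    then have "max tol 0 = 0" by simp
    then show False using max by simp
  qed
  have "cond_number mults preconditioned_system \<le> Max ?E"
    unfolding cond_number_def using max(1) min(1) by (simp add: divide_le_eq mult_le_cancel_left1)
  also have "\<dots> \<le> C_const * tol" using max(2) \<open>tol > 0\<close> by simp
  finally show ?thesis .
qed

end
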